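(* Let $n\ge 3$ and let $Y$ be a closed subscheme of $\mathbb{P}^{n-1}$ of dimension $\le 1$, with saturated homogeneous ideal $I_Y\subset R=K[x_1,\dots,x_n]$. Assume that for some $d>r_2(R/I_Y)$ $$\Delta H(R/I_Y,d)=\Delta H(R/I_Y,d+1)=s\ne 0.$$ Then the ideal $\langle (I_Y)_{\le d}\rangle$ is $d$-regular, and it is a saturated ideal defining a one-dimensional scheme of degree $s$ in $\mathbb{P}^{n-1}$.
   Context: $K$ is a field of characteristic $0$, $R=K[x_1,\dots,x_n]$ with the standard grading, $\mathbb{P}^{n-1}=\operatorname{Proj} R$. $H(R/I,t)=\dim_K (R/I)_t$ and $\Delta H(R/I,t)=H(R/I,t)-H(R/I,t-1)$. For a homogeneous ideal $I$ and $s\ge\dim(R/I)$, the $s$-reduction number is $r_s(R/I)=\max\{k : H(R/(I+J),k)\ne 0\}$, where $J$ is generated by $s$ general linear forms. $\langle (I_Y)_{\le d}\rangle$ is the ideal generated by the elements of $I_Y$ of degree $\le d$. A homogeneous ideal $I$ is $m$-regular if for all $p\ge 0$ every $p$-th syzygy in the minimal free resolution of $I$ has degree $\le m+p$. *)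

theory Defs
  imports
    "HOL-Library.Poly_Mapping"
    "HOL-Library.Extended_Real"
    "HOL-Library.FuncSet"
    "HOL-Library.Cardinality"
    "HOL-Computational_Algebra.Polynomial"
    "Jordan_Normal_Form.Matrix_Kernel"
begin

section \<open>The polynomial ring\<close>

text \<open>
  For a finite index type \<open>'n\<close>, the type \<open>('k, 'n) mpol\<close> is the whole ring $K[x_1,\dots,x_n]$
  with $n$ = \<open>CARD('n)\<close>; a polynomial is its finitely supported coefficient function on exponent
  vectors, and ring addition and multiplication are those of \<open>Poly_Mapping\<close>.
\<close>

type_synonym ('k, 'n) mpol = "('n \<Rightarrow>\<^sub>0 nat) \<Rightarrow>\<^sub>0 'k"

definition Const :: "'k::field \<Rightarrow> ('k, 'n) mpol" where
  "Const c = Poly_Mapping.single 0 c"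

definition Var :: "'n \<Rightarrow> ('k::field, 'n) mpol" where
  "Var i = Poly_Mapping.single (Poly_Mapping.single i 1) 1"

definition mdeg :: "('n::finite \<Rightarrow>\<^sub>0 nat) \<Rightarrow> nat" where
  "mdeg m = (\<Sum>i\<in>UNIV. Poly_Mapping.lookup m i)"

text \<open>The graded piece $R_t$ (it contains the zero polynomial).\<close>

definition forms :: "nat \<Rightarrow> ('k::field, 'n::finite) mpol set" where
  "forms t = {f. \<forall>m\<in>Poly_Mapping.keys f. mdeg m = t}"

definition polys_le :: "nat \<Rightarrow> ('k::field, 'n::finite) mpol set" where
  "polys_le t = {f. \<forall>m\<in>Poly_Mapping.keys f. mdeg m \<le> t}"


section \<open>Ideals\<close>

text \<open>
  A commutative ring is a module over itself: its submodules are the ideals, and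
  the submodule spanned by a set is the ideal generated by it.
\<close>

global_interpretation ring_ideal: Modules.module "(*) :: 'a::comm_ring_1 \<Rightarrow> 'a \<Rightarrow> 'a"
  by unfold_locales (auto simp: algebra_simps)

abbreviation is_ideal :: "'a::comm_ring_1 set \<Rightarrow> bool" where
  "is_ideal \<equiv> ring_ideal.subspace"

abbreviation ideal_gen :: "'a::comm_ring_1 set \<Rightarrow> 'a set" where
  "ideal_gen \<equiv> ring_ideal.span"

definition prime_ideal :: "'a::comm_ring_1 set \<Rightarrow> bool" where
  "prime_ideal P \<longleftrightarrow> is_ideal P \<and> 1 \<notin> P \<and> (\<forall>f g. f * g \<in> P \<longrightarrow> f \<in> P \<or> g \<in> P)"

definition homogeneous_ideal :: "('k::field, 'n::finite) mpol set \<Rightarrow> bool" where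
  "homogeneous_ideal I \<longleftrightarrow> (\<exists>G \<subseteq> (\<Union>t. forms t). I = ideal_gen G)"

text \<open>$\langle I_{\le d}\rangle$\<close>

definition truncated_ideal :: "nat \<Rightarrow> ('k::field, 'n::finite) mpol set \<Rightarrow> ('k, 'n) mpol set" where
  "truncated_ideal d I = ideal_gen (I \<inter> polys_le d)"

text \<open>
  $I^{\mathrm{sat}} = \{f : \mathfrak m^k f \subseteq I \mbox{ for some } k\}$ with
  $\mathfrak m = (x_1,\dots,x_n)$; the ideal $\mathfrak m^k$ is generated by \<open>forms k\<close>.
\<close>

definition saturation :: "('k::field, 'n::finite) mpol set \<Rightarrow> ('k, 'n) mpol set" where
  "saturation I = {f. \<exists>k. \<forall>g\<in>forms k. g * f \<in> I}"

definition saturated_ideal :: "('k::field, 'n::finite) mpol set \<Rightarrow> bool" where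
  "saturated_ideal I \<longleftrightarrow> homogeneous_ideal I \<and> saturation I = I"


section \<open>The closed subscheme of projective space defined by a homogeneous ideal\<close>

text \<open>
  The points of $\mathrm{Proj}(R/I)$: homogeneous primes containing $I$ but not all of
  $(x_1,\dots,x_n)$.
\<close>

definition proj_points :: "('k::field, 'n::finite) mpol set \<Rightarrow> ('k, 'n) mpol set set" where
  "proj_points I = {P. prime_ideal P \<and> homogeneous_ideal P \<and> I \<subseteq> P \<and> \<not> range Var \<subseteq> P}"

text \<open>
  The Krull dimension of the underlying space of $\mathrm{Proj}(R/I)$. Its irreducible closed
  subsets are the closures of its points, so chains of them are chains of points for inclusion
  of primes. The empty scheme has dimension \<open>- \<infinity>\<close>.
\<close>

definition scheme_dim :: "('k::field, 'n::finite) mpol set \<Rightarrow> ereal" where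
  "scheme_dim I = (SUP l \<in> {l::nat. \<exists>P. (\<forall>i\<le>l. P i \<in> proj_points I) \<and> (\<forall>i<l. P i \<subset> P (Suc i))}.
     ereal (real l))"


section \<open>Hilbert functions\<close>

text \<open>
  \<open>B\<close> is a set of elements of $R_t$ whose residue classes form a $K$-basis of $(R/I)_t$:
  every residue class has unique coordinates. In particular distinct elements of \<open>B\<close> have
  distinct classes, so \<open>card B\<close> is $\dim_K (R/I)_t$.
\<close>

definition residue_basis ::
    "('k::field, 'n::finite) mpol set \<Rightarrow> nat \<Rightarrow> ('k, 'n) mpol set \<Rightarrow> bool" where
  "residue_basis I t B \<longleftrightarrow> finite B \<and> B \<subseteq> forms t \<and>
     (\<forall>f\<in>forms t. \<exists>!c. c \<in> B \<rightarrow>\<^sub>E UNIV \<and> f - (\<Sum>b\<in>B. Const (c b) * b) \<in> I)"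

definition hilbert_function :: "('k::field, 'n::finite) mpol set \<Rightarrow> nat \<Rightarrow> nat" where
  "hilbert_function I t = (THE h. \<exists>B. residue_basis I t B \<and> card B = h)"

text \<open>$(R/I)_{-1} = 0$, and the difference is taken in the integers.\<close>

definition delta_hilbert :: "('k::field, 'n::finite) mpol set \<Rightarrow> nat \<Rightarrow> int" where
  "delta_hilbert I t =
     int (hilbert_function I t) - (if t = 0 then 0 else int (hilbert_function I (t - 1)))"

definition hilbert_polynomial :: "('k::field, 'n::finite) mpol set \<Rightarrow> rat poly" where
  "hilbert_polynomial I =
     (THE p. \<exists>t0. \<forall>t\<ge>t0. poly p (of_nat t) = of_nat (hilbert_function I t))"

text \<open>
  The degree of a nonempty projective scheme of dimension $r$ is $r!$ times the leading coefficient
  of its Hilbert polynomial, which has degree $r$.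
\<close>

definition scheme_degree :: "('k::field, 'n::finite) mpol set \<Rightarrow> rat" where
  "scheme_degree I =
     fact (Polynomial.degree (hilbert_polynomial I)) * lead_coeff (hilbert_polynomial I)"


section \<open>General linear forms and reduction numbers\<close>

definition eval_mpol :: "('v \<Rightarrow> 'k) \<Rightarrow> ('k::field, 'v) mpol \<Rightarrow> 'k" where
  "eval_mpol a g = (\<Sum>m\<in>Poly_Mapping.keys g. Poly_Mapping.lookup g m * (\<Prod>v\<in>Poly_Mapping.keys m. a v ^ Poly_Mapping.lookup m v))"

text \<open>Zariski-open subsets of the affine space $K^A$, i.e. complements of common zero loci.\<close>

definition zariski_open :: "'v set \<Rightarrow> ('v \<Rightarrow> 'k::field) set \<Rightarrow> bool" where
  "zariski_open A U \<longleftrightarrow> (\<exists>G. (\<forall>g\<in>G. \<forall>m\<in>Poly_Mapping.keys g. Poly_Mapping.keys m \<subseteq> A) \<and>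
     U = {a \<in> A \<rightarrow>\<^sub>E UNIV. \<not> (\<forall>g\<in>G. eval_mpol a g = 0)})"

text \<open>A coefficient vector in $K^{s \times n}$ encodes $s$ linear forms.\<close>

definition linear_forms :: "nat \<Rightarrow> (nat \<times> 'n \<Rightarrow> 'k) \<Rightarrow> ('k::field, 'n::finite) mpol set" where
  "linear_forms s a = (\<lambda>i. \<Sum>j\<in>UNIV. Const (a (i, j)) * Var j) ` {..<s}"

definition for_general_linear_forms ::
    "nat \<Rightarrow> (('k::field, 'n::finite) mpol set \<Rightarrow> bool) \<Rightarrow> bool" where
  "for_general_linear_forms s Q \<longleftrightarrow>
     (\<exists>U. zariski_open ({..<s} \<times> UNIV) U \<and> U \<noteq> {} \<and> (\<forall>a\<in>U. Q (linear_forms s a)))"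

text \<open>
  For infinite $K$, at most one \<open>r\<close> fits the description, since any two nonempty open sets meet;
  for $s \ge \dim(R/I)$ and $I \ne R$ there is one.
\<close>

definition reduction_number :: "nat \<Rightarrow> ('k::field, 'n::finite) mpol set \<Rightarrow> nat" where
  "reduction_number s I = (THE r. for_general_linear_forms s (\<lambda>L.
     hilbert_function (ideal_gen (I \<union> L)) r \<noteq> 0 \<and>
     (\<forall>k. hilbert_function (ideal_gen (I \<union> L)) k \<noteq> 0 \<longrightarrow> k \<le> r)))"


section \<open>Minimal free resolutions and regularity\<close>

text \<open>
  A minimal graded free resolution
  $\cdots \to F_1 \to F_0 \to I \to 0$, $F_p = \bigoplus_{i < r_p} R(-a_{p,i})$.
  The matrix \<open>D 0\<close>, with a single row, is the map $F_0 \to R$ with image $I$, and \<open>D (p + 1)\<close>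
  is the map $F_{p+1} \to F_p$. The conditions are, in order: the sizes of the matrices; the maps
  preserve degrees; the image of the augmentation is \<open>I\<close>; exactness; and minimality, i.e. the
  entries of the maps between the free modules lie in $(x_1,\dots,x_n)$. Minimality and exactness
  make the generators, hence all basis elements, have nonnegative degrees \<open>a p i\<close>, and finite
  length is not imposed (the modules $F_p$ may be zero).
\<close>

definition minimal_free_resolution :: "('k::field, 'n::finite) mpol set \<Rightarrow>
    (nat \<Rightarrow> nat) \<Rightarrow> (nat \<Rightarrow> nat \<Rightarrow> nat) \<Rightarrow> (nat \<Rightarrow> ('k, 'n) mpol mat) \<Rightarrow> bool" where
  "minimal_free_resolution I r a D \<longleftrightarrow>
     D 0 \<in> carrier_mat 1 (r 0) \<and> (\<forall>p. D (Suc p) \<in> carrier_mat (r p) (r (Suc p))) \<and>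
     (\<forall>j<r 0. D 0 $$ (0, j) \<in> forms (a 0 j)) \<and>
     (\<forall>p. \<forall>i<r p. \<forall>j<r (Suc p). \<forall>m\<in>Poly_Mapping.keys (D (Suc p) $$ (i, j)).
        mdeg m + a p i = a (Suc p) j) \<and>
     {(D 0 *\<^sub>v v) $ 0 | v. v \<in> carrier_vec (r 0)} = I \<and>
     (\<forall>p. mat_kernel (D p) = {D (Suc p) *\<^sub>v v | v. v \<in> carrier_vec (r (Suc p))}) \<and>
     (\<forall>p. \<forall>i<r p. \<forall>j<r (Suc p). D (Suc p) $$ (i, j) \<in> ideal_gen (range Var))"

text \<open>
  A minimal free resolution of a homogeneous ideal exists and is unique up to isomorphism of
  graded complexes, so the degrees of the $p$-th syzygies do not depend on the choice.
\<close>

definition regular_ideal :: "nat \<Rightarrow> ('k::field, 'n::finite) mpol set \<Rightarrow> bool" where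
  "regular_ideal m I \<longleftrightarrow>
     (\<exists>r a D. minimal_free_resolution I r a D \<and> (\<forall>p. \<forall>i<r p. a p i \<le> m + p))"

end

theory Submission
  imports Defs "HOL-Library.Function_Algebras"
begin

text \<open>
  Choose linear forms \<open>\<ell>\<^sub>1, \<ell>\<^sub>2\<close> such that \<open>\<ell>\<^sub>1\<close> is injective on \<open>(R/I)\<^sub>d\<close> and \<open>(I, \<ell>\<^sub>1, \<ell>\<^sub>2)\<^sub>d = R\<^sub>d\<close>. Let \<open>J\<close> be the
  ideal generated by \<open>I\<^sub>\<le>\<^sub>d\<close>. Multiplication by \<open>\<ell>\<^sub>2\<close> maps \<open>(R/(J, \<ell>\<^sub>1))\<^sub>d\<close> onto \<open>(R/(J, \<ell>\<^sub>1))\<^sub>d\<^sub>+\<^sub>1\<close>. The first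
  space has dimension \<open>s\<close> and the second has dimension at least \<open>s\<close>, because \<open>(R/(I, \<ell>\<^sub>1))\<^sub>d\<^sub>+\<^sub>1\<close> is a
  quotient of it, so the map is bijective. Thus \<open>J\<close> and \<open>\<ell>\<^sub>1, \<ell>\<^sub>2\<close> satisfy the regularity criterion of
  Bayer and Stillman in degree \<open>d\<close>, and the injectivity statements of the criterion propagate to all
  degrees \<open>\<ge> d\<close>. They give the degree bounds for the syzygies, show that \<open>\<ell>\<^sub>1\<close> is a nonzerodivisor on
  \<open>R/J\<close>, so that \<open>J\<close> is saturated, and show that the Hilbert function of \<open>R/J\<close> grows by exactly \<open>s\<close>
  in each step from degree \<open>d\<close> on.

  The reduction number is a maximum attained for general \<open>\<ell>\<^sub>1, \<ell>\<^sub>2\<close>. That \<open>R/(I, \<ell>\<^sub>1, \<ell>\<^sub>2)\<close> has finite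
  length for some \<open>\<ell>\<^sub>1, \<ell>\<^sub>2\<close> is seen without Noetherian arguments: a homogeneous ideal that is maximal
  among those \<open>P \<supseteq> I\<close> for which \<open>R/(P, \<ell>\<^sub>1, \<dots>, \<ell>\<^sub>k)\<close> has infinite length for all \<open>\<ell>\<^sub>1, \<dots>, \<ell>\<^sub>k\<close> is
  prime, and enlarging it by linear forms gives a chain of \<open>k + 1\<close> primes.
\<close>

section \<open>Dimensions of quotient spaces\<close>

text \<open>The obstacle in the choice of the forms is that one pair has to meet two generic
  conditions. The condition on (I, l1, l2) is open in the coefficients, whereas injectivity of l1 on
  (R/I)_d has to come from saturation alone. Associated primes are replaced by McCoy's theorem for a
  one-parameter family of linear forms, and the same family is started at a pair that satisfies the
  open condition, so that each condition excludes only finitely many parameters.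

  The criterion is run with \<open>cut_cond\<close> because the quotient of J \<inter> Y_i by Y_i J
  is Tor_1(R/J, R/Y_i), where Y_i = (y_0, ..., y_(i-1)). The vanishing for a syzygy module follows
  from the vanishing for the preceding module one degree lower, which is the origin of the bound d +
  p. Since \<open>regular_ideal\<close> asks for an actual resolution, one is built along the way;
  finite generation of its modules is itself read off from the cut conditions.\<close>

locale linear_space = vector_space scale
  for scale :: "'a::field \<Rightarrow> 'b::ab_group_add \<Rightarrow> 'b" (infixr "*s" 75)
begin

definition finite_span :: "'b set \<Rightarrow> bool" where
  "finite_span V \<longleftrightarrow> (\<exists>S. finite S \<and> V \<subseteq> local.span S)"

text \<open>Quotients V/U are not formed: a basis of V/U is represented by a finite subset of V that
  is independent and spanning modulo U. This is the format of \<open>residue_basis\<close>.\<close>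

definition indep_mod :: "'b set \<Rightarrow> 'b set \<Rightarrow> bool" where
  "indep_mod U B \<longleftrightarrow> (\<forall>c. (\<Sum>b\<in>B. c b *s b) \<in> U \<longrightarrow> (\<forall>b\<in>B. c b = 0))"

definition span_mod :: "'b set \<Rightarrow> 'b set \<Rightarrow> 'b set \<Rightarrow> bool" where
  "span_mod U B V \<longleftrightarrow> (\<forall>v\<in>V. \<exists>c. v - (\<Sum>b\<in>B. c b *s b) \<in> U)"

lemma finite_span_mono: "finite_span V \<Longrightarrow> W \<subseteq> V \<Longrightarrow> finite_span W"
  unfolding finite_span_def by blast

lemma finite_span_basis:
  assumes "finite_span V"
  obtains B where "finite B" "B \<subseteq> V" "local.independent B" "V \<subseteq> local.span B" "card B = local.dim V"
proof -
  obtain S where S: "finite S" "V \<subseteq> local.span S" using assms unfolding finite_span_def by auto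
  obtain B where B: "B \<subseteq> V" "local.independent B" "V \<subseteq> local.span B" "card B = local.dim V"
    using basis_exists[of V] by blast
  have "B \<subseteq> local.span S" using B(1) S(2) by blast
  then have "finite B" using independent_span_bound[OF S(1) B(2)] by auto
  with B that show ?thesis by blast
qed

lemma independent_card_le_dim_finite_span:
  assumes "finite_span V" "local.independent B" "B \<subseteq> V"
  shows "finite B" "card B \<le> local.dim V"
proof -
  obtain C where C: "finite C" "C \<subseteq> V" "local.independent C" "V \<subseteq> local.span C" "card C = local.dim V"
    using finite_span_basis[OF assms(1)] .
  have "B \<subseteq> local.span C" using assms(3) C(4) by blast
  from independent_span_bound[OF C(1) assms(2) this] C(5) show "finite B" "card B \<le> local.dim V" by auto
qed

text \<open>\<open>B\<close> together with a basis of \<open>U\<close> is independent in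
  \<open>V\<close>. The union is disjoint because an element of \<open>B\<close> in \<open>U\<close>
  would be a relation modulo \<open>U\<close>.\<close>

lemma card_le_dim_quotient:
  assumes V: "finite_span V" and U: "local.subspace U" "U \<subseteq> V"
    and B: "finite B" "B \<subseteq> V" "indep_mod U B"
  shows "card B + local.dim U \<le> local.dim V"
proof -
  obtain C where C: "finite C" "C \<subseteq> U" "local.independent C" "U \<subseteq> local.span C" "card C = local.dim U"
    using finite_span_basis[OF finite_span_mono[OF V U(2)]] .
  have disj: "B \<inter> C = {}"
  proof (rule ccontr)
    assume "B \<inter> C \<noteq> {}"
    then obtain x where x: "x \<in> B" "x \<in> C" by auto
    have "(\<Sum>b\<in>B. (if b = x then 1 else 0) *s b) = (\<Sum>b\<in>B. if b = x then b else 0)"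
      by (rule sum.cong) auto
    also have "\<dots> = x" using x B(1) by simp
    also have "x \<in> U" using x C(2) by auto
    finally have "(\<Sum>b\<in>B. (if b = x then 1 else 0) *s b) \<in> U" .
    then have "\<forall>b\<in>B. (if b = x then 1 else 0) = (0::'a)"
      by (rule B(3)[unfolded indep_mod_def, rule_format, THEN ballI])
    then show False using x(1) by auto
  qed
  have "local.independent (B \<union> C)"
  proof (rule independent_if_scalars_zero)
    show "finite (B \<union> C)" using B C by auto
    fix f x assume s: "(\<Sum>x\<in>B \<union> C. f x *s x) = 0" and x: "x \<in> B \<union> C"
    have eq: "(\<Sum>x\<in>B. f x *s x) + (\<Sum>x\<in>C. f x *s x) = 0"
      using s sum.union_disjoint[OF B(1) C(1) disj, of "\<lambda>x. f x *s x"] by simp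
    have cU: "(\<Sum>x\<in>C. f x *s x) \<in> U"
      by (rule subspace_sum[OF U(1)]) (use C(2) U(1) in \<open>auto intro: subspace_scale\<close>)
    have "(\<Sum>x\<in>B. f x *s x) = - (\<Sum>x\<in>C. f x *s x)" using eq by (simp add: eq_neg_iff_add_eq_0)
    then have "(\<Sum>x\<in>B. f x *s x) \<in> U" using cU subspace_neg[OF U(1)] by simp
    then have fB: "\<forall>b\<in>B. f b = 0" using B(3) unfolding indep_mod_def by blast
    then have "(\<Sum>x\<in>C. f x *s x) = 0" using eq by simp
    then have "\<forall>b\<in>C. f b = 0" using independentD[OF C(3,1) subset_refl] by blast
    with fB x show "f x = 0" by auto
  qed
  from independent_card_le_dim_finite_span(2)[OF V this] B(2) C(2) U(2)
  have "card (B \<union> C) \<le> local.dim V" by auto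
  then show ?thesis using card_Un_disjoint[OF B(1) C(1) disj] C(5) by simp
qed

lemma dim_quotient_le_card:
  assumes V: "finite_span V" and U: "local.subspace U" "U \<subseteq> V"
    and B: "finite B" "span_mod U B V"
  shows "local.dim V \<le> card B + local.dim U"
proof -
  obtain C where C: "finite C" "C \<subseteq> U" "local.independent C" "U \<subseteq> local.span C" "card C = local.dim U"
    using finite_span_basis[OF finite_span_mono[OF V U(2)]] .
  have "V \<subseteq> local.span (B \<union> C)"
  proof
    fix v assume "v \<in> V"
    then obtain c where c: "v - (\<Sum>b\<in>B. c b *s b) \<in> U" using B(2) unfolding span_mod_def by blast
    then have "v - (\<Sum>b\<in>B. c b *s b) \<in> local.span (B \<union> C)" using C(4) span_mono[of C "B \<union> C"] by blast
    moreover have "(\<Sum>b\<in>B. c b *s b) \<in> local.span (B \<union> C)"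
      by (rule span_sum) (auto intro: span_scale span_base)
    ultimately show "v \<in> local.span (B \<union> C)" using span_add by fastforce
  qed
  from dim_le_card[OF this] B(1) C(1) have "local.dim V \<le> card (B \<union> C)" by simp
  also have "\<dots> \<le> card B + card C" by (rule card_Un_le)
  finally show ?thesis using C(5) by simp
qed

lemma quotient_basis_exists:
  assumes V: "finite_span V" "local.subspace V" and U: "local.subspace U" "U \<subseteq> V"
  obtains B where "finite B" "B \<subseteq> V" "indep_mod U B" "span_mod U B V" "card B + local.dim U = local.dim V"
proof -
  obtain C where C: "finite C" "C \<subseteq> U" "local.independent C" "U \<subseteq> local.span C" "card C = local.dim U"
    using finite_span_basis[OF finite_span_mono[OF V(1) U(2)]] .
  obtain D where D: "C \<subseteq> D" "D \<subseteq> V" "local.independent D" "V \<subseteq> local.span D"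
    using maximal_independent_subset_extend[of C V] C U(2) by (metis order_trans)
  have fD: "finite D" using independent_card_le_dim_finite_span(1)[OF V(1) D(3,2)] .
  define B where "B = D - C"
  have fB: "finite B" and BV: "B \<subseteq> V" using fD D(2) by (auto simp: B_def)
  have DBC: "D = B \<union> C" "B \<inter> C = {}" using D(1) by (auto simp: B_def)
  have Usp: "U = local.span C" using C U(1) by (simp add: span_subspace)
  have ind: "indep_mod U B" unfolding indep_mod_def
  proof (intro allI impI)
    fix c assume "(\<Sum>b\<in>B. c b *s b) \<in> U"
    then obtain e where e: "(\<Sum>b\<in>B. c b *s b) = (\<Sum>b\<in>C. e b *s b)"
      unfolding Usp span_finite[OF C(1)] by auto
    define f where "f b = (if b \<in> B then c b else - e b)" for b
    have "(\<Sum>b\<in>C. f b *s b) = (\<Sum>b\<in>C. - (e b *s b))"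
      by (rule sum.cong) (use DBC(2) in \<open>auto simp: f_def\<close>)
    moreover have "(\<Sum>b\<in>B. f b *s b) = (\<Sum>b\<in>B. c b *s b)"
      by (rule sum.cong) (auto simp: f_def)
    ultimately have "(\<Sum>b\<in>D. f b *s b) = 0"
      unfolding DBC(1) using sum.union_disjoint[OF fB C(1) DBC(2), of "\<lambda>b. f b *s b"] e
      by (simp add: sum_negf)
    then have "\<forall>b\<in>D. f b = 0" using independentD[OF D(3) fD subset_refl] by blast
    then show "\<forall>b\<in>B. c b = 0" unfolding DBC(1) f_def by (metis UnI1)
  qed
  have sp: "span_mod U B V" unfolding span_mod_def
  proof
    fix v assume "v \<in> V"
    then obtain f where f: "v = (\<Sum>b\<in>D. f b *s b)" using D(4) unfolding span_finite[OF fD] by auto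
    then have "v = (\<Sum>b\<in>B. f b *s b) + (\<Sum>b\<in>C. f b *s b)"
      unfolding DBC(1) using sum.union_disjoint[OF fB C(1) DBC(2), of "\<lambda>b. f b *s b"] by simp
    then have "v - (\<Sum>b\<in>B. f b *s b) = (\<Sum>b\<in>C. f b *s b)" by simp
    also have "\<dots> \<in> U" unfolding Usp by (auto intro: span_sum span_scale span_base)
    finally show "\<exists>c. v - (\<Sum>b\<in>B. c b *s b) \<in> U" by blast
  qed
  have "card B + local.dim U = local.dim V"
    using card_le_dim_quotient[OF V(1) U fB BV ind] dim_quotient_le_card[OF V(1) U fB sp] by simp
  with fB BV ind sp that show ?thesis by blast
qed

lemma card_quotient_basis:
  assumes "finite_span V" "local.subspace U" "U \<subseteq> V"
    "finite B" "B \<subseteq> V" "indep_mod U B" "span_mod U B V"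
  shows "card B = local.dim V - local.dim U"
  using card_le_dim_quotient[OF assms(1-6)] dim_quotient_le_card[OF assms(1-4,7)] by simp

lemma dim_mono_finite_span:
  assumes "finite_span V" "local.subspace U" "U \<subseteq> V"
  shows "local.dim U \<le> local.dim V"
  using card_le_dim_quotient[OF assms, of "{}"] by (simp add: indep_mod_def)

lemma subspace_eq_if_dim_le:
  assumes V: "finite_span V" "local.subspace V" and U: "local.subspace U" "U \<subseteq> V" and le: "local.dim V \<le> local.dim U"
  shows "U = V"
proof (rule ccontr)
  assume "U \<noteq> V"
  then obtain v where v: "v \<in> V" "v \<notin> U" using U by auto
  have "indep_mod U {v}" unfolding indep_mod_def
  proof (intro allI impI ballI)
    fix c b assume c: "(\<Sum>b\<in>{v}. c b *s b) \<in> U" and b: "b \<in> {v}"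
    show "c b = 0"
    proof (rule ccontr)
      assume "c b \<noteq> 0"
      then have "inverse (c v) *s (c v *s v) = v" using b by simp
      then show False using subspace_scale[OF U(1), of "c v *s v" "inverse (c v)"] c v(2) by simp
    qed
  qed
  from card_le_dim_quotient[OF V(1) U _ _ this] v(1) le show False by simp
qed

text \<open>The images of representatives of a basis of V/U span V'/U'.\<close>

lemma quotient_dim_le_if_surj:
  assumes f: "Vector_Spaces.linear scale scale f"
    and V: "finite_span V" "local.subspace V" and U: "local.subspace U" "U \<subseteq> V"
    and V': "finite_span V'" and U': "local.subspace U'" "U' \<subseteq> V'"
    and fU: "\<And>u. u \<in> U \<Longrightarrow> f u \<in> U'"
    and surj: "\<And>w. w \<in> V' \<Longrightarrow> \<exists>v\<in>V. w - f v \<in> U'"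
  shows "local.dim V' - local.dim U' \<le> local.dim V - local.dim U"
proof -
  interpret f: Vector_Spaces.linear scale scale f by (rule f)
  obtain B where B: "finite B" "B \<subseteq> V" "indep_mod U B" "span_mod U B V" "card B + local.dim U = local.dim V"
    using quotient_basis_exists[OF V U] .
  have "local.dim V' \<le> card (f ` B) + local.dim U'"
  proof -
    obtain C where C: "finite C" "C \<subseteq> U'" "local.independent C" "U' \<subseteq> local.span C" "card C = local.dim U'"
      using finite_span_basis[OF finite_span_mono[OF V' U'(2)]] .
    have "V' \<subseteq> local.span (f ` B \<union> C)"
    proof
      fix w assume "w \<in> V'"
      then obtain v where v: "v \<in> V" "w - f v \<in> U'" using surj by blast
      obtain c where c: "v - (\<Sum>b\<in>B. c b *s b) \<in> U" using B(4) v(1) unfolding span_mod_def by blast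
      have "w = (w - f v) + f (v - (\<Sum>b\<in>B. c b *s b)) + (\<Sum>b\<in>B. c b *s f b)"
        by (simp add: f.diff f.sum f.scale)
      moreover have "w - f v \<in> local.span (f ` B \<union> C)"
        using v(2) C(4) span_mono[of C "f ` B \<union> C"] by blast
      moreover have "f (v - (\<Sum>b\<in>B. c b *s b)) \<in> local.span (f ` B \<union> C)"
        using fU[OF c] C(4) span_mono[of C "f ` B \<union> C"] by blast
      moreover have "(\<Sum>b\<in>B. c b *s f b) \<in> local.span (f ` B \<union> C)"
        by (rule span_sum) (auto intro: span_scale span_base)
      ultimately show "w \<in> local.span (f ` B \<union> C)" by (metis span_add)
    qed
    from dim_le_card[OF this] B(1) C(1) have "local.dim V' \<le> card (f ` B \<union> C)" by simp
    also have "\<dots> \<le> card (f ` B) + card C" by (rule card_Un_le)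
    finally show ?thesis using C(5) by simp
  qed
  also have "card (f ` B) \<le> card B" using B(1) by (rule card_image_le)
  finally show ?thesis using B(5) by simp
qed

lemma quotient_dim_le_if_inj:
  assumes f: "Vector_Spaces.linear scale scale f"
    and V: "finite_span V" "local.subspace V" and U: "local.subspace U" "U \<subseteq> V"
    and V': "finite_span V'" and U': "local.subspace U'" "U' \<subseteq> V'"
    and fV: "\<And>v. v \<in> V \<Longrightarrow> f v \<in> V'"
    and inj: "\<And>v. v \<in> V \<Longrightarrow> f v \<in> U' \<Longrightarrow> v \<in> U"
  shows "local.dim V - local.dim U \<le> local.dim V' - local.dim U'"
proof -
  interpret f: Vector_Spaces.linear scale scale f by (rule f)
  obtain B where B: "finite B" "B \<subseteq> V" "indep_mod U B" "span_mod U B V" "card B + local.dim U = local.dim V"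
    using quotient_basis_exists[OF V U] .
  have lc: "(\<Sum>b\<in>B. c b *s b) \<in> V" for c
    by (rule subspace_sum[OF V(2)]) (use B(2) V(2) subspace_scale in blast)
  have key: "\<forall>b\<in>B. c b = 0" if "(\<Sum>b\<in>B. c b *s f b) \<in> U'" for c
  proof -
    have "f (\<Sum>b\<in>B. c b *s b) \<in> U'" using that by (simp add: f.sum f.scale)
    then have "(\<Sum>b\<in>B. c b *s b) \<in> U" using inj lc by blast
    then show ?thesis using B(3) unfolding indep_mod_def by blast
  qed
  have injB: "inj_on f B"
  proof (rule inj_onI, rule ccontr)
    fix x y assume xy: "x \<in> B" "y \<in> B" "f x = f y" "x \<noteq> y"
    define c where "c b = (if b = x then 1 else if b = y then - 1 else (0::'a))" for b
    have "(\<Sum>b\<in>B. c b *s f b) = (\<Sum>b\<in>B. (if b = x then f x else 0) + (if b = y then - f y else 0))"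
      by (rule sum.cong) (use xy in \<open>auto simp: c_def\<close>)
    also have "\<dots> = 0" using xy B(1) by (simp add: sum.distrib)
    finally have "\<forall>b\<in>B. c b = 0" using key subspace_0[OF U'(1)] by simp
    then show False using xy(1) by (auto simp: c_def)
  qed
  have "indep_mod U' (f ` B)" unfolding indep_mod_def
  proof (intro allI impI)
    fix c assume "(\<Sum>b\<in>f ` B. c b *s b) \<in> U'"
    then have "(\<Sum>b\<in>B. c (f b) *s f b) \<in> U'" using sum.reindex[OF injB, of "\<lambda>b. c b *s b"] by simp
    from key[of "\<lambda>b. c (f b)", OF this] show "\<forall>b\<in>f ` B. c b = 0" by auto
  qed
  from card_le_dim_quotient[OF V' U' _ _ this] B(1,2) fV have "card (f ` B) + local.dim U' \<le> local.dim V'" by auto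
  then show ?thesis using card_image[OF injB] B(5) by simp
qed

text \<open>The preimage \<open>W\<close> of U' in V contains U, and V/W still maps onto V'/U'. The
  dimension bound leaves no room between U and \<open>W\<close>.\<close>

lemma inj_if_surj_quotient:
  assumes f: "Vector_Spaces.linear scale scale f"
    and V: "finite_span V" "local.subspace V" and U: "local.subspace U" "U \<subseteq> V"
    and V': "finite_span V'" and U': "local.subspace U'" "U' \<subseteq> V'"
    and fU: "\<And>u. u \<in> U \<Longrightarrow> f u \<in> U'"
    and surj: "\<And>w. w \<in> V' \<Longrightarrow> \<exists>v\<in>V. w - f v \<in> U'"
    and le: "local.dim V - local.dim U \<le> local.dim V' - local.dim U'"
    and v: "v \<in> V" "f v \<in> U'"
  shows "v \<in> U"
proof -
  interpret f: Vector_Spaces.linear scale scale f by (rule f)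
  define W where "W = {v\<in>V. f v \<in> U'}"
  have "W = V \<inter> {v. f v \<in> U'}" by (auto simp: W_def)
  then have W: "local.subspace W" "W \<subseteq> V"
    using subspace_inter[OF V(2) f.subspace_linear_preimage[OF U'(1)]] by (auto simp: W_def)
  have UW: "U \<subseteq> W" using fU U(2) unfolding W_def by auto
  have "local.dim V' - local.dim U' \<le> local.dim V - local.dim W"
    by (rule quotient_dim_le_if_surj[OF f V W V' U' _ surj]) (auto simp: W_def)
  moreover have "local.dim W \<le> local.dim V" "local.dim U \<le> local.dim V" using dim_mono_finite_span V(1) W U by blast+
  ultimately have "local.dim W \<le> local.dim U" using le by linarith
  then have "U = W" using subspace_eq_if_dim_le[OF finite_span_mono[OF V(1) W(2)] W(1) U(1) UW] by simp
  then show ?thesis using v by (simp add: W_def)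
qed

end

section \<open>Homogeneous components and homogeneous ideals\<close>

abbreviation lk :: "('a \<Rightarrow>\<^sub>0 'b::zero) \<Rightarrow> 'a \<Rightarrow> 'b" where "lk \<equiv> Poly_Mapping.lookup"
abbreviation ks :: "('a \<Rightarrow>\<^sub>0 'b::zero) \<Rightarrow> 'a set" where "ks \<equiv> Poly_Mapping.keys"

lemma mdeg_0 [simp]: "mdeg 0 = 0"
  by (simp add: mdeg_def)

lemma mdeg_add [simp]: "mdeg (a + b) = mdeg a + mdeg b"
  by (simp add: mdeg_def lookup_add sum.distrib)

lemma mdeg_single [simp]: "mdeg (Poly_Mapping.single i k) = k"
  by (simp add: mdeg_def lookup_single when_def)

lemma mdeg_eq_0_iff [simp]: "mdeg m = 0 \<longleftrightarrow> m = 0"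
  by (auto simp: mdeg_def intro: poly_mapping_eqI)

lemma Const_0 [simp]: "Const 0 = 0" and Const_1 [simp]: "Const 1 = 1"
  and Const_add: "Const (a + b) = Const a + Const b"
  and Const_mult: "Const (a * b) = Const a * Const b"
  and Const_uminus: "Const (- a) = - Const a" and Const_diff: "Const (a - b) = Const a - Const b"
  by (simp_all add: Const_def single_add mult_single single_uminus single_diff)

lemma lookup_single_mult_add:
  fixes f :: "('n \<Rightarrow>\<^sub>0 nat) \<Rightarrow>\<^sub>0 'k::field"
  shows "lk (Poly_Mapping.single a c * f) (a + m) = c * lk f m"
proof -
  have "lk (Poly_Mapping.single a c * f) (a + m) =
     (\<Sum>l. (c when a = l) * (\<Sum>q. lk f q when a + m = l + q))"
    unfolding lookup_mult lookup_single ..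
  also have "\<dots> = (\<Sum>l. (c * (\<Sum>q. lk f q when a + m = l + q)) when a = l)"
    unfolding when_mult by (simp only: eq_commute)
  also have "\<dots> = c * (\<Sum>q. lk f q when a + m = a + q)"
    by (rule Sum_any_when_equal')
  also have "\<dots> = c * lk f m" by (simp only: add_left_cancel Sum_any_when_equal')
  finally show ?thesis .
qed

lemma lookup_Const_mult [simp]: "lk (Const c * f) m = c * lk f m"
  for f :: "('k::field, 'n) mpol"
  using lookup_single_mult_add[of 0 c f m] by (simp add: Const_def)

lemma forms_iff: "f \<in> forms t \<longleftrightarrow> (\<forall>m. lk f m \<noteq> 0 \<longrightarrow> mdeg m = t)"
  by (auto simp: forms_def in_keys_iff)

lemma forms_0 [simp]: "0 \<in> forms t"
  by (simp add: forms_iff)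

lemma forms_add: "f \<in> forms t \<Longrightarrow> g \<in> forms t \<Longrightarrow> f + g \<in> forms t"
  unfolding forms_iff lookup_add by (metis add_0)

lemma forms_diff: "f \<in> forms t \<Longrightarrow> g \<in> forms t \<Longrightarrow> f - g \<in> forms t"
  unfolding forms_iff lookup_minus by (metis diff_0_right)

lemma forms_sum: "(\<And>i. i \<in> A \<Longrightarrow> f i \<in> forms t) \<Longrightarrow> sum f A \<in> forms t"
  by (induction A rule: infinite_finite_induct) (auto intro: forms_add)

lemma forms_mult:
  fixes f g :: "('k::field, 'n::finite) mpol"
  assumes "f \<in> forms s" "g \<in> forms t"
  shows "f * g \<in> forms (s + t)"
  using keys_mult[of f g] assms unfolding forms_def by fastforce

lemma forms_Const [simp]: "Const c \<in> forms 0"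
  by (auto simp: forms_def Const_def)

lemma forms_1 [simp]: "1 \<in> forms 0"
  using forms_Const[of 1] by simp

lemma forms_Const_mult: "f \<in> forms t \<Longrightarrow> Const c * f \<in> forms t"
  using forms_mult[OF forms_Const, of f t c] by simp

lemma forms_Var [simp]: "Var i \<in> forms 1" "Var i \<in> forms (Suc 0)"
  by (auto simp: forms_def Var_def)

lemma forms_power: "f \<in> forms s \<Longrightarrow> f ^ k \<in> forms (k * s)"
  by (induction k) (auto intro: forms_mult)

lemma forms_zero_is_Const:
  assumes "f \<in> forms 0"
  shows "f = Const (lk f 0)"
proof (rule poly_mapping_eqI)
  fix m show "lk f m = lk (Const (lk f 0)) m"
    using assms by (cases "m = 0") (auto simp: forms_iff Const_def lookup_single)
qed

text \<open>Homogeneous component; \<open>mapp\<close> supplies the finite support.\<close>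

definition hc :: "nat \<Rightarrow> ('k::field, 'n::finite) mpol \<Rightarrow> ('k, 'n) mpol" where
  "hc t f = Poly_Mapping.mapp (\<lambda>m c. c when mdeg m = t) f"

lemma lookup_hc [simp]: "lk (hc t f) m = (if mdeg m = t then lk f m else 0)"
  by (auto simp: hc_def lookup_mapp when_def in_keys_iff)

lemma hc_in_forms [simp]: "hc t f \<in> forms t"
  by (simp add: forms_iff)

lemma hc_0 [simp]: "hc t 0 = 0"
  by (rule poly_mapping_eqI) simp

lemma hc_add: "hc t (f + g) = hc t f + hc t g"
  by (rule poly_mapping_eqI) (simp add: lookup_add)

lemma hc_diff: "hc t (f - g) = hc t f - hc t g"
  by (rule poly_mapping_eqI) (simp add: lookup_minus)

lemma hc_sum: "hc t (sum f A) = (\<Sum>i\<in>A. hc t (f i))"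
  by (induction A rule: infinite_finite_induct) (auto simp: hc_add)

lemma hc_forms: "f \<in> forms s \<Longrightarrow> hc t f = (if s = t then f else 0)"
proof (rule poly_mapping_eqI)
  fix m assume "f \<in> forms s"
  then have "lk f m = 0 \<or> mdeg m = s" unfolding forms_iff by blast
  then show "lk (hc t f) m = lk (if s = t then f else 0) m" by auto
qed

lemma sum_hc: "f = (\<Sum>t\<in>mdeg ` ks f. hc t f)"
proof (rule poly_mapping_eqI)
  fix m
  show "lk f m = lk (\<Sum>t\<in>mdeg ` ks f. hc t f) m"
  proof (cases "m \<in> ks f")
    case True
    then have "mdeg m \<in> mdeg ` ks f" by blast
    then show ?thesis by (simp add: lookup_sum sum.delta)
  next
    case False
    then show ?thesis by (simp add: lookup_sum in_keys_iff)
  qed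
qed

lemma hc_mult:
  assumes g: "g \<in> forms s"
  shows "hc u (g * f) = (if s \<le> u then g * hc (u - s) f else 0)"
proof -
  have "hc u (g * f) = (\<Sum>t\<in>mdeg ` ks f. hc u (g * hc t f))"
    by (subst sum_hc[of f]) (simp add: sum_distrib_left hc_sum)
  also have "\<dots> = (\<Sum>t\<in>mdeg ` ks f. if s + t = u then g * hc t f else 0)"
    by (rule sum.cong) (auto simp: hc_forms[OF forms_mult[OF g hc_in_forms]])
  also have "\<dots> = (if s \<le> u then g * hc (u - s) f else 0)"
  proof (cases "s \<le> u")
    case True
    have "(\<Sum>t\<in>mdeg ` ks f. if s + t = u then g * hc t f else 0) =
      (\<Sum>t\<in>mdeg ` ks f. if t = u - s then g * hc t f else 0)"
      by (rule sum.cong) (use True in auto)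
    also have "\<dots> = (if u - s \<in> mdeg ` ks f then g * hc (u - s) f else 0)"
      by (simp add: sum.delta)
    also have "\<dots> = g * hc (u - s) f"
    proof -
      have "hc (u - s) f = 0" if "u - s \<notin> mdeg ` ks f"
      proof (rule poly_mapping_eqI)
        fix k
        have "lk f k = 0" if "mdeg k = u - s"
          using that \<open>u - s \<notin> mdeg ` ks f\<close> by (metis imageI in_keys_iff)
        then show "lk (hc (u - s) f) k = lk 0 k" by simp
      qed
      then show ?thesis by auto
    qed
    finally show ?thesis using True by simp
  next
    case False
    then have "(\<Sum>t\<in>mdeg ` ks f. if s + t = u then g * hc t f else 0) = 0"
      by (intro sum.neutral) auto
    with False show ?thesis by simp
  qed
  finally show ?thesis .
qed

lemma hc_mult_add: "g \<in> forms s \<Longrightarrow> hc (s + t) (g * f) = g * hc t f"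
  by (simp add: hc_mult)

text \<open>The definition speaks of homogeneous generators. Together with
  \<open>homogeneous_idealI\<close> this trades it for closure under components, the form in which
  homogeneity is used below.\<close>

lemma homogeneous_idealD:
  assumes "homogeneous_ideal I"
  shows "is_ideal I" "\<And>f t. f \<in> I \<Longrightarrow> hc t f \<in> I"
proof -
  obtain G where G: "G \<subseteq> (\<Union>t. forms t)" "I = ideal_gen G"
    using assms unfolding homogeneous_ideal_def by blast
  show "is_ideal I" using G(2) by simp
  fix f t assume "f \<in> I"
  then have "f \<in> ideal_gen G" using G(2) by simp
  then have "hc t f \<in> ideal_gen G"
  proof (induction f rule: ring_ideal.span_induct_alt)
    case base show ?case by (simp add: ring_ideal.span_zero)
  next
    case (step c x y)
    obtain s where "x \<in> forms s" using G(1) step(1) by blast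
    then have "hc t (c * x) = (if s \<le> t then hc (t - s) c * x else 0)"
      using hc_mult[of x s t c] by (simp add: mult.commute)
    then have "hc t (c * x) \<in> ideal_gen G"
      using step(1) by (simp add: ring_ideal.span_zero ring_ideal.span_scale ring_ideal.span_base)
    then show ?case using step(2) by (simp add: hc_add ring_ideal.span_add)
  qed
  then show "hc t f \<in> I" using G(2) by simp
qed

lemma homogeneous_idealI:
  assumes I: "is_ideal I" and hc: "\<And>f t. f \<in> I \<Longrightarrow> hc t f \<in> I"
  shows "homogeneous_ideal I"
  unfolding homogeneous_ideal_def
proof (intro exI conjI)
  show "I \<inter> (\<Union>t. forms t) \<subseteq> (\<Union>t. forms t)" by blast
  show "I = ideal_gen (I \<inter> (\<Union>t. forms t))"
  proof
    show "ideal_gen (I \<inter> (\<Union>t. forms t)) \<subseteq> I"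
      by (rule ring_ideal.span_minimal) (use I in auto)
    show "I \<subseteq> ideal_gen (I \<inter> (\<Union>t. forms t))"
    proof
      fix f assume "f \<in> I"
      then have "hc t f \<in> ideal_gen (I \<inter> (\<Union>t. forms t))" for t
        using hc hc_in_forms by (intro ring_ideal.span_base) blast
      then have "(\<Sum>t\<in>mdeg ` ks f. hc t f) \<in> ideal_gen (I \<inter> (\<Union>t. forms t))"
        by (intro ring_ideal.span_sum)
      then show "f \<in> ideal_gen (I \<inter> (\<Union>t. forms t))" using sum_hc[of f] by simp
    qed
  qed
qed

lemma homogeneous_ideal_gen:
  assumes "G \<subseteq> (\<Union>t. forms t)"
  shows "homogeneous_ideal (ideal_gen G)"
  using assms unfolding homogeneous_ideal_def by blast

lemma homogeneous_ideal_mem_iff: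
  assumes "homogeneous_ideal I"
  shows "f \<in> I \<longleftrightarrow> (\<forall>t. hc t f \<in> I)"
proof
  assume "\<forall>t. hc t f \<in> I"
  then have "(\<Sum>t\<in>mdeg ` ks f. hc t f) \<in> I"
    by (intro ring_ideal.subspace_sum[OF homogeneous_idealD(1)[OF assms]]) auto
  then show "f \<in> I" using sum_hc[of f] by simp
qed (use homogeneous_idealD(2)[OF assms] in blast)

lemma ideal_mult_right: "is_ideal I \<Longrightarrow> f \<in> I \<Longrightarrow> g * f \<in> I"
  and ideal_mult_left: "is_ideal I \<Longrightarrow> f \<in> I \<Longrightarrow> f * g \<in> I"
  using ring_ideal.subspace_scale[of I f g] by (simp_all add: mult.commute)

lemma ideal_gen_Un:
  assumes "is_ideal I"
  shows "ideal_gen (I \<union> G) = {x + y |x y. x \<in> I \<and> y \<in> ideal_gen G}"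
  unfolding ring_ideal.span_Un using assms by (simp add: ring_ideal.span_eq_iff[THEN iffD2])

lemma homogeneous_ideal_gen_Un:
  assumes "homogeneous_ideal I" "G \<subseteq> (\<Union>t. forms t)"
  shows "homogeneous_ideal (ideal_gen (I \<union> G))"
proof -
  obtain H where H: "H \<subseteq> (\<Union>t. forms t)" "I = ideal_gen H"
    using assms(1) unfolding homogeneous_ideal_def by blast
  have "ideal_gen (I \<union> G) = ideal_gen (H \<union> G)"
    unfolding H(2) by (simp add: ring_ideal.span_Un ring_ideal.span_span)
  then show ?thesis using homogeneous_ideal_gen[of "H \<union> G"] H(1) assms(2) by simp
qed

lemma ideal_gen_insert_iff:
  assumes "is_ideal I"
  shows "f \<in> ideal_gen (insert l I) \<longleftrightarrow> (\<exists>v. f - l * v \<in> I)"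
  using ring_ideal.span_breakdown_eq[of f l I] assms
  by (simp add: ring_ideal.span_eq_iff[THEN iffD2] mult.commute)

lemma homogeneous_ideal_gen_insert:
  assumes "homogeneous_ideal I" "l \<in> forms e"
  shows "homogeneous_ideal (ideal_gen (insert l I))"
  using homogeneous_ideal_gen_Un[OF assms(1), of "{l}"] assms(2) by auto

text \<open>Any cofactor of \<open>l\<close> may be replaced by its component of degree
  \<open>t\<close>, because I is closed under components.\<close>

lemma ideal_gen_insert_forms:
  assumes I: "homogeneous_ideal I" and l: "l \<in> forms e"
    and w: "w \<in> ideal_gen (insert l I)" "w \<in> forms (t + e)"
  obtains v where "v \<in> forms t" "w - l * v \<in> I"
proof -
  obtain v where v: "w - l * v \<in> I"
    using w(1) ideal_gen_insert_iff[OF homogeneous_idealD(1)[OF I]] by blast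
  have "hc (t + e) (w - l * v) \<in> I" using homogeneous_idealD(2)[OF I v] .
  then have "w - l * hc t v \<in> I"
    using hc_forms[OF w(2), of "t + e"] hc_mult_add[OF l, of t v] by (simp add: hc_diff add.commute)
  with that show ?thesis by (metis hc_in_forms)
qed

section \<open>Graded pieces and Hilbert functions\<close>

definition mon :: "('n \<Rightarrow>\<^sub>0 nat) \<Rightarrow> ('k::field, 'n) mpol" where
  "mon m = Poly_Mapping.single m 1"

lemma mon_expansion: "f = (\<Sum>m\<in>ks f. Const (lk f m) * mon m)"
proof (rule poly_mapping_eqI)
  fix k
  have "lk (\<Sum>m\<in>ks f. Const (lk f m) * mon m) k = (\<Sum>m\<in>ks f. lk f m * (if m = k then 1 else 0))"
    by (simp add: lookup_sum mon_def lookup_single when_def)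
  also have "\<dots> = (\<Sum>m\<in>ks f. if m = k then lk f k else 0)" by (rule sum.cong) auto
  also have "\<dots> = lk f k" by (simp add: in_keys_iff)
  finally show "lk f k = lk (\<Sum>m\<in>ks f. Const (lk f m) * mon m) k" ..
qed

lemma mon_in_forms: "mon m \<in> forms (mdeg m)"
  by (auto simp: mon_def forms_def)

lemma mon_add: "mon (a + b) = mon a * mon b"
  by (simp add: mon_def mult_single)

lemma Var_eq_mon: "Var i = mon (Poly_Mapping.single i 1)"
  by (simp add: Var_def mon_def)

lemma finite_mdeg_eq: "finite {m :: 'n::finite \<Rightarrow>\<^sub>0 nat. mdeg m = t}"
proof -
  have "lk ` {m :: 'n \<Rightarrow>\<^sub>0 nat. mdeg m = t} \<subseteq> (UNIV :: 'n set) \<rightarrow>\<^sub>E {..t}"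
  proof -
    have "lk m i \<le> mdeg m" for m :: "'n \<Rightarrow>\<^sub>0 nat" and i
      unfolding mdeg_def by (rule member_le_sum) auto
    then show ?thesis by auto
  qed
  then have "finite (lk ` {m :: 'n \<Rightarrow>\<^sub>0 nat. mdeg m = t})"
    by (rule finite_subset) (simp add: finite_PiE)
  then show ?thesis by (rule finite_imageD) (simp add: inj_on_def)
qed

global_interpretation kvs: linear_space "\<lambda>c f. Const c * f :: ('k::field, 'n::finite) mpol"
  by unfold_locales
    (simp_all only: distrib_left distrib_right Const_add Const_mult mult.assoc Const_1 mult_1_left)

lemma finite_span_forms: "kvs.finite_span (forms t :: ('k::field, 'n::finite) mpol set)"
  unfolding kvs.finite_span_def
proof (intro exI conjI)
  show "finite (mon ` {m :: 'n::finite \<Rightarrow>\<^sub>0 nat. mdeg m = t} :: ('k, 'n) mpol set)"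
    by (intro finite_imageI finite_mdeg_eq)
  show "forms t \<subseteq> kvs.span (mon ` {m. mdeg m = t} :: ('k, 'n) mpol set)"
  proof
    fix f :: "('k, 'n) mpol" assume f: "f \<in> forms t"
    have "(\<Sum>m\<in>ks f. Const (lk f m) * mon m) \<in> kvs.span (mon ` {m. mdeg m = t})"
      by (intro kvs.span_sum kvs.span_scale kvs.span_base) (use f in \<open>auto simp: forms_def\<close>)
    then show "f \<in> kvs.span (mon ` {m. mdeg m = t})" using mon_expansion[of f] by simp
  qed
qed

lemma subspace_forms: "kvs.subspace (forms t :: ('k::field, 'n::finite) mpol set)"
  by (auto simp: kvs.subspace_def forms_add forms_Const_mult)

lemma subspace_ideal: "is_ideal I \<Longrightarrow> kvs.subspace I"
  by (auto simp: kvs.subspace_def ring_ideal.subspace_def)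

lemma subspace_ideal_forms: "is_ideal I \<Longrightarrow> kvs.subspace (I \<inter> forms t)"
  by (intro kvs.subspace_inter subspace_ideal subspace_forms)

lemma linear_mult: "Vector_Spaces.linear (\<lambda>c f. Const c * f :: ('k::field, 'n::finite) mpol) (\<lambda>c f. Const c * f) ((*) g)"
  by unfold_locales (simp_all only: distrib_left mult.left_commute)

text \<open>Uniqueness of the coordinates of 0 is independence modulo I, existence of coordinates is
  spanning. Coordinates in \<open>residue_basis\<close> are extensional functions on
  \<open>B\<close>, hence the restrictions in the proof.\<close>

lemma residue_basis_iff:
  fixes I :: "('k::field, 'n::finite) mpol set"
  assumes I: "is_ideal I"
  shows "residue_basis I t B \<longleftrightarrow> finite B \<and> B \<subseteq> forms t \<and>
    kvs.indep_mod (I \<inter> forms t) B \<and> kvs.span_mod (I \<inter> forms t) B (forms t)"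
proof -
  have lc: "(\<Sum>b\<in>B. Const (c b) * b) \<in> forms t" if "B \<subseteq> forms t" for c
    by (rule forms_sum) (use that in \<open>auto intro: forms_Const_mult\<close>)
  show ?thesis
  proof (cases "finite B \<and> B \<subseteq> forms t")
    case False then show ?thesis by (auto simp: residue_basis_def)
  next
    case True
    then have B: "finite B" "B \<subseteq> forms t" by auto
    note lc = lc[OF B(2)]
    show ?thesis
    proof
      assume R: "residue_basis I t B"
      have "kvs.indep_mod (I \<inter> forms t) B" unfolding kvs.indep_mod_def
      proof (intro allI impI)
        fix c assume c: "(\<Sum>b\<in>B. Const (c b) * b) \<in> I \<inter> forms t"
        have ex1: "\<exists>!c. c \<in> B \<rightarrow>\<^sub>E UNIV \<and> 0 - (\<Sum>b\<in>B. Const (c b) * b) \<in> I"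
          using R forms_0 unfolding residue_basis_def by blast
        define c1 where "c1 = restrict c B"
        define c2 where "c2 = restrict (\<lambda>_. 0::'k) B"
        have "(\<Sum>b\<in>B. Const (c1 b) * b) = (\<Sum>b\<in>B. Const (c b) * b)"
          by (rule sum.cong) (auto simp: c1_def)
        then have 1: "c1 \<in> B \<rightarrow>\<^sub>E UNIV \<and> 0 - (\<Sum>b\<in>B. Const (c1 b) * b) \<in> I"
          using c ring_ideal.subspace_neg[OF I] by (auto simp: c1_def)
        have "(\<Sum>b\<in>B. Const (c2 b) * b) = 0"
          by (rule sum.neutral) (auto simp: c2_def)
        then have 2: "c2 \<in> B \<rightarrow>\<^sub>E UNIV \<and> 0 - (\<Sum>b\<in>B. Const (c2 b) * b) \<in> I"
          using ring_ideal.subspace_0[OF I] by (auto simp: c2_def)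
        from ex1 1 2 have "c1 = c2" by blast
        then show "\<forall>b\<in>B. c b = 0" unfolding c1_def c2_def by (metis restrict_apply')
      qed
      moreover have "kvs.span_mod (I \<inter> forms t) B (forms t)" unfolding kvs.span_mod_def
      proof
        fix v :: "('k, 'n) mpol" assume v: "v \<in> forms t"
        then obtain c where "v - (\<Sum>b\<in>B. Const (c b) * b) \<in> I"
          using R unfolding residue_basis_def by blast
        then show "\<exists>c. v - (\<Sum>b\<in>B. Const (c b) * b) \<in> I \<inter> forms t"
          using forms_diff[OF v lc] by blast
      qed
      ultimately show "finite B \<and> B \<subseteq> forms t \<and> kvs.indep_mod (I \<inter> forms t) B \<and>
        kvs.span_mod (I \<inter> forms t) B (forms t)" using B by blast
    next
      assume R: "finite B \<and> B \<subseteq> forms t \<and> kvs.indep_mod (I \<inter> forms t) B \<and>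
        kvs.span_mod (I \<inter> forms t) B (forms t)"
      show "residue_basis I t B" unfolding residue_basis_def
      proof (intro conjI ballI ex_ex1I)
        fix f :: "('k, 'n) mpol" assume "f \<in> forms t"
        then obtain c where c: "f - (\<Sum>b\<in>B. Const (c b) * b) \<in> I"
          using R unfolding kvs.span_mod_def by blast
        have "(\<Sum>b\<in>B. Const (restrict c B b) * b) = (\<Sum>b\<in>B. Const (c b) * b)"
          by (rule sum.cong) auto
        with c show "\<exists>c. c \<in> B \<rightarrow>\<^sub>E UNIV \<and> f - (\<Sum>b\<in>B. Const (c b) * b) \<in> I"
          by (intro exI[of _ "restrict c B"]) auto
      next
        fix f :: "('k, 'n) mpol" and c e assume "f \<in> forms t"
          and c: "c \<in> B \<rightarrow>\<^sub>E UNIV \<and> f - (\<Sum>b\<in>B. Const (c b) * b) \<in> I"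
          and e: "e \<in> B \<rightarrow>\<^sub>E UNIV \<and> f - (\<Sum>b\<in>B. Const (e b) * b) \<in> I"
        have "(f - (\<Sum>b\<in>B. Const (e b) * b)) - (f - (\<Sum>b\<in>B. Const (c b) * b)) \<in> I"
          using c e ring_ideal.subspace_diff[OF I] by blast
        moreover have "(f - (\<Sum>b\<in>B. Const (e b) * b)) - (f - (\<Sum>b\<in>B. Const (c b) * b)) =
          (\<Sum>b\<in>B. Const (c b - e b) * b)"
        proof -
          have "x - y - (x - z) = z - y" for x y z :: "('k, 'n) mpol" by (simp add: algebra_simps)
          then show ?thesis by (simp only: Const_diff left_diff_distrib sum_subtractf)
        qed
        ultimately have "(\<Sum>b\<in>B. Const (c b - e b) * b) \<in> I \<inter> forms t"
          using lc[of "\<lambda>b. c b - e b"] by simp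
        moreover have "kvs.indep_mod (I \<inter> forms t) B" using R by blast
        ultimately have "\<forall>b\<in>B. c b - e b = 0"
          using spec[OF iffD1[OF kvs.indep_mod_def], of _ _ "\<lambda>b. c b - e b"] by blast
        with c e show "c = e" by (intro PiE_ext[of _ B "\<lambda>_. UNIV"]) auto
      qed (use B in auto)
    qed
  qed
qed

lemma residue_basis_exists:
  assumes "is_ideal I"
  obtains B where "residue_basis I t B"
proof -
  obtain B where "finite B" "B \<subseteq> forms t" "kvs.indep_mod (I \<inter> forms t) B"
    "kvs.span_mod (I \<inter> forms t) B (forms t)"
    using kvs.quotient_basis_exists[OF finite_span_forms subspace_forms
      subspace_ideal_forms[OF assms] Int_lower2] by metis
  then show ?thesis using that residue_basis_iff[OF assms] by blast
qed

text \<open>All residue bases have the same cardinality, so the definite description in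
  \<open>hilbert_function\<close> denotes it.\<close>

lemma hilbert_function_eq:
  fixes I :: "('k::field, 'n::finite) mpol set"
  assumes I: "is_ideal I"
  shows "hilbert_function I t = kvs.dim (forms t :: ('k, 'n) mpol set) - kvs.dim (I \<inter> forms t)"
proof -
  have card: "card B = kvs.dim (forms t :: ('k, 'n) mpol set) - kvs.dim (I \<inter> forms t)" if "residue_basis I t B" for B
    using that kvs.card_quotient_basis[OF finite_span_forms subspace_ideal_forms[OF I] Int_lower2]
    unfolding residue_basis_iff[OF I] by blast
  obtain B where B: "residue_basis I t B" using residue_basis_exists[OF I] .
  show ?thesis unfolding hilbert_function_def
    by (rule the_equality) (use B card in auto)
qed

lemma dim_ideal_forms_le:
  fixes I :: "('k::field, 'n::finite) mpol set"
  shows "is_ideal I \<Longrightarrow> kvs.dim (I \<inter> forms t) \<le> kvs.dim (forms t :: ('k, 'n) mpol set)"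
  by (rule kvs.dim_mono_finite_span[OF finite_span_forms subspace_ideal_forms Int_lower2])

lemma finite_span_ideal_forms: "kvs.finite_span (I \<inter> forms t)"
  by (rule kvs.finite_span_mono[OF finite_span_forms Int_lower2])

lemma hilbert_function_antimono:
  fixes I :: "('k::field, 'n::finite) mpol set"
  assumes "is_ideal I" "is_ideal J" "I \<inter> forms t \<subseteq> J"
  shows "hilbert_function J t \<le> hilbert_function I t"
proof -
  have "kvs.dim (I \<inter> forms t) \<le> kvs.dim (J \<inter> forms t)"
    by (rule kvs.dim_mono_finite_span[OF finite_span_ideal_forms subspace_ideal_forms])
      (use assms in auto)
  then show ?thesis by (simp add: hilbert_function_eq assms)
qed

lemma hilbert_function_cong:
  assumes "is_ideal I" "is_ideal J" "I \<inter> forms t = J \<inter> forms t"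
  shows "hilbert_function I t = hilbert_function J t"
  by (simp add: hilbert_function_eq assms)

lemma hilbert_function_eq_0_iff:
  fixes I :: "('k::field, 'n::finite) mpol set"
  assumes I: "is_ideal I"
  shows "hilbert_function I t = 0 \<longleftrightarrow> forms t \<subseteq> I"
proof
  assume "hilbert_function I t = 0"
  then have "kvs.dim (forms t :: ('k, 'n) mpol set) \<le> kvs.dim (I \<inter> forms t)" by (simp add: hilbert_function_eq I)
  then have "I \<inter> forms t = forms t"
    using kvs.subspace_eq_if_dim_le[OF finite_span_forms subspace_forms subspace_ideal_forms[OF I]
      Int_lower2] by blast
  then show "forms t \<subseteq> I" by blast
next
  assume "forms t \<subseteq> I"
  then have "I \<inter> forms t = forms t" by blast
  then show "hilbert_function I t = 0" by (simp add: hilbert_function_eq I)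
qed

lemma hilbert_function_le_if_mult_inj:
  fixes I :: "('k::field, 'n::finite) mpol set"
  assumes I: "is_ideal I" and J: "is_ideal J" and g: "g \<in> forms e"
    and inj: "\<And>f. f \<in> forms t \<Longrightarrow> g * f \<in> J \<Longrightarrow> f \<in> I"
  shows "hilbert_function I t \<le> hilbert_function J (t + e)"
  unfolding hilbert_function_eq[OF I] hilbert_function_eq[OF J]
proof (rule kvs.quotient_dim_le_if_inj[OF linear_mult[of g] finite_span_forms subspace_forms
    subspace_ideal_forms[OF I] Int_lower2 finite_span_forms subspace_ideal_forms[OF J] Int_lower2])
  show "g * v \<in> forms (t + e)" if "v \<in> forms t" for v
    using forms_mult[OF g that] by (simp add: add.commute)
  show "v \<in> I \<inter> forms t" if "v \<in> forms t" "g * v \<in> J \<inter> forms (t + e)" for v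
    using that inj by blast
qed

lemma hilbert_function_le_if_mult_surj:
  fixes I :: "('k::field, 'n::finite) mpol set"
  assumes I: "is_ideal I" and J: "is_ideal J" and g: "g \<in> forms e"
    and IJ: "\<And>f. f \<in> I \<Longrightarrow> f \<in> forms t \<Longrightarrow> g * f \<in> J"
    and surj: "\<And>w. w \<in> forms (t + e) \<Longrightarrow> \<exists>v\<in>forms t. w - g * v \<in> J"
  shows "hilbert_function J (t + e) \<le> hilbert_function I t"
  unfolding hilbert_function_eq[OF I] hilbert_function_eq[OF J]
proof (rule kvs.quotient_dim_le_if_surj[OF linear_mult[of g] finite_span_forms subspace_forms
    subspace_ideal_forms[OF I] Int_lower2 finite_span_forms subspace_ideal_forms[OF J] Int_lower2])
  have gf: "g * v \<in> forms (t + e)" if "v \<in> forms t" for v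
    using forms_mult[OF g that] by (simp add: add.commute)
  show "g * v \<in> J \<inter> forms (t + e)" if "v \<in> I \<inter> forms t" for v
    using that IJ gf by blast
  show "\<exists>v\<in>forms t. w - g * v \<in> J \<inter> forms (t + e)" if "w \<in> forms (t + e)" for w
    using surj[OF that] gf forms_diff[OF that] by blast
qed

lemma mult_inj_if_surj:
  fixes I :: "('k::field, 'n::finite) mpol set"
  assumes I: "is_ideal I" and J: "is_ideal J" and g: "g \<in> forms e"
    and IJ: "\<And>f. f \<in> I \<Longrightarrow> f \<in> forms t \<Longrightarrow> g * f \<in> J"
    and surj: "\<And>w. w \<in> forms (t + e) \<Longrightarrow> \<exists>v\<in>forms t. w - g * v \<in> J"
    and le: "hilbert_function I t \<le> hilbert_function J (t + e)"
    and f: "f \<in> forms t" "g * f \<in> J"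
  shows "f \<in> I"
proof -
  have gf: "g * v \<in> forms (t + e)" if "v \<in> forms t" for v
    using forms_mult[OF g that] by (simp add: add.commute)
  have "f \<in> I \<inter> forms t"
  proof (rule kvs.inj_if_surj_quotient[OF linear_mult[of g] finite_span_forms subspace_forms
    subspace_ideal_forms[OF I] Int_lower2 finite_span_forms subspace_ideal_forms[OF J] Int_lower2])
    show "g * v \<in> J \<inter> forms (t + e)" if "v \<in> I \<inter> forms t" for v
      using that IJ gf by blast
    show "\<exists>v\<in>forms t. w - g * v \<in> J \<inter> forms (t + e)" if "w \<in> forms (t + e)" for w
      using surj[OF that] gf forms_diff[OF that] by blast
    show "kvs.dim (forms t :: ('k, 'n) mpol set) - kvs.dim (I \<inter> forms t)
      \<le> kvs.dim (forms (t + e) :: ('k, 'n) mpol set) - kvs.dim (J \<inter> forms (t + e))"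
      using le unfolding hilbert_function_eq[OF I] hilbert_function_eq[OF J] .
    show "f \<in> forms t" "g * f \<in> J \<inter> forms (t + e)" using f gf by auto
  qed
  then show ?thesis by blast
qed

text \<open>Multiplication by \<open>g\<close> embeds (R/I)_t into (J/I)_(t+e), whose dimension is
  the difference of the two Hilbert functions in degree t + e.\<close>

lemma hilbert_function_nonzerodivisor_le:
  fixes I :: "('k::field, 'n::finite) mpol set"
  assumes I: "is_ideal I" and J: "is_ideal J" "I \<subseteq> J" and g: "g \<in> forms e" "g \<in> J"
    and inj: "\<And>f. f \<in> forms t \<Longrightarrow> g * f \<in> I \<Longrightarrow> f \<in> I"
  shows "hilbert_function J (t + e) + hilbert_function I t \<le> hilbert_function I (t + e)"
proof -
  have "kvs.dim (forms t :: ('k, 'n) mpol set) - kvs.dim (I \<inter> forms t)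
      \<le> kvs.dim (J \<inter> forms (t + e)) - kvs.dim (I \<inter> forms (t + e))"
  proof (rule kvs.quotient_dim_le_if_inj[OF linear_mult[of g] finite_span_forms subspace_forms
      subspace_ideal_forms[OF I] Int_lower2 finite_span_ideal_forms subspace_ideal_forms[OF I]])
    show "I \<inter> forms (t + e) \<subseteq> J \<inter> forms (t + e)" using J(2) by blast
    show "g * v \<in> J \<inter> forms (t + e)" if "v \<in> forms t" for v
      using forms_mult[OF g(1) that] ideal_mult_left[OF J(1) g(2)] by (simp add: add.commute)
    show "v \<in> I \<inter> forms t" if "v \<in> forms t" "g * v \<in> I \<inter> forms (t + e)" for v
      using that inj by blast
  qed
  moreover have "kvs.dim (I \<inter> forms (t + e)) \<le> kvs.dim (J \<inter> forms (t + e))"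
    by (rule kvs.dim_mono_finite_span[OF finite_span_ideal_forms subspace_ideal_forms[OF I]])
      (use J(2) in auto)
  moreover have "kvs.dim (J \<inter> forms (t + e)) \<le> kvs.dim (forms (t + e) :: ('k, 'n) mpol set)"
    by (rule dim_ideal_forms_le[OF J(1)])
  ultimately show ?thesis
    unfolding hilbert_function_eq[OF I] hilbert_function_eq[OF J(1)] by linarith
qed

text \<open>Exactness of 0 -> (R/I)_t -> (R/I)_(t+e) -> (R/(I, l))_(t+e) -> 0. Injectivity is asked
  for in the single degree \<open>t\<close>, because the form l1 is at first controlled in single
  degrees only.\<close>

lemma hilbert_function_hyperplane_section:
  fixes I :: "('k::field, 'n::finite) mpol set"
  assumes I: "homogeneous_ideal I" and l: "l \<in> forms e"
    and inj: "\<And>f. f \<in> forms t \<Longrightarrow> l * f \<in> I \<Longrightarrow> f \<in> I"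
  shows "hilbert_function (ideal_gen (insert l I)) (t + e) + hilbert_function I t
    = hilbert_function I (t + e)"
proof (rule antisym)
  note iI = homogeneous_idealD(1)[OF I]
  let ?J = "ideal_gen (insert l I)"
  have J: "is_ideal ?J" "I \<subseteq> ?J" "l \<in> ?J" by (auto intro: ring_ideal.span_base)
  show "hilbert_function ?J (t + e) + hilbert_function I t \<le> hilbert_function I (t + e)"
    by (rule hilbert_function_nonzerodivisor_le[OF iI J(1,2) l J(3) inj])
  have gv: "l * v \<in> ?J \<inter> forms (t + e)" if "v \<in> forms t" for v
    using forms_mult[OF l that] ideal_mult_left[OF J(1,3)] by (simp add: add.commute)
  have "kvs.dim (?J \<inter> forms (t + e)) - kvs.dim (I \<inter> forms (t + e))
      \<le> kvs.dim (forms t :: ('k, 'n) mpol set) - kvs.dim (I \<inter> forms t)"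
  proof (rule kvs.quotient_dim_le_if_surj[OF linear_mult[of l] finite_span_forms subspace_forms
      subspace_ideal_forms[OF iI] Int_lower2 finite_span_ideal_forms subspace_ideal_forms[OF iI]])
    show "I \<inter> forms (t + e) \<subseteq> ?J \<inter> forms (t + e)" using J(2) by blast
    show "l * v \<in> I \<inter> forms (t + e)" if "v \<in> I \<inter> forms t" for v
      using that gv ideal_mult_right[OF iI] by blast
    fix w assume w: "w \<in> ?J \<inter> forms (t + e)"
    then obtain v where "v \<in> forms t" "w - l * v \<in> I"
      using ideal_gen_insert_forms[OF I l] by blast
    then show "\<exists>v\<in>forms t. w - l * v \<in> I \<inter> forms (t + e)"
      using gv forms_diff w by blast
  qed
  moreover have "kvs.dim (I \<inter> forms (t + e)) \<le> kvs.dim (?J \<inter> forms (t + e))"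
    by (rule kvs.dim_mono_finite_span[OF finite_span_ideal_forms subspace_ideal_forms[OF iI]])
      (use J(2) in auto)
  moreover have "kvs.dim (?J \<inter> forms (t + e)) \<le> kvs.dim (forms (t + e) :: ('k, 'n) mpol set)"
    by (rule dim_ideal_forms_le[OF J(1)])
  ultimately show "hilbert_function I (t + e) \<le> hilbert_function ?J (t + e) + hilbert_function I t"
    unfolding hilbert_function_eq[OF iI] hilbert_function_eq[OF J(1)] by linarith
qed

section \<open>Evaluation homomorphisms\<close>

definition mon_eval :: "('v \<Rightarrow> 's::comm_ring_1) \<Rightarrow> ('v \<Rightarrow>\<^sub>0 nat) \<Rightarrow> 's" where
  "mon_eval a m = (\<Prod>v\<in>ks m. a v ^ lk m v)"

text \<open>The coefficient map \<open>c\<close> is a parameter so that evaluation at a point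
  (\<open>c\<close> the identity) and substitution of polynomials (\<open>c = Const\<close>) are one
  construction.\<close>

definition subst :: "('k::field \<Rightarrow> 's::comm_ring_1) \<Rightarrow> ('v \<Rightarrow> 's) \<Rightarrow> ('k, 'v) mpol \<Rightarrow> 's" where
  "subst c a f = (\<Sum>m\<in>ks f. c (lk f m) * mon_eval a m)"

lemma mon_eval_superset:
  assumes "finite A" "ks m \<subseteq> A"
  shows "mon_eval a m = (\<Prod>v\<in>A. a v ^ lk m v)"
  unfolding mon_eval_def
  by (rule prod.mono_neutral_left) (use assms in \<open>auto simp: in_keys_iff\<close>)

lemma mon_eval_0 [simp]: "mon_eval a 0 = 1"
  by (simp add: mon_eval_def)

lemma mon_eval_single [simp]: "mon_eval a (Poly_Mapping.single v k) = a v ^ k"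
  by (simp add: mon_eval_def)

lemma mon_eval_add: "mon_eval a (m + m') = mon_eval a m * mon_eval a m'"
proof -
  let ?A = "ks m \<union> ks m'"
  have "mon_eval a (m + m') = (\<Prod>v\<in>?A. a v ^ lk (m + m') v)"
    by (rule mon_eval_superset) (simp_all add: keys_add)
  also have "\<dots> = (\<Prod>v\<in>?A. a v ^ lk m v) * (\<Prod>v\<in>?A. a v ^ lk m' v)"
    by (simp add: lookup_add power_add prod.distrib)
  also have "\<dots> = mon_eval a m * mon_eval a m'"
    using mon_eval_superset[of ?A m a] mon_eval_superset[of ?A m' a] by simp
  finally show ?thesis .
qed

locale coefficient_hom =
  fixes c :: "'k::field \<Rightarrow> 's::comm_ring_1"
  assumes c_0: "c 0 = 0" and c_1: "c 1 = 1"
    and c_add: "\<And>x y. c (x + y) = c x + c y" and c_mult: "\<And>x y. c (x * y) = c x * c y"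
begin

lemma subst_superset:
  assumes "finite A" "ks f \<subseteq> A"
  shows "subst c a f = (\<Sum>m\<in>A. c (lk f m) * mon_eval a m)"
  unfolding subst_def
  by (rule sum.mono_neutral_left) (use assms in \<open>auto simp: in_keys_iff c_0\<close>)

lemma subst_0 [simp]: "subst c a 0 = 0"
  by (simp add: subst_def)

lemma subst_single: "subst c a (Poly_Mapping.single m x) = c x * mon_eval a m"
  by (simp add: subst_def c_0)

lemma subst_1 [simp]: "subst c a 1 = 1"
  using subst_single[of a 0 1] by (simp add: c_1)

lemma subst_add: "subst c a (f + g) = subst c a f + subst c a g"
proof -
  let ?A = "ks f \<union> ks g"
  have "subst c a (f + g) = (\<Sum>m\<in>?A. c (lk (f + g) m) * mon_eval a m)"
    by (rule subst_superset) (simp_all add: keys_add)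
  also have "\<dots> = (\<Sum>m\<in>?A. c (lk f m) * mon_eval a m) + (\<Sum>m\<in>?A. c (lk g m) * mon_eval a m)"
    by (simp add: lookup_add c_add distrib_right sum.distrib)
  also have "\<dots> = subst c a f + subst c a g"
    using subst_superset[of ?A f a] subst_superset[of ?A g a] by simp
  finally show ?thesis .
qed

lemma subst_sum: "subst c a (sum f A) = (\<Sum>i\<in>A. subst c a (f i))"
  by (induction A rule: infinite_finite_induct) (auto simp: subst_add)

lemma sum_single: "(f :: ('k, 'v) mpol) = (\<Sum>m\<in>ks f. Poly_Mapping.single m (lk f m))"
proof (rule poly_mapping_eqI)
  fix k
  have "lk (\<Sum>m\<in>ks f. Poly_Mapping.single m (lk f m)) k = (\<Sum>m\<in>ks f. if m = k then lk f k else 0)"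
    unfolding lookup_sum lookup_single when_def by (rule sum.cong) auto
  also have "\<dots> = lk f k" by (simp add: in_keys_iff)
  finally show "lk f k = lk (\<Sum>m\<in>ks f. Poly_Mapping.single m (lk f m)) k" ..
qed

lemma subst_mult: "subst c a (f * g) = subst c a f * subst c a g"
proof -
  let ?s = Poly_Mapping.single
  have "f * g = (\<Sum>m\<in>ks f. ?s m (lk f m)) * (\<Sum>m'\<in>ks g. ?s m' (lk g m'))"
    using sum_single[of f] sum_single[of g] by simp
  also have "\<dots> = (\<Sum>m\<in>ks f. \<Sum>m'\<in>ks g. ?s (m + m') (lk f m * lk g m'))"
    by (simp add: sum_product mult_single)
  finally have fg: "f * g = (\<Sum>m\<in>ks f. \<Sum>m'\<in>ks g. ?s (m + m') (lk f m * lk g m'))" .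
  have "subst c a (f * g) =
     (\<Sum>m\<in>ks f. \<Sum>m'\<in>ks g. (c (lk f m) * mon_eval a m) * (c (lk g m') * mon_eval a m'))"
    unfolding fg subst_sum subst_single c_mult mon_eval_add
    by (intro sum.cong refl) (simp only: mult_ac)
  also have "\<dots> = subst c a f * subst c a g"
    unfolding subst_def by (simp add: sum_product)
  finally show ?thesis .
qed

lemma subst_Const [simp]: "subst c a (Const x) = c x"
  by (simp add: Const_def subst_single)

lemma subst_Var [simp]: "subst c a (Var v) = a v"
  by (simp add: Var_def subst_single c_1)

end

global_interpretation Const_hom: coefficient_hom "Const :: 'k::field \<Rightarrow> ('k, 'n) mpol"
  by unfold_locales (simp_all add: Const_add Const_mult)

global_interpretation eval_hom: coefficient_hom "\<lambda>x. x :: 'k::field"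
  by unfold_locales auto

lemma eval_mpol_eq_subst: "eval_mpol a g = subst (\<lambda>x. x) a g"
  by (simp add: eval_mpol_def subst_def mon_eval_def)

lemma eval_mpol_hom:
  "eval_mpol a 0 = 0" "eval_mpol a 1 = 1" "eval_mpol a (f + g) = eval_mpol a f + eval_mpol a g"
  "eval_mpol a (f * g) = eval_mpol a f * eval_mpol a g"
  "eval_mpol a (Const x) = x" "eval_mpol a (Var v) = a v"
  by (simp_all add: eval_mpol_eq_subst eval_hom.subst_add eval_hom.subst_mult)

lemma Var_power: "Var v ^ k = mon (Poly_Mapping.single v k)"
  by (induction k) (simp_all add: mon_def Var_def mult_single flip: single_add)

lemma prod_mon: "(\<Prod>v\<in>A. mon (p v)) = mon (\<Sum>v\<in>A. p v)"
  by (induction A rule: infinite_finite_induct) (auto simp: mon_def mult_single)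

lemma sum_single_lookup: "(\<Sum>v\<in>ks m. Poly_Mapping.single v (lk m v)) = (m :: 'n \<Rightarrow>\<^sub>0 nat)"
proof (rule poly_mapping_eqI)
  fix k
  have "lk (\<Sum>v\<in>ks m. Poly_Mapping.single v (lk m v)) k = (\<Sum>v\<in>ks m. if v = k then lk m k else 0)"
    unfolding lookup_sum lookup_single when_def by (rule sum.cong) auto
  also have "\<dots> = lk m k" by (simp add: in_keys_iff)
  finally show "lk (\<Sum>v\<in>ks m. Poly_Mapping.single v (lk m v)) k = lk m k" .
qed

lemma mon_eval_Var: "mon_eval Var m = mon m"
  by (simp add: mon_eval_def Var_power prod_mon sum_single_lookup)

lemma subst_Var_id: "subst Const Var f = f"
  using mon_expansion[of f] by (simp add: subst_def mon_eval_Var)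

lemma subst_subst:
  fixes a :: "'w \<Rightarrow> ('k::field, 'u) mpol" and b :: "'v \<Rightarrow> ('k, 'w) mpol"
  shows "subst Const a (subst Const b f) = subst Const (\<lambda>v. subst Const a (b v)) f"
proof -
  have pw: "subst Const a (x ^ k) = subst Const a x ^ k" for x k
    by (induction k) (simp_all add: Const_hom.subst_mult)
  have pr: "subst Const a (\<Prod>v\<in>A. g v) = (\<Prod>v\<in>A. subst Const a (g v))" for A :: "'v set" and g
    by (induction A rule: infinite_finite_induct) (simp_all add: Const_hom.subst_mult)
  show ?thesis
    by (simp add: subst_def[of Const b] subst_def[of Const "\<lambda>v. subst Const a (b v)"]
      Const_hom.subst_sum Const_hom.subst_mult mon_eval_def pr pw)
qed

lemma subst_ideal_gen: "f \<in> ideal_gen S \<Longrightarrow> subst Const a f \<in> ideal_gen (subst Const a ` S)"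
proof (induction f rule: ring_ideal.span_induct_alt)
  case base show ?case by (simp add: ring_ideal.span_zero)
next
  case (step c x y)
  then show ?case
    by (simp add: Const_hom.subst_add Const_hom.subst_mult ring_ideal.span_add
      ring_ideal.span_scale ring_ideal.span_base)
qed

section \<open>Linear forms and regular sequences\<close>

lemma mdeg_eq_1: "mdeg m = 1 \<Longrightarrow> \<exists>v. m = Poly_Mapping.single v 1"
proof -
  assume "mdeg m = 1"
  then obtain v where v: "lk m v = 1" "\<forall>w. v \<noteq> w \<longrightarrow> lk m w = 0"
    unfolding mdeg_def by (auto simp: sum_eq_Suc0_iff)
  have "m = Poly_Mapping.single v 1"
    by (rule poly_mapping_eqI) (use v in \<open>auto simp: lookup_single when_def\<close>)
  then show ?thesis ..
qed

lemma single_eq_single_1: "Poly_Mapping.single v (1::nat) = Poly_Mapping.single w 1 \<longleftrightarrow> v = w"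
  by (metis lookup_single_eq lookup_single_not_eq zero_neq_one)

lemma linear_form_expansion:
  fixes f :: "('k::field, 'n::finite) mpol"
  assumes "f \<in> forms 1"
  shows "f = (\<Sum>v\<in>UNIV. Const (lk f (Poly_Mapping.single v 1)) * Var v)"
proof (rule poly_mapping_eqI)
  fix m
  have s: "lk (\<Sum>v\<in>UNIV. Const (lk f (Poly_Mapping.single v 1)) * Var v) m =
    (\<Sum>v\<in>UNIV. if Poly_Mapping.single v 1 = m then lk f m else 0)"
    unfolding lookup_sum lookup_Const_mult Var_def lookup_single when_def by (rule sum.cong) auto
  show "lk f m = lk (\<Sum>v\<in>UNIV. Const (lk f (Poly_Mapping.single v 1)) * Var v) m"
  proof (cases "mdeg m = 1")
    case True
    then obtain w where w: "m = Poly_Mapping.single w 1" using mdeg_eq_1 by blast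
    show ?thesis unfolding s unfolding w single_eq_single_1 by simp
  next
    case False
    then have "lk f m = 0" using assms by (auto simp: forms_iff)
    with s show ?thesis by simp
  qed
qed

lemma lookup_linear_comb:
  "lk (\<Sum>v\<in>UNIV. Const (c v) * Var v) (Poly_Mapping.single w 1) = (c w :: 'k::field)" for c :: "'n::finite \<Rightarrow> _"
  unfolding lookup_sum lookup_Const_mult Var_def lookup_single single_eq_single_1 when_def
  by (subst sum.cong[OF refl, of UNIV _ "\<lambda>v. if v = w then c w else 0"]) auto

lemma linear_comb_in_forms:
  "(\<And>v. v \<in> A \<Longrightarrow> y v \<in> forms t) \<Longrightarrow> (\<Sum>v\<in>A. Const (c v) * y v) \<in> forms t"
  by (intro forms_sum forms_Const_mult)

lemma Var_ideal_iff:
  fixes f :: "('k::field, 'n) mpol"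
  shows "f \<in> ideal_gen (Var ` A) \<longleftrightarrow> (\<forall>m\<in>ks f. \<exists>j\<in>A. lk m j \<noteq> 0)"
proof
  assume "f \<in> ideal_gen (Var ` A)"
  then show "\<forall>m\<in>ks f. \<exists>j\<in>A. lk m j \<noteq> 0"
  proof (induction f rule: ring_ideal.span_induct_alt)
    case base show ?case by simp
  next
    case (step c x y)
    then obtain j where j: "j \<in> A" "x = Var j" by blast
    show ?case
    proof
      fix m assume "m \<in> ks (c * x + y)"
      then have "m \<in> ks (c * x) \<or> m \<in> ks y" using keys_add[of "c * x" y] by blast
      then show "\<exists>j\<in>A. lk m j \<noteq> 0"
      proof
        assume "m \<in> ks (c * x)"
        then obtain p q where "m = p + q" "q \<in> ks x" using keys_mult[of c x] by blast
        then have "m = p + Poly_Mapping.single j 1" using j by (auto simp: Var_def)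
        then have "lk m j \<noteq> 0" by (simp add: lookup_add)
        with j(1) show ?thesis by blast
      qed (use step(2) in blast)
    qed
  qed
next
  assume A: "\<forall>m\<in>ks f. \<exists>j\<in>A. lk m j \<noteq> 0"
  have "mon m \<in> ideal_gen (Var ` A :: ('k, 'n) mpol set)" if m: "m \<in> ks f" for m
  proof -
    obtain j where j: "j \<in> A" "lk m j \<noteq> 0" using A m by blast
    have "m = (m - Poly_Mapping.single j 1) + Poly_Mapping.single j 1"
      by (rule poly_mapping_eqI) (use j(2) in \<open>auto simp: lookup_add lookup_minus lookup_single when_def\<close>)
    then have "mon m = mon (m - Poly_Mapping.single j 1) * (Var j :: ('k, 'n) mpol)"
      using mon_add Var_eq_mon by metis
    then show ?thesis using j(1) by (simp add: ring_ideal.span_scale ring_ideal.span_base)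
  qed
  then have "(\<Sum>m\<in>ks f. Const (lk f m) * mon m) \<in> ideal_gen (Var ` A)"
    by (intro ring_ideal.span_sum ring_ideal.span_scale)
  then show "f \<in> ideal_gen (Var ` A)" using mon_expansion[of f] by simp
qed

text \<open>Multiplication by a variable outside \<open>A\<close> leaves the exponents in
  \<open>A\<close> unchanged, and these decide membership in the monomial ideal.\<close>

lemma Var_regular:
  fixes f :: "('k::field, 'n) mpol"
  assumes "i \<notin> A" "Var i * f \<in> ideal_gen (Var ` A)"
  shows "f \<in> ideal_gen (Var ` A)"
  unfolding Var_ideal_iff
proof
  fix m assume "m \<in> ks f"
  then have "Poly_Mapping.single i 1 + m \<in> ks (Var i * f)"
    using lookup_single_mult_add[of "Poly_Mapping.single i 1" 1 f m] by (simp add: in_keys_iff Var_def)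
  then obtain j where j: "j \<in> A" "lk (Poly_Mapping.single i 1 + m) j \<noteq> 0"
    using assms(2) unfolding Var_ideal_iff by blast
  then have "lk m j \<noteq> 0" using assms(1) by (auto simp: lookup_add lookup_single when_def split: if_splits)
  with j(1) show "\<exists>j\<in>A. lk m j \<noteq> 0" by blast
qed

lemma Var_inj: "inj (Var :: 'n \<Rightarrow> ('k::field, 'n) mpol)"
proof (rule injI)
  fix v w :: 'n assume "(Var v :: ('k, 'n) mpol) = Var w"
  then have "lk (Var v :: ('k, 'n) mpol) (Poly_Mapping.single v 1) = lk (Var w) (Poly_Mapping.single v 1)"
    by simp
  then show "v = w" unfolding Var_def lookup_single single_eq_single_1 by (simp add: when_def split: if_splits)
qed

lemma dim_forms_1: "kvs.dim (forms 1 :: ('k::field, 'n::finite) mpol set) = CARD('n)"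
proof -
  let ?B = "range Var :: ('k, 'n) mpol set"
  have "kvs.independent ?B"
  proof (rule kvs.independent_if_scalars_zero)
    fix g x assume g: "(\<Sum>x\<in>?B. Const (g x) * x) = 0" and "x \<in> ?B"
    then obtain w where w: "x = Var w" by blast
    have "(\<Sum>v\<in>UNIV. Const (g (Var v)) * (Var v :: ('k, 'n) mpol)) = 0"
      using g sum.reindex[OF Var_inj, of "\<lambda>x. Const (g x) * x"] by simp
    then show "g x = 0" using lookup_linear_comb[of "\<lambda>v. g (Var v)" w] w by simp
  qed simp
  moreover have "forms 1 \<subseteq> kvs.span ?B"
  proof
    fix f :: "('k, 'n) mpol" assume "f \<in> forms 1"
    then have "f = (\<Sum>v\<in>UNIV. Const (lk f (Poly_Mapping.single v 1)) * Var v)"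
      by (rule linear_form_expansion)
    also have "\<dots> \<in> kvs.span ?B"
      by (intro kvs.span_sum kvs.span_scale kvs.span_base) auto
    finally show "f \<in> kvs.span ?B" .
  qed
  ultimately have "card ?B = kvs.dim (forms 1 :: ('k, 'n) mpol set)"
    by (intro kvs.basis_card_eq_dim) auto
  then show ?thesis by (simp add: card_image[OF Var_inj])
qed

lemma two_forms_extend_basis:
  fixes l1 l2 :: "('k::field, 'n::finite) mpol"
  assumes l: "l1 \<in> forms 1" "l2 \<in> forms 1"
    and ind: "\<And>a b. Const a * l1 + Const b * l2 = 0 \<Longrightarrow> a = 0 \<and> b = 0"
  obtains y where "y 0 = l1" "y (1::nat) = l2" "inj_on y {..<CARD('n)}"
    "y ` {..<CARD('n)} \<subseteq> forms 1" "kvs.independent (y ` {..<CARD('n)})"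
    "forms 1 \<subseteq> kvs.span (y ` {..<CARD('n)})" "CARD('n) \<ge> 2"
proof -
  have ne: "l1 \<noteq> l2"
  proof
    assume "l1 = l2"
    then have "Const 1 * l1 + Const (-1) * l2 = 0" by (simp add: Const_uminus)
    then show False using ind by fastforce
  qed
  have "kvs.independent {l1, l2}"
  proof (rule kvs.independent_if_scalars_zero)
    fix g x assume "(\<Sum>x\<in>{l1, l2}. Const (g x) * x) = 0" "x \<in> {l1, l2}"
    then show "g x = 0" using ind[of "g l1" "g l2"] ne by auto
  qed simp
  then obtain B where B: "{l1, l2} \<subseteq> B" "B \<subseteq> forms 1" "kvs.independent B" "forms 1 \<subseteq> kvs.span B"
    using kvs.maximal_independent_subset_extend[of "{l1, l2}" "forms 1"] l by blast
  have cardB: "card B = CARD('n)"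
    using kvs.basis_card_eq_dim[OF B(2,4,3)] dim_forms_1[where 'k='k and 'n='n] by simp
  then have fB: "finite B" by (metis card.infinite finite_UNIV_card_ge_0 finite less_numeral_extra(3))
  let ?n = "CARD('n)"
  have n2: "?n \<ge> 2" using card_mono[OF fB B(1)] ne cardB by simp
  have c: "card (B - {l1, l2}) = ?n - 2" using B(1) ne cardB by (simp add: card_Diff_subset)
  obtain h where h: "bij_betw h {0..<card (B - {l1, l2})} (B - {l1, l2})"
    using ex_bij_betw_nat_finite[of "B - {l1, l2}"] fB by blast
  define y where "y i = (if i = 0 then l1 else if i = 1 then l2 else h (i - 2))" for i :: nat
  have h': "h i \<in> B - {l1, l2}" if "i < ?n - 2" for i
    using bij_betwE[OF h] that unfolding c by simp
  have inj: "inj_on y {..<?n}"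
  proof (rule inj_onI)
    fix i j assume ij: "i \<in> {..<?n}" "j \<in> {..<?n}" "y i = y j"
    have hh: "h a = h b \<Longrightarrow> a = b" if "a < ?n - 2" "b < ?n - 2" for a b
      using h that unfolding c bij_betw_def inj_on_def by simp
    have "i = 0 \<or> i = 1 \<or> (i \<ge> 2 \<and> i - 2 < ?n - 2)" "j = 0 \<or> j = 1 \<or> (j \<ge> 2 \<and> j - 2 < ?n - 2)"
      using ij by auto
    then show "i = j" using ij(3) ne h'[of "i - 2"] h'[of "j - 2"] hh[of "i - 2" "j - 2"]
      by (auto simp: y_def)
  qed
  have sub: "y ` {..<?n} \<subseteq> B" using h' B(1) n2 by (auto simp: y_def)
  have img: "y ` {..<?n} = B"
    using card_subset_eq[OF fB sub] card_image[OF inj] cardB by simp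
  show ?thesis
    by (rule that[of y]) (use inj img B n2 in \<open>auto simp: y_def\<close>)
qed

text \<open>The variables form a regular sequence, and a linear change of coordinates carries them
  to a basis of R_1 that starts with l1, l2.\<close>

lemma two_forms_extend_regular:
  fixes l1 l2 :: "('k::field, 'n::finite) mpol"
  assumes l: "l1 \<in> forms 1" "l2 \<in> forms 1"
    and ind: "\<And>a b. Const a * l1 + Const b * l2 = 0 \<Longrightarrow> a = 0 \<and> b = 0"
  obtains y where "y 0 = l1" "y (1::nat) = l2" "CARD('n) \<ge> 2"
    "\<And>i. i < CARD('n) \<Longrightarrow> y i \<in> forms 1"
    "\<And>v. Var v \<in> ideal_gen (y ` {..<CARD('n)})"
    "\<And>i f. i < CARD('n) \<Longrightarrow> y i * f \<in> ideal_gen (y ` {..<i}) \<Longrightarrow> f \<in> ideal_gen (y ` {..<i})"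
proof -
  let ?n = "CARD('n)"
  obtain y where y: "y 0 = l1" "y (1::nat) = l2" "inj_on y {..<?n}"
    "y ` {..<?n} \<subseteq> forms 1" "kvs.independent (y ` {..<?n})"
    "forms 1 \<subseteq> kvs.span (y ` {..<?n})" "?n \<ge> 2"
    using two_forms_extend_basis[OF l ind] .
  obtain e :: "nat \<Rightarrow> 'n" where "bij_betw e {0..<card (UNIV :: 'n set)} UNIV"
    using ex_bij_betw_nat_finite[of "UNIV :: 'n set"] by auto
  then have e: "bij_betw e {..<?n} UNIV" by (simp add: atLeast0LessThan)
  define e' where "e' = inv_into {..<?n} e"
  have e': "e' (e i) = i" if "i < ?n" for i
    unfolding e'_def using e that by (simp add: bij_betw_def inv_into_f_f)
  have ee': "e (e' v) = v" "e' v < ?n" for v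
    using bij_betw_inv_into_right[OF e, of v] bij_betw_apply[OF bij_betw_inv_into[OF e], of v]
    by (simp_all add: e'_def)
  \<comment> \<open>The basis is reindexed by the variables themselves, so that it can be
    substituted for them.\<close>
  define Y where "Y v = y (e' v)" for v
  have yY: "y i = Y (e i)" if "i < ?n" for i using e'[OF that] by (simp add: Y_def)
  have Yf: "Y v \<in> forms 1" for v using y(4) ee'(2) by (auto simp: Y_def)
  have "bij_betw e' UNIV {..<?n}" unfolding e'_def by (rule bij_betw_inv_into[OF e])
  then have "bij_betw (y \<circ> e') UNIV (y ` {..<?n})"
    by (rule bij_betw_trans) (use y(3) in \<open>simp add: bij_betw_def\<close>)
  then have Yinj: "inj Y" and Yimg: "range Y = y ` {..<?n}"
    unfolding bij_betw_def Y_def by (simp_all add: comp_def inj_def)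
  have Yspan: "\<exists>c. f = (\<Sum>v\<in>UNIV. Const (c v) * Y v)" if f: "f \<in> forms 1" for f
  proof -
    have "f \<in> kvs.span (range Y)" using f y(6) Yimg by auto
    then obtain u where "f = (\<Sum>x\<in>range Y. Const (u x) * x)"
      unfolding kvs.span_finite[OF finite_imageI[OF finite]] by blast
    then have "f = (\<Sum>v\<in>UNIV. Const (u (Y v)) * Y v)"
      using sum.reindex[OF Yinj, of "\<lambda>x. Const (u x) * x"] by simp
    then show ?thesis by (rule exI[of _ "\<lambda>v. u (Y v)"])
  qed
  have Yind: "c v = 0" if c: "(\<Sum>v\<in>UNIV. Const (c v) * Y v) = 0" for c v
  proof -
    have "(\<Sum>x\<in>range Y. Const (c (inv_into UNIV Y x)) * x) = 0"
      using c sum.reindex[OF Yinj, of "\<lambda>x. Const (c (inv_into UNIV Y x)) * x"] Yinj by simp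
    moreover have "kvs.independent (range Y)" "finite (range Y)" using y(5) Yimg by simp_all
    ultimately have "c (inv_into UNIV Y (Y v)) = 0"
      using kvs.independentD[of "range Y" "range Y" "\<lambda>x. c (inv_into UNIV Y x)" "Y v"] by blast
    then show ?thesis using Yinj by simp
  qed
  define \<sigma> where "\<sigma> = subst Const Y"
  have "\<forall>v. \<exists>c. Var v = (\<Sum>w\<in>UNIV. Const (c w) * Y w)" using Yspan forms_Var by blast
  then obtain b where b: "\<And>v. Var v = (\<Sum>w\<in>UNIV. Const (b v w) * Y w)" by metis
  \<comment> \<open>\<open>\<tau>\<close> will substitute for each variable its expression in the
    basis, read in the variables; \<open>\<sigma>\<close> after \<open>\<tau>\<close> is then the
    identity by construction.\<close>
  define z where "z v = (\<Sum>w\<in>UNIV. Const (b v w) * Var w :: ('k, 'n) mpol)" for v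
  define \<tau> where "\<tau> = subst Const z"
  have st: "\<sigma> (\<tau> f) = f" for f
  proof -
    have "\<sigma> (z v) = Var v" for v
      by (simp add: \<sigma>_def z_def Const_hom.subst_sum Const_hom.subst_mult flip: b)
    then show ?thesis by (simp add: \<sigma>_def \<tau>_def subst_subst subst_Var_id)
  qed
  \<comment> \<open>The other composite, on the basis: \<open>\<tau> (Y w) - Var w\<close> is a
    linear form killed by \<open>\<sigma>\<close>, and \<open>\<sigma>\<close> is injective on
    linear forms because the \<open>Y v\<close> are independent.\<close>
  have tY: "\<tau> (Y w) = Var w" for w
  proof -
    have "\<tau> (Y w) = (\<Sum>v\<in>UNIV. Const (lk (Y w) (Poly_Mapping.single v 1)) * z v)"
      by (subst linear_form_expansion[OF Yf])
        (simp add: \<tau>_def Const_hom.subst_sum Const_hom.subst_mult)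
    also have "\<dots> \<in> forms 1" unfolding z_def by (intro linear_comb_in_forms forms_Var)
    finally have t1: "\<tau> (Y w) - Var w \<in> forms 1" by (intro forms_diff forms_Var)
    define c where "c v = lk (\<tau> (Y w) - Var w) (Poly_Mapping.single v 1)" for v
    have c: "\<tau> (Y w) - Var w = (\<Sum>v\<in>UNIV. Const (c v) * Var v)"
      unfolding c_def by (rule linear_form_expansion[OF t1])
    have "\<sigma> (\<tau> (Y w)) = \<sigma> ((\<tau> (Y w) - Var w) + Var w)" by simp
    also have "\<dots> = \<sigma> (\<tau> (Y w) - Var w) + Y w" by (simp only: \<sigma>_def Const_hom.subst_add Const_hom.subst_Var)
    finally have "\<sigma> (\<tau> (Y w) - Var w) = 0" using st[of "Y w"] by simp
    then have "(\<Sum>v\<in>UNIV. Const (c v) * Y v) = 0"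
      unfolding c by (simp add: \<sigma>_def Const_hom.subst_sum Const_hom.subst_mult)
    then have "c v = 0" for v using Yind by blast
    then show ?thesis using c by simp
  qed
  show ?thesis
  proof (rule that[of y])
    show "y 0 = l1" "y 1 = l2" "?n \<ge> 2" by fact+
    show "y i \<in> forms 1" if "i < ?n" for i using y(4) that by auto
    show "Var v \<in> ideal_gen (y ` {..<?n})" for v
    proof -
      have "Var v = (\<Sum>w\<in>UNIV. Const (b v w) * Y w)" by (rule b)
      also have "\<dots> \<in> ideal_gen (y ` {..<?n})"
        by (intro ring_ideal.span_sum ring_ideal.span_scale ring_ideal.span_base) (use Yimg in auto)
      finally show ?thesis .
    qed
    fix i f assume i: "i < ?n" and f: "y i * f \<in> ideal_gen (y ` {..<i})"
    have im: "\<tau> ` y ` {..<i} = Var ` (e ` {..<i})"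
      unfolding image_image by (rule image_cong) (use i yY tY in auto)
    have "\<tau> (y i * f) \<in> ideal_gen (\<tau> ` y ` {..<i})"
      unfolding \<tau>_def by (rule subst_ideal_gen[OF f])
    moreover have "\<tau> (y i * f) = Var (e i) * \<tau> f"
      using yY[OF i] tY[of "e i"] by (simp add: \<tau>_def Const_hom.subst_mult)
    ultimately have "Var (e i) * \<tau> f \<in> ideal_gen (Var ` (e ` {..<i}))" unfolding im by simp
    moreover have "e i \<notin> e ` {..<i}" using e' i by (metis imageE lessThan_iff less_irrefl order.strict_trans)
    ultimately have "\<tau> f \<in> ideal_gen (Var ` (e ` {..<i}))" 
      by (rule Var_regular[rotated])
    then have "\<sigma> (\<tau> f) \<in> ideal_gen (\<sigma> ` Var ` (e ` {..<i}))"
      unfolding \<sigma>_def by (rule subst_ideal_gen)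
    moreover have "\<sigma> ` Var ` (e ` {..<i}) = y ` {..<i}"
      unfolding image_image by (rule image_cong) (use i yY in \<open>auto simp: \<sigma>_def\<close>)
    ultimately show "f \<in> ideal_gen (y ` {..<i})" using st by simp
  qed
qed

lemma ideal_gen_image_iff:
  assumes "finite A"
  shows "f \<in> ideal_gen (h ` A) \<longleftrightarrow> (\<exists>u. f = (\<Sum>i\<in>A. h i * u i))"
proof
  assume "f \<in> ideal_gen (h ` A)"
  then show "\<exists>u. f = (\<Sum>i\<in>A. h i * u i)"
  proof (induction f rule: ring_ideal.span_induct_alt)
    case base
    have "0 = (\<Sum>i\<in>A. h i * 0)" by simp
    then show ?case by (rule exI[of _ "\<lambda>_. 0"])
  next
    case (step c x y)
    then obtain i u where i: "i \<in> A" "x = h i" and u: "y = (\<Sum>i\<in>A. h i * u i)" by blast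
    have "(\<Sum>j\<in>A. h j * (u j + (if j = i then c else 0))) = y + (\<Sum>j\<in>A. if j = i then h i * c else 0)"
      unfolding u distrib_left sum.distrib by (intro arg_cong2[where f="(+)"] sum.cong) auto
    also have "\<dots> = c * x + y" using i assms by (simp add: mult.commute add.commute)
    finally show ?case by metis
  qed
next
  assume "\<exists>u. f = (\<Sum>i\<in>A. h i * u i)"
  then obtain u where u: "f = (\<Sum>i\<in>A. u i * h i)" by (auto simp: mult.commute)
  show "f \<in> ideal_gen (h ` A)" unfolding u
    by (intro ring_ideal.span_sum ring_ideal.span_scale ring_ideal.span_base imageI)
qed

lemma forms_Suc_expansion:
  fixes f :: "('k::field, 'n::finite) mpol"
  assumes "f \<in> forms (Suc t)"
  obtains u where "\<And>v. u v \<in> forms t" "f = (\<Sum>v\<in>UNIV. Var v * u v)"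
proof -
  have "f \<in> ideal_gen (Var ` UNIV)" unfolding Var_ideal_iff
  proof
    fix m assume "m \<in> ks f"
    then have "mdeg m \<noteq> 0" using assms by (simp add: forms_def)
    then show "\<exists>j\<in>UNIV. lk m j \<noteq> 0" by (auto simp: mdeg_def)
  qed
  then obtain u where u: "f = (\<Sum>v\<in>UNIV. Var v * u v)"
    unfolding ideal_gen_image_iff[OF finite] by blast
  have "f = hc (Suc t) f" using hc_forms[OF assms, of "Suc t"] by simp
  also have "\<dots> = (\<Sum>v\<in>UNIV. Var v * hc t (u v))"
    unfolding u hc_sum by (rule sum.cong) (simp_all add: hc_mult[OF forms_Var(2)])
  finally show ?thesis using that[of "\<lambda>v. hc t (u v)"] by simp
qed

lemma forms_subset_mono:
  fixes J :: "('k::field, 'n::finite) mpol set"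
  assumes J: "is_ideal J" and "forms t \<subseteq> J" "t \<le> t'"
  shows "forms t' \<subseteq> J"
  using assms(3,2)
proof (induction t' rule: dec_induct)
  case (step t')
  show ?case
  proof
    fix f :: "('k, 'n) mpol" assume "f \<in> forms (Suc t')"
    then obtain u where "\<And>v. u v \<in> forms t'" "f = (\<Sum>v\<in>UNIV. Var v * u v)"
      using forms_Suc_expansion by blast
    then show "f \<in> J" using step
      by (auto intro!: ring_ideal.subspace_sum[OF J] ideal_mult_right[OF J])
  qed
qed simp

lemma forms_subset_iff:
  fixes J :: "('k::field, 'n::finite) mpol set"
  assumes J: "is_ideal J"
  shows "forms t \<subseteq> J \<longleftrightarrow> (\<forall>m. mdeg m = t \<longrightarrow> mon m \<in> J)"
proof
  assume m: "\<forall>m. mdeg m = t \<longrightarrow> mon m \<in> J"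
  show "forms t \<subseteq> J"
  proof
    fix f :: "('k, 'n) mpol" assume "f \<in> forms t"
    then have "(\<Sum>m\<in>ks f. Const (lk f m) * mon m) \<in> J"
      using m by (intro ring_ideal.subspace_sum[OF J] ideal_mult_right[OF J]) (auto simp: forms_def)
    then show "f \<in> J" using mon_expansion[of f] by simp
  qed
qed (use mon_in_forms in auto)

lemma mdeg_split:
  assumes "mdeg m = a + b"
  obtains p q where "m = p + q" "mdeg p = a" "mdeg q = b"
  using assms
proof (induction a arbitrary: m thesis)
  case 0
  from 0(1)[of 0 m] 0(2) show ?case by simp
next
  case (Suc a)
  then have "mdeg m \<noteq> 0" by simp
  then obtain i where i: "lk m i \<noteq> 0" by (auto simp: mdeg_def)
  define m' where "m' = m - Poly_Mapping.single i 1"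
  have m: "m = m' + Poly_Mapping.single i 1" unfolding m'_def
    by (rule poly_mapping_eqI) (use i in \<open>auto simp: lookup_add lookup_minus lookup_single when_def\<close>)
  have "mdeg m' = a + b" using Suc(3) unfolding m by simp
  then obtain p q where "m' = p + q" "mdeg p = a" "mdeg q = b" using Suc(1) by blast
  then show ?case using Suc(2)[of "p + Poly_Mapping.single i 1" q] m by (simp add: ac_simps)
qed

section \<open>General linear forms\<close>

definition lform :: "(nat \<times> 'n \<Rightarrow> 'k) \<Rightarrow> nat \<Rightarrow> ('k::field, 'n::finite) mpol" where
  "lform a i = (\<Sum>j\<in>UNIV. Const (a (i, j)) * Var j)"

lemma linear_forms_eq: "linear_forms s a = lform a ` {..<s}"
  by (simp add: linear_forms_def lform_def)

lemma lform_in_forms [simp]: "lform a i \<in> forms 1" "lform a i \<in> forms (Suc 0)"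
  using linear_comb_in_forms[of UNIV Var 1 "\<lambda>j. a (i, j)"] by (simp_all add: lform_def)

lemma linear_forms_subset: "linear_forms s a \<subseteq> (\<Union>t. forms t)"
  unfolding linear_forms_eq using lform_in_forms by blast

lemma linear_forms_cong:
  "(\<And>i j. i < s \<Longrightarrow> a (i, j) = b (i, j)) \<Longrightarrow> linear_forms s a = linear_forms s b"
  unfolding linear_forms_eq lform_def by (rule image_cong) auto

lemma mem_ideal_linear_forms_iff:
  assumes "is_ideal P"
  shows "f \<in> ideal_gen (P \<union> linear_forms k a) \<longleftrightarrow> (\<exists>p u. p \<in> P \<and> f = p + (\<Sum>i<k. lform a i * u i))"
proof -
  have "f \<in> ideal_gen (P \<union> linear_forms k a) \<longleftrightarrow>
    (\<exists>p y. f = p + y \<and> p \<in> P \<and> y \<in> ideal_gen (lform a ` {..<k}))"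
    unfolding ideal_gen_Un[OF assms] linear_forms_eq by blast
  then show ?thesis unfolding ideal_gen_image_iff[OF finite_lessThan] by blast
qed

text \<open>The support condition of \<open>zariski_open\<close>: such polynomials can be evaluated
  at extensional functions on \<open>A\<close>.\<close>

definition vars_in :: "'v set \<Rightarrow> ('k::field, 'v) mpol \<Rightarrow> bool" where
  "vars_in A g \<longleftrightarrow> (\<forall>m\<in>ks g. ks m \<subseteq> A)"

lemma vars_in_0 [simp]: "vars_in A 0"
  and vars_in_Const [simp]: "vars_in A (Const x)"
  and vars_in_1 [simp]: "vars_in A 1"
  by (auto simp: vars_in_def Const_def)

lemma vars_in_Var: "v \<in> A \<Longrightarrow> vars_in A (Var v)"
  by (auto simp: vars_in_def Var_def)

lemma vars_in_uminus: "vars_in A f \<Longrightarrow> vars_in A (- f)"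
  by (simp add: vars_in_def in_keys_iff)

lemma vars_in_add: "vars_in A f \<Longrightarrow> vars_in A g \<Longrightarrow> vars_in A (f + g)"
  using keys_add[of f g] unfolding vars_in_def by blast

lemma vars_in_mult:
  assumes "vars_in A f" "vars_in A g" shows "vars_in A (f * g)"
  unfolding vars_in_def
proof
  fix m assume "m \<in> ks (f * g)"
  then obtain p q where "m = p + q" "p \<in> ks f" "q \<in> ks g" using keys_mult[of f g] by blast
  then show "ks m \<subseteq> A" using assms keys_add[of p q] unfolding vars_in_def by blast
qed

lemma vars_in_sum: "(\<And>i. i \<in> S \<Longrightarrow> vars_in A (f i)) \<Longrightarrow> vars_in A (sum f S)"
  by (induction S rule: infinite_finite_induct) (auto intro: vars_in_add)

lemma vars_in_prod: "(\<And>i. i \<in> S \<Longrightarrow> vars_in A (f i)) \<Longrightarrow> vars_in A (prod f S)"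
  by (induction S rule: infinite_finite_induct) (auto intro: vars_in_mult)

lemma vars_in_det:
  assumes "M \<in> carrier_mat N N" "\<And>i j. i < N \<Longrightarrow> j < N \<Longrightarrow> vars_in A (M $$ (i, j))"
  shows "vars_in A (det M)"
proof -
  have sgn: "vars_in A (of_int (sign p))" for p :: "nat \<Rightarrow> nat"
    by (cases p rule: sign_cases) (auto intro: vars_in_uminus)
  show ?thesis unfolding det_def'[OF assms(1)]
  proof (intro vars_in_sum vars_in_mult vars_in_prod sgn)
    fix p i assume "p \<in> {p. p permutes {0..<N}}" "i \<in> {0..<N}"
    then have "i < N" "p i < N" using permutes_in_image by fastforce+
    then show "vars_in A (M $$ (i, p i))" by (rule assms(2))
  qed
qed

lemma eval_mpol_sum: "eval_mpol a (sum f S) = (\<Sum>i\<in>S. eval_mpol a (f i))"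
  by (induction S rule: infinite_finite_induct) (auto simp: eval_mpol_hom)

lemma eval_mpol_comm_ring_hom: "comm_ring_hom (eval_mpol (a :: 'v \<Rightarrow> 'k::field))"
  by unfold_locales (simp_all add: eval_mpol_hom)

lemma eval_mpol_cong:
  assumes "vars_in A g" "\<And>v. v \<in> A \<Longrightarrow> a v = b v"
  shows "eval_mpol a g = eval_mpol b g"
  unfolding eval_mpol_def
  by (intro sum.cong refl arg_cong2[where f="(*)"] prod.cong)
    (use assms in \<open>auto simp: vars_in_def, metis subsetD\<close>)

text \<open>
  If every monomial \<open>x\<^sub>r\<close> of degree \<open>t\<close> is \<open>p\<^sub>r + \<Sum>\<^sub>i \<ell>\<^sub>i(a\<^sub>0) u\<^sub>r\<^sub>i\<close> with \<open>p\<^sub>r \<in> P\<close>, then the elements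
  \<open>p\<^sub>r + \<Sum>\<^sub>i \<ell>\<^sub>i(a) u\<^sub>r\<^sub>i\<close> span the forms of degree \<open>t\<close> whenever their coefficient matrix, which is
  polynomial in \<open>a\<close> and the identity at \<open>a\<^sub>0\<close>, has nonzero determinant.
\<close>

lemma forms_in_ideal_open:
  fixes P :: "('k::field, 'n::finite) mpol set"
  assumes P: "homogeneous_ideal P" and a0: "forms t \<subseteq> ideal_gen (P \<union> linear_forms k a0)"
  obtains g where "vars_in ({..<k} \<times> UNIV) g" "eval_mpol a0 g \<noteq> 0"
    "\<And>a. eval_mpol a g \<noteq> 0 \<Longrightarrow> forms t \<subseteq> ideal_gen (P \<union> linear_forms k a)"
proof -
  note iP = homogeneous_idealD(1)[OF P]
  define N where "N = card {m :: 'n \<Rightarrow>\<^sub>0 nat. mdeg m = t}"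
  obtain mo :: "nat \<Rightarrow> ('n \<Rightarrow>\<^sub>0 nat)" where mo: "bij_betw mo {0..<N} {m. mdeg m = t}"
    using ex_bij_betw_nat_finite[OF finite_mdeg_eq] N_def by blast
  have mot: "mdeg (mo r) = t" if "r < N" for r using bij_betwE[OF mo] that by simp
  have mo_inj: "mo r = mo s \<longleftrightarrow> r = s" if "r < N" "s < N" for r s
    using mo that unfolding bij_betw_def inj_on_def by auto
  have mo_surj: "\<exists>r<N. m = mo r" if "mdeg m = t" for m
    using mo that unfolding bij_betw_def by force
  have "\<forall>r. \<exists>p u. r < N \<longrightarrow> p \<in> P \<and> mon (mo r) = p + (\<Sum>i<k. lform a0 i * u i)"
  proof
    fix r
    show "\<exists>p u. r < N \<longrightarrow> p \<in> P \<and> mon (mo r) = p + (\<Sum>i<k. lform a0 i * u i)"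
    proof (cases "r < N")
      case True
      then have "mon (mo r) \<in> ideal_gen (P \<union> linear_forms k a0)"
        using a0 mon_in_forms[of "mo r"] mot by auto
      then show ?thesis unfolding mem_ideal_linear_forms_iff[OF iP] by blast
    qed simp
  qed
  then obtain p u where pu: "\<And>r. r < N \<Longrightarrow> p r \<in> P"
    "\<And>r. r < N \<Longrightarrow> mon (mo r) = p r + (\<Sum>i<k. lform a0 i * u r i)"
    by metis
  define e where "e a r = p r + (\<Sum>i<k. lform a i * u r i)" for a r
  \<comment> \<open>The coefficient of the \<open>s\<close>-th monomial in \<open>e a r\<close>, as
    a polynomial in unknowns (i, j) that stand for the coefficients of the linear forms.\<close>
  define G where "G r s = Const (lk (p r) (mo s)) +
    (\<Sum>i<k. \<Sum>j\<in>UNIV. Const (lk (Var j * u r i) (mo s)) * Var (i, j))" for r s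
  define M where "M = mat N N (\<lambda>(r, s). G r s)"
  have M: "M \<in> carrier_mat N N" by (simp add: M_def)
  have evG: "eval_mpol a (G r s) = lk (e a r) (mo s)" for a r s
  proof -
    have "lk (lform a i * u r i) (mo s) = (\<Sum>j\<in>UNIV. lk (Var j * u r i) (mo s) * a (i, j))" for i
      unfolding lform_def sum_distrib_right lookup_sum mult.assoc lookup_Const_mult
      by (simp add: mult.commute)
    then show ?thesis
      by (simp add: G_def e_def lookup_add lookup_sum eval_mpol_hom eval_mpol_sum)
  qed
  define Ma where "Ma a = map_mat (eval_mpol a) M" for a
  have Ma: "Ma a \<in> carrier_mat N N" for a using M by (simp add: Ma_def)
  have Mars: "Ma a $$ (r, s) = lk (e a r) (mo s)" if "r < N" "s < N" for a r s
    using that by (simp add: Ma_def M_def evG)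
  have det: "eval_mpol a (det M) = det (Ma a)" for a
    unfolding Ma_def by (rule comm_ring_hom.hom_det[OF eval_mpol_comm_ring_hom, symmetric])
  show ?thesis
  proof (rule that[of "det M"])
    show "vars_in ({..<k} \<times> UNIV) (det M)"
    proof (rule vars_in_det[OF M])
      fix r s assume "r < N" "s < N"
      then have "M $$ (r, s) = G r s" by (simp add: M_def)
      then show "vars_in ({..<k} \<times> UNIV) (M $$ (r, s))" unfolding G_def
        by (auto intro!: vars_in_add vars_in_sum vars_in_mult vars_in_Var)
    qed
    have "Ma a0 = 1\<^sub>m N"
    proof (rule eq_matI)
      fix r s assume rs: "r < dim_row (1\<^sub>m N :: 'k mat)" "s < dim_col (1\<^sub>m N :: 'k mat)"
      then have "e a0 r = mon (mo r)" using pu(2) by (simp add: e_def)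
      then show "Ma a0 $$ (r, s) = 1\<^sub>m N $$ (r, s)"
        using rs by (simp add: Mars mon_def lookup_single when_def mo_inj)
    qed (simp_all add: Ma_def M_def)
    then show "eval_mpol a0 (det M) \<noteq> 0" by (simp add: det)
    fix a assume "eval_mpol a (det M) \<noteq> 0"
    then have d: "det (Ma a) \<noteq> 0" by (simp add: det)
    let ?J = "ideal_gen (P \<union> linear_forms k a)"
    have hJ: "homogeneous_ideal ?J" by (rule homogeneous_ideal_gen_Un[OF P linear_forms_subset])
    note iJ = homogeneous_idealD(1)[OF hJ]
    \<comment> \<open>The \<open>p r\<close> and \<open>u r i\<close> are arbitrary polynomials, so
      \<open>e a r\<close> may have components in other degrees; these are cut off inside the
      homogeneous ideal.\<close>
    have eJ: "hc t (e a r) \<in> ?J" if "r < N" for r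
    proof (rule homogeneous_idealD(2)[OF hJ])
      show "e a r \<in> ?J" unfolding mem_ideal_linear_forms_iff[OF iP] e_def using pu(1)[OF that] by blast
    qed
    have hce: "lk (hc t (e a r)) (mo s) = Ma a $$ (r, s)" if "r < N" "s < N" for r s
      using that by (simp add: Mars mot)
    \<comment> \<open>The adjugate expresses the determinant times each monomial through the
      elements \<open>hc t (e a r)\<close> of the ideal.\<close>
    define B where "B = adj_mat (Ma a)"
    have B: "B \<in> carrier_mat N N" "B * Ma a = det (Ma a) \<cdot>\<^sub>m 1\<^sub>m N"
      using adj_mat[OF Ma] by (simp_all add: B_def)
    have monJ: "mon (mo q) \<in> ?J" if q: "q < N" for q
    proof -
      have "(\<Sum>r<N. Const (B $$ (q, r)) * hc t (e a r)) = Const (det (Ma a)) * mon (mo q)"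
      proof (rule poly_mapping_eqI)
        fix m
        show "lk (\<Sum>r<N. Const (B $$ (q, r)) * hc t (e a r)) m = lk (Const (det (Ma a)) * mon (mo q)) m"
        proof (cases "mdeg m = t")
          case True
          then obtain s where s: "s < N" "m = mo s" using mo_surj by blast
          have "lk (\<Sum>r<N. Const (B $$ (q, r)) * hc t (e a r)) m = (\<Sum>r<N. B $$ (q, r) * Ma a $$ (r, s))"
            unfolding lookup_sum lookup_Const_mult s(2) using s(1) hce by (intro sum.cong) auto
          also have "\<dots> = (B * Ma a) $$ (q, s)"
            using B(1) Ma[of a] q s(1) by (auto simp: scalar_prod_def atLeast0LessThan)
          also have "\<dots> = det (Ma a) * (if q = s then 1 else 0)" unfolding B(2) using q s(1) by simp
          also have "\<dots> = lk (Const (det (Ma a)) * mon (mo q)) m"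
            using mo_inj[OF q s(1)] s(2) by (simp add: mon_def lookup_single when_def)
          finally show ?thesis .
        next
          case False
          then have "m \<noteq> mo q" using mot[OF q] by auto
          with False show ?thesis by (simp add: lookup_sum mon_def lookup_single when_def)
        qed
      qed
      moreover have "(\<Sum>r<N. Const (B $$ (q, r)) * hc t (e a r)) \<in> ?J"
        by (intro ring_ideal.subspace_sum[OF iJ] ideal_mult_right[OF iJ] eJ) simp
      ultimately have "Const (det (Ma a)) * mon (mo q) \<in> ?J" by simp
      then have "Const (inverse (det (Ma a))) * (Const (det (Ma a)) * mon (mo q)) \<in> ?J"
        by (rule ideal_mult_right[OF iJ])
      then show ?thesis using d by (simp flip: Const_mult mult.assoc)
    qed
    show "forms t \<subseteq> ?J" unfolding forms_subset_iff[OF iJ] using monJ mo_surj by blast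
  qed
qed

lemma nonzero_poly_nonroot:
  fixes p :: "'k::field_char_0 poly"
  assumes "p \<noteq> 0"
  obtains y where "poly p y \<noteq> 0"
proof -
  have "finite {y. poly p y = 0}" by (rule poly_roots_finite[OF assms])
  then have "{y. poly p y = 0} \<noteq> UNIV" using infinite_UNIV_char_0 by metis
  with that show ?thesis by blast
qed

lemma eval_mpol_along_curve:
  fixes c :: "'v \<Rightarrow> 'k::field poly"
  shows "\<exists>q. \<forall>y. poly q y = eval_mpol (\<lambda>v. poly (c v) y) g"
proof (intro exI allI)
  show "poly (\<Sum>m\<in>ks g. Polynomial.smult (lk g m) (\<Prod>v\<in>ks m. c v ^ lk m v)) y = eval_mpol (\<lambda>v. poly (c v) y) g"
    for y by (simp add: eval_mpol_def poly_sum poly_prod)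
qed

text \<open>Affine space over an infinite field is irreducible: on the line that passes through
  \<open>a1\<close> at 0 and \<open>a2\<close> at 1, both polynomials restrict to nonzero
  polynomials in one variable.\<close>

lemma eval_mpol_common_nonzero:
  fixes a1 a2 :: "'v \<Rightarrow> 'k::field_char_0"
  assumes "eval_mpol a1 g1 \<noteq> 0" "eval_mpol a2 g2 \<noteq> 0"
  obtains a where "eval_mpol a g1 \<noteq> 0" "eval_mpol a g2 \<noteq> 0"
proof -
  define c where "c v = [:a1 v, a2 v - a1 v:]" for v
  obtain q1 where q1: "\<And>y. poly q1 y = eval_mpol (\<lambda>v. poly (c v) y) g1"
    using eval_mpol_along_curve[of c g1] by blast
  obtain q2 where q2: "\<And>y. poly q2 y = eval_mpol (\<lambda>v. poly (c v) y) g2"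
    using eval_mpol_along_curve[of c g2] by blast
  have "poly q1 0 \<noteq> 0" using assms(1) by (simp add: q1 c_def)
  moreover have "poly q2 1 \<noteq> 0" using assms(2) by (simp add: q2 c_def)
  ultimately have "q1 \<noteq> 0" "q2 \<noteq> 0" by auto
  then have "q1 * q2 \<noteq> 0" by simp
  then obtain y where "poly (q1 * q2) y \<noteq> 0" by (rule nonzero_poly_nonroot)
  then have "poly q1 y \<noteq> 0" "poly q2 y \<noteq> 0" by auto
  with that q1 q2 show ?thesis by metis
qed

section \<open>Homogeneous primes\<close>

lemma hc_product: "hc n (f * g) = (\<Sum>i\<le>n. hc i f * hc (n - i) g)"
proof -
  let ?D = "mdeg ` ks f"
  have hc0: "hc i f = 0" if "i \<notin> ?D" for i
  proof (rule poly_mapping_eqI)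
    fix k
    have "lk f k = 0" if "mdeg k = i" using that \<open>i \<notin> ?D\<close> by (metis imageI in_keys_iff)
    then show "lk (hc i f) k = lk 0 k" by simp
  qed
  have "hc n (f * g) = (\<Sum>i\<in>?D. hc n (hc i f * g))"
    by (subst sum_hc[of f]) (simp add: sum_distrib_right hc_sum)
  also have "\<dots> = (\<Sum>i\<in>?D. if i \<le> n then hc i f * hc (n - i) g else 0)"
    by (rule sum.cong) (simp_all add: hc_mult[OF hc_in_forms])
  also have "\<dots> = (\<Sum>i\<in>?D \<inter> {..n}. hc i f * hc (n - i) g)"
    by (rule sum.mono_neutral_cong_right) auto
  also have "\<dots> = (\<Sum>i\<le>n. hc i f * hc (n - i) g)"
  proof (rule sum.mono_neutral_left)
    show "\<forall>i\<in>{..n} - ?D \<inter> {..n}. hc i f * hc (n - i) g = 0"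
    proof
      fix i assume "i \<in> {..n} - ?D \<inter> {..n}"
      then have "i \<notin> ?D" by blast
      then show "hc i f * hc (n - i) g = 0" by (simp add: hc0)
    qed
  qed auto
  finally show ?thesis .
qed

text \<open>For a product lying in the ideal, look at the lowest components of the factors outside it.\<close>

lemma homogeneous_prime_idealI:
  fixes P :: "('k::field, 'n::finite) mpol set"
  assumes P: "homogeneous_ideal P" and one: "1 \<notin> P"
    and prime: "\<And>s t f g. f \<in> forms s \<Longrightarrow> g \<in> forms t \<Longrightarrow> f * g \<in> P \<Longrightarrow> f \<in> P \<or> g \<in> P"
  shows "prime_ideal P"
  unfolding prime_ideal_def
proof (intro conjI allI impI)
  note iP = homogeneous_idealD(1)[OF P]
  show "is_ideal P" "1 \<notin> P" by fact+
  fix f g assume fg: "f * g \<in> P"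
  show "f \<in> P \<or> g \<in> P"
  proof (rule ccontr)
    assume "\<not> (f \<in> P \<or> g \<in> P)"
    then obtain s0 t0 where "hc s0 f \<notin> P" "hc t0 g \<notin> P"
      using homogeneous_ideal_mem_iff[OF P] by blast
    then obtain s t where st: "hc s f \<notin> P" "\<And>i. i < s \<Longrightarrow> hc i f \<in> P"
      "hc t g \<notin> P" "\<And>i. i < t \<Longrightarrow> hc i g \<in> P"
      using exists_least_iff[of "\<lambda>i. hc i f \<notin> P"] exists_least_iff[of "\<lambda>i. hc i g \<notin> P"] by blast
    have "hc (s + t) (f * g) \<in> P" using homogeneous_idealD(2)[OF P fg] .
    then have 1: "(\<Sum>i\<le>s + t. hc i f * hc (s + t - i) g) \<in> P" by (simp add: hc_product)
    have 2: "(\<Sum>i\<in>{..s + t} - {s}. hc i f * hc (s + t - i) g) \<in> P"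
    proof (rule ring_ideal.subspace_sum[OF iP])
      fix i assume i: "i \<in> {..s + t} - {s}"
      show "hc i f * hc (s + t - i) g \<in> P"
      proof (cases "i < s")
        case True then show ?thesis using st(2) ideal_mult_left[OF iP] by blast
      next
        case False
        then have "s + t - i < t" using i by auto
        then show ?thesis using st(4) ideal_mult_right[OF iP] by blast
      qed
    qed
    have "(\<Sum>i\<le>s + t. hc i f * hc (s + t - i) g) =
      hc s f * hc t g + (\<Sum>i\<in>{..s + t} - {s}. hc i f * hc (s + t - i) g)"
      by (subst sum.remove[of _ s]) auto
    then have "hc s f * hc t g \<in> P" using ring_ideal.subspace_diff[OF iP 1 2] by simp
    then show False using prime[OF hc_in_forms hc_in_forms] st(1,3) by blast
  qed
qed

lemma homogeneous_ideal_Union_chain: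
  assumes C: "C \<noteq> {}" "subset.chain A C" and hom: "\<And>P. P \<in> C \<Longrightarrow> homogeneous_ideal P"
  shows "homogeneous_ideal (\<Union>C)"
proof (rule homogeneous_idealI)
  show "is_ideal (\<Union>C)"
  proof (rule ring_ideal.subspaceI)
    show "0 \<in> \<Union>C" using C(1) hom homogeneous_idealD(1) ring_ideal.subspace_0 by blast
    show "c * x \<in> \<Union>C" if "x \<in> \<Union>C" for c x
      using that hom homogeneous_idealD(1) ideal_mult_right by blast
    fix x y assume "x \<in> \<Union>C" "y \<in> \<Union>C"
    then obtain P where "P \<in> C" "{x, y} \<subseteq> P"
      using finite_subset_Union_chain[of "{x, y}" C A] C by auto
    then show "x + y \<in> \<Union>C" using hom homogeneous_idealD(1) ring_ideal.subspace_add by blast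
  qed
  show "hc t f \<in> \<Union>C" if "f \<in> \<Union>C" for f t using that hom homogeneous_idealD(2) by blast
qed

text \<open>Zorn's lemma inside the homogeneous ideals above I, for a property that survives unions
  of nonempty chains. It is used for \<open>W \<inter> P = {}\<close> and for
  \<open>never_artinian k\<close>.\<close>

lemma maximal_homogeneous_ideal:
  assumes I: "homogeneous_ideal I" "Q I"
    and chain: "\<And>C. C \<noteq> {} \<Longrightarrow> subset.chain UNIV C \<Longrightarrow> (\<And>P. P \<in> C \<Longrightarrow> homogeneous_ideal P \<and> Q P) \<Longrightarrow> Q (\<Union>C)"
  shows "\<exists>P. homogeneous_ideal P \<and> I \<subseteq> P \<and> Q P \<and>
    (\<forall>P'. homogeneous_ideal P' \<longrightarrow> P \<subset> P' \<longrightarrow> \<not> Q P')"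
proof -
  let ?A = "{P. homogeneous_ideal P \<and> I \<subseteq> P \<and> Q P}"
  have "\<exists>M\<in>?A. \<forall>X\<in>?A. M \<subseteq> X \<longrightarrow> X = M"
  proof (rule subset_Zorn_nonempty)
    show "?A \<noteq> {}" using I by blast
    fix C assume C: "C \<noteq> {}" "subset.chain ?A C"
    then have CA: "C \<subseteq> ?A" by (simp add: subset.chain_def)
    have C': "subset.chain UNIV C" using C(2) unfolding subset.chain_def by blast
    have "homogeneous_ideal (\<Union>C)"
      by (rule homogeneous_ideal_Union_chain[OF C(1) C']) (use CA in blast)
    moreover have "I \<subseteq> \<Union>C" using C(1) CA by blast
    moreover have "Q (\<Union>C)" by (rule chain[OF C(1) C']) (use CA in blast)
    ultimately show "\<Union>C \<in> ?A" by simp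
  qed
  then obtain M where M: "M \<in> ?A" "\<forall>X\<in>?A. M \<subseteq> X \<longrightarrow> X = M" by (rule bexE)
  show ?thesis
  proof (intro exI[of _ M] conjI allI impI)
    show "homogeneous_ideal M" "I \<subseteq> M" "Q M" using M(1) by auto
    show "\<not> Q P'" if "homogeneous_ideal P'" "M \<subset> P'" for P'
    proof
      assume "Q P'"
      then have "P' \<in> ?A" using that M(1) by auto
      with M(2) that(2) show False by auto
    qed
  qed
qed

text \<open>The product of (J, f) and (J, g) is contained in (J, fg) = J.\<close>

lemma product_mem_ideal:
  assumes J: "is_ideal J" and x: "x1 - f * v1 \<in> J" "x2 - g * v2 \<in> J" and fg: "f * g \<in> J"
  shows "x1 * x2 \<in> J"
proof -
  have "f * v1 * (g * v2) = f * g * (v1 * v2)" by (simp only: mult_ac)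
  then have "x1 * x2 = (x1 - f * v1) * x2 + (f * v1) * (x2 - g * v2) + (f * g) * (v1 * v2)"
    by (simp only: left_diff_distrib right_diff_distrib) simp
  also have "\<dots> \<in> J"
    by (intro ring_ideal.subspace_add[OF J] ideal_mult_left[OF J x(1)] ideal_mult_right[OF J x(2)]
      ideal_mult_left[OF J fg])
  finally show ?thesis .
qed

lemma psubset_ideal_gen_insert: "f \<notin> P \<Longrightarrow> P \<subset> ideal_gen (insert f P)"
  using ring_ideal.span_superset[of "insert f P"] by blast

text \<open>An ideal that is maximal among the homogeneous ideals avoiding the multiplicative set is
  prime. Testing primality on forms keeps (P, f) and (P, g) homogeneous, so both meet
  \<open>W\<close>.\<close>

lemma homogeneous_prime_avoiding:
  fixes I :: "('k::field, 'n::finite) mpol set"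
  assumes I: "homogeneous_ideal I" and W: "W \<inter> I = {}" "1 \<in> W"
    "\<And>x y. x \<in> W \<Longrightarrow> y \<in> W \<Longrightarrow> x * y \<in> W"
  obtains P where "homogeneous_ideal P" "prime_ideal P" "I \<subseteq> P" "W \<inter> P = {}"
proof -
  have "W \<inter> \<Union>C = {}" if "\<And>P. P \<in> C \<Longrightarrow> homogeneous_ideal P \<and> W \<inter> P = {}" for C
    using that by blast
  from maximal_homogeneous_ideal[of I "\<lambda>P. W \<inter> P = {}", OF I W(1) this]
  obtain P where P: "homogeneous_ideal P" "I \<subseteq> P" "W \<inter> P = {}"
    "\<And>P'. homogeneous_ideal P' \<Longrightarrow> P \<subset> P' \<Longrightarrow> W \<inter> P' \<noteq> {}"
    by blast
  note iP = homogeneous_idealD(1)[OF P(1)]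
  have "prime_ideal P"
  proof (rule homogeneous_prime_idealI[OF P(1)])
    show "1 \<notin> P" using W(2) P(3) by blast
    fix s t f g assume f: "f \<in> forms s" "g \<in> forms t" "f * g \<in> P"
    show "f \<in> P \<or> g \<in> P"
    proof (rule ccontr)
      assume "\<not> (f \<in> P \<or> g \<in> P)"
      then have nP: "f \<notin> P" "g \<notin> P" by auto
      have meets: "\<exists>w v. w \<in> W \<and> w - h * v \<in> P" if h: "h \<in> forms e" "h \<notin> P" for h e
      proof -
        have "W \<inter> ideal_gen (insert h P) \<noteq> {}"
          by (rule P(4)[OF homogeneous_ideal_gen_insert[OF P(1) h(1)] psubset_ideal_gen_insert[OF h(2)]])
        then obtain w where "w \<in> W" "w \<in> ideal_gen (insert h P)" by auto
        then show ?thesis using ideal_gen_insert_iff[OF iP, of w h] by auto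
      qed
      obtain w1 v1 where w1: "w1 \<in> W" "w1 - f * v1 \<in> P" using meets[OF f(1) nP(1)] by auto
      obtain w2 v2 where w2: "w2 \<in> W" "w2 - g * v2 \<in> P" using meets[OF f(2) nP(2)] by auto
      have "w1 * w2 \<in> P" by (rule product_mem_ideal[OF iP w1(2) w2(2) f(3)])
      then show False using W(3)[OF w1(1) w2(1)] P(3) by auto
    qed
  qed
  with P(1-3) show ?thesis by (intro that[of P])
qed

text \<open>
  For a homogeneous ideal \<open>P\<close>, the condition says that \<open>R/(P, \<ell>\<^sub>1, \<dots>, \<ell>\<^sub>k)\<close> has infinite length for all
  linear forms.
\<close>

definition never_artinian :: "nat \<Rightarrow> ('k::field, 'n::finite) mpol set \<Rightarrow> bool" where
  "never_artinian k P \<longleftrightarrow> (\<forall>a t. \<not> forms t \<subseteq> ideal_gen (P \<union> linear_forms k a))"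

lemma ideal_gen_insert_Un:
  "ideal_gen (ideal_gen (insert f P) \<union> L) = ideal_gen (insert f (ideal_gen (P \<union> L)))"
proof -
  have 1: "ideal_gen (ideal_gen A \<union> B) = ideal_gen (A \<union> B)" for A B :: "'a::comm_ring_1 set"
    by (simp add: ring_ideal.span_Un ring_ideal.span_span)
  have "ideal_gen (ideal_gen (insert f P) \<union> L) = ideal_gen ((P \<union> L) \<union> {f})"
    unfolding 1 by (rule arg_cong[of _ _ ideal_gen]) auto
  also have "\<dots> = ideal_gen (ideal_gen (P \<union> L) \<union> {f})" unfolding 1 ..
  finally show ?thesis by simp
qed

text \<open>There are finitely many monomials of degree \<open>t\<close>, so finitely many elements
  of the union suffice to reach them, and these lie in a single member of the chain.\<close>

lemma never_artinian_Union_chain: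
  fixes C :: "('k::field, 'n::finite) mpol set set"
  assumes C: "C \<noteq> {}" "subset.chain UNIV C"
    and na: "\<And>P. P \<in> C \<Longrightarrow> homogeneous_ideal P \<and> never_artinian k P"
  shows "never_artinian k (\<Union>C)"
  unfolding never_artinian_def
proof (intro allI notI)
  fix a t assume sub: "forms t \<subseteq> ideal_gen (\<Union>C \<union> linear_forms k a)"
  have iC: "is_ideal (\<Union>C)"
    by (rule homogeneous_idealD(1)[OF homogeneous_ideal_Union_chain[OF C]]) (use na in blast)
  have "\<forall>m. \<exists>p u. mdeg m = t \<longrightarrow> p \<in> \<Union>C \<and> (mon m :: ('k, 'n) mpol) = p + (\<Sum>i<k. lform a i * u i)"
  proof
    fix m :: "'n \<Rightarrow>\<^sub>0 nat"
    show "\<exists>p u. mdeg m = t \<longrightarrow> p \<in> \<Union>C \<and> (mon m :: ('k, 'n) mpol) = p + (\<Sum>i<k. lform a i * u i)"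
      using sub mon_in_forms[of m] mem_ideal_linear_forms_iff[OF iC, of "mon m" k a] by blast
  qed
  then obtain p u where pu: "\<And>m. mdeg m = t \<Longrightarrow> p m \<in> \<Union>C"
    "\<And>m. mdeg m = t \<Longrightarrow> (mon m :: ('k, 'n) mpol) = p m + (\<Sum>i<k. lform a i * u m i)" by metis
  have "p ` {m. mdeg m = t} \<subseteq> \<Union>C" using pu(1) by blast
  then obtain P where P: "P \<in> C" "p ` {m. mdeg m = t} \<subseteq> P"
    using finite_subset_Union_chain[OF finite_imageI[OF finite_mdeg_eq] _ C] by metis
  have iP: "is_ideal P" using na[OF P(1)] homogeneous_idealD(1) by blast
  have "forms t \<subseteq> ideal_gen (P \<union> linear_forms k a)"
    unfolding forms_subset_iff[OF ring_ideal.subspace_span]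
  proof (intro allI impI)
    fix m :: "'n \<Rightarrow>\<^sub>0 nat" assume m: "mdeg m = t"
    then have "p m \<in> P" using P(2) by blast
    then show "(mon m :: ('k, 'n) mpol) \<in> ideal_gen (P \<union> linear_forms k a)"
      unfolding mem_ideal_linear_forms_iff[OF iP] using pu(2)[OF m] by blast
  qed
  then show False using na[OF P(1)] unfolding never_artinian_def by blast
qed

text \<open>If fg lies in the maximal ideal \<open>P\<close> but f and g do not, then (P, f) and (P,
  g) acquire finite length modulo suitable linear forms. Openness provides the same forms for both,
  and then R_(t1+t2), spanned by products from R_t1 and R_t2, lies in P plus these forms.\<close>

lemma never_artinian_prime:
  fixes I :: "('k::field_char_0, 'n::finite) mpol set"
  assumes I: "homogeneous_ideal I" "never_artinian k I"
  obtains P where "P \<in> proj_points I" "never_artinian k P"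
proof -
  from maximal_homogeneous_ideal[of I "never_artinian k", OF I never_artinian_Union_chain]
  obtain P where P: "homogeneous_ideal P" "I \<subseteq> P" "never_artinian k P"
    "\<And>P'. homogeneous_ideal P' \<Longrightarrow> P \<subset> P' \<Longrightarrow> \<not> never_artinian k P'"
    by blast
  note iP = homogeneous_idealD(1)[OF P(1)]
  \<comment> \<open>The zero forms are among the linear forms covered by
    \<open>never_artinian\<close>, so \<open>P\<close> itself contains no R_t. This excludes 1 and,
    for t = 1, the irrelevant ideal.\<close>
  have nsub: "\<not> forms t \<subseteq> P" for t
  proof
    assume "forms t \<subseteq> P"
    also have "P \<subseteq> ideal_gen (P \<union> linear_forms k (\<lambda>_. 0))"
      using ring_ideal.span_superset[of "P \<union> linear_forms k (\<lambda>_. 0)"] by simp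
    finally show False using P(3) unfolding never_artinian_def by simp
  qed
  have "prime_ideal P"
  proof (rule homogeneous_prime_idealI[OF P(1)])
    show "1 \<notin> P" using nsub[of 0] ideal_mult_right[OF iP, of 1] by auto
    fix s t f g assume f: "f \<in> forms s" "g \<in> forms t" "f * g \<in> P"
    show "f \<in> P \<or> g \<in> P"
    proof (rule ccontr)
      assume "\<not> (f \<in> P \<or> g \<in> P)"
      then have nP: "f \<notin> P" "g \<notin> P" by auto
      note hom = homogeneous_ideal_gen_insert[OF P(1) f(1)] homogeneous_ideal_gen_insert[OF P(1) f(2)]
      have "\<not> never_artinian k (ideal_gen (insert f P))" "\<not> never_artinian k (ideal_gen (insert g P))"
        by (intro P(4) hom psubset_ideal_gen_insert nP)+
      then obtain a1 a2 t1 t2 where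
        a1: "forms t1 \<subseteq> ideal_gen (ideal_gen (insert f P) \<union> linear_forms k a1)" and
        a2: "forms t2 \<subseteq> ideal_gen (ideal_gen (insert g P) \<union> linear_forms k a2)"
        unfolding never_artinian_def by auto
      obtain g1 where g1: "eval_mpol a1 g1 \<noteq> 0"
        "\<And>a. eval_mpol a g1 \<noteq> 0 \<Longrightarrow> forms t1 \<subseteq> ideal_gen (ideal_gen (insert f P) \<union> linear_forms k a)"
        using forms_in_ideal_open[OF hom(1) a1] by metis
      obtain g2 where g2: "eval_mpol a2 g2 \<noteq> 0"
        "\<And>a. eval_mpol a g2 \<noteq> 0 \<Longrightarrow> forms t2 \<subseteq> ideal_gen (ideal_gen (insert g P) \<union> linear_forms k a)"
        using forms_in_ideal_open[OF hom(2) a2] by metis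
      obtain a where a: "eval_mpol a g1 \<noteq> 0" "eval_mpol a g2 \<noteq> 0"
        using eval_mpol_common_nonzero[OF g1(1) g2(1)] .
      let ?J = "ideal_gen (P \<union> linear_forms k a)"
      have iJ: "is_ideal ?J" by simp
      have s1: "forms t1 \<subseteq> ideal_gen (insert f ?J)" and s2: "forms t2 \<subseteq> ideal_gen (insert g ?J)"
        using g1(2)[OF a(1)] g2(2)[OF a(2)] unfolding ideal_gen_insert_Un .
      have fgJ: "f * g \<in> ?J" using f(3) by (intro ring_ideal.span_base) simp
      have "forms (t1 + t2) \<subseteq> ?J" unfolding forms_subset_iff[OF iJ]
      proof (intro allI impI)
        fix m :: "'n \<Rightarrow>\<^sub>0 nat" assume "mdeg m = t1 + t2"
        then obtain p q where pq: "m = p + q" "mdeg p = t1" "mdeg q = t2" by (rule mdeg_split)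
        then have "mon p \<in> ideal_gen (insert f ?J)" "mon q \<in> ideal_gen (insert g ?J)"
          using subsetD[OF s1, of "mon p"] subsetD[OF s2, of "mon q"]
            mon_in_forms[of p] mon_in_forms[of q] by auto
        then obtain v1 v2 where "mon p - f * v1 \<in> ?J" "mon q - g * v2 \<in> ?J"
          unfolding ideal_gen_insert_iff[OF iJ] by auto
        then show "mon m \<in> ?J" unfolding pq(1) mon_add by (rule product_mem_ideal[OF iJ _ _ fgJ])
      qed
      then show False using P(3) unfolding never_artinian_def by auto
    qed
  qed
  moreover have "\<not> range Var \<subseteq> P"
  proof
    assume V: "range Var \<subseteq> P"
    have "forms 1 \<subseteq> P"
    proof
      fix f :: "('k, 'n) mpol" assume "f \<in> forms 1"
      then have "f = (\<Sum>v\<in>UNIV. Const (lk f (Poly_Mapping.single v 1)) * Var v)"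
        by (rule linear_form_expansion)
      also have "\<dots> \<in> P"
        by (intro ring_ideal.subspace_sum[OF iP] ideal_mult_right[OF iP]) (use V in blast)
      finally show "f \<in> P" .
    qed
    then show False using nsub by simp
  qed
  ultimately have "P \<in> proj_points I" using P(1,2) by (simp add: proj_points_def)
  with P(3) show ?thesis by (intro that[of P])
qed

lemma linear_forms_Suc: "linear_forms (Suc k) (\<lambda>(i, j). if i = k then c j else a (i, j)) =
  insert (\<Sum>j\<in>UNIV. Const (c j) * Var j) (linear_forms k a)"
proof -
  let ?b = "\<lambda>(i, j). if i = k then c j else a (i, j)"
  have "linear_forms k ?b = linear_forms k a" by (rule linear_forms_cong) auto
  moreover have "lform ?b k = (\<Sum>j\<in>UNIV. Const (c j) * Var j)" by (simp add: lform_def)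
  ultimately show ?thesis unfolding linear_forms_eq by (simp add: lessThan_Suc)
qed

text \<open>Appending \<open>l\<close> to \<open>k\<close> linear forms gives k + 1 linear
  forms.\<close>

lemma never_artinian_insert:
  assumes "never_artinian (Suc k) P" "l \<in> forms 1"
  shows "never_artinian k (ideal_gen (insert l P))"
  unfolding never_artinian_def
proof (intro allI notI)
  fix a t assume sub: "forms t \<subseteq> ideal_gen (ideal_gen (insert l P) \<union> linear_forms k a)"
  let ?b = "\<lambda>(i, j). if i = k then lk l (Poly_Mapping.single j 1) else a (i, j)"
  have 1: "ideal_gen (ideal_gen A \<union> B) = ideal_gen (A \<union> B)" for A B :: "'z::comm_ring_1 set"
    by (simp add: ring_ideal.span_Un ring_ideal.span_span)
  have "linear_forms (Suc k) ?b = insert l (linear_forms k a)"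
    using linear_forms_Suc[of k "\<lambda>j. lk l (Poly_Mapping.single j 1)" a]
    by (simp only: linear_form_expansion[OF assms(2), symmetric])
  then have "ideal_gen (ideal_gen (insert l P) \<union> linear_forms k a) =
    ideal_gen (P \<union> linear_forms (Suc k) ?b)" unfolding 1 by simp
  with sub assms(1) show False unfolding never_artinian_def by auto
qed

lemma proj_points_antimono: "I \<subseteq> J \<Longrightarrow> proj_points J \<subseteq> proj_points I"
  unfolding proj_points_def by (rule Collect_mono) (metis order_trans)

lemma never_artinian_chain:
  fixes I :: "('k::field_char_0, 'n::finite) mpol set"
  assumes "homogeneous_ideal I" "never_artinian k I"
  shows "\<exists>P. (\<forall>i\<le>k. P i \<in> proj_points I) \<and> (\<forall>i<k. P i \<subset> P (Suc i))"
  using assms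
proof (induction k arbitrary: I)
  case 0
  obtain P where "P \<in> proj_points I" using never_artinian_prime[OF 0] by blast
  then show ?case by (intro exI[of _ "\<lambda>_. P"]) simp
next
  case (Suc k)
  obtain P where P: "P \<in> proj_points I" "never_artinian (Suc k) P"
    using never_artinian_prime[OF Suc.prems] by blast
  \<comment> \<open>A relevant prime misses some variable, and every prime above (P, x_v) contains P
    strictly. The chain obtained by induction for (P, x_v) is therefore prolonged below by
    P.\<close>
  then obtain v where v: "Var v \<notin> P" by (auto simp: proj_points_def)
  have hP: "homogeneous_ideal P" using P(1) by (simp add: proj_points_def)
  let ?J = "ideal_gen (insert (Var v) P)"
  from Suc.IH[OF homogeneous_ideal_gen_insert[OF hP forms_Var(1)]
      never_artinian_insert[OF P(2) forms_Var(1)], of v]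
  obtain Q where Q: "\<forall>i\<le>k. Q i \<in> proj_points ?J" "\<forall>i<k. Q i \<subset> Q (Suc i)"
    by (elim exE conjE)
  have PJ: "P \<subset> ?J" using psubset_ideal_gen_insert[OF v] .
  have "I \<subseteq> P" using P(1) by (simp add: proj_points_def)
  then have QI: "Q i \<in> proj_points I" if "i \<le> k" for i
    using subsetD[OF proj_points_antimono[OF order_trans[OF _ psubset_imp_subset[OF PJ]]], of I "Q i"]
      Q(1) that by simp
  have "?J \<subseteq> Q 0" using Q(1) by (simp add: proj_points_def)
  with PJ have PQ: "P \<subset> Q 0" by (rule psubset_subset_trans)
  show ?case
  proof (intro exI conjI allI impI)
    let ?R = "\<lambda>i. case i of 0 \<Rightarrow> P | Suc i \<Rightarrow> Q i"
    show "?R i \<in> proj_points I" if "i \<le> Suc k" for i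
      using that P(1) QI by (cases i) auto
    show "?R i \<subset> ?R (Suc i)" if "i < Suc k" for i
      using that PQ Q(2) by (cases i) auto
  qed
qed

lemma scheme_dim_geI:
  assumes "\<forall>i\<le>l. P i \<in> proj_points I" "\<forall>i<l. P i \<subset> P (Suc i)"
  shows "ereal (real l) \<le> scheme_dim I"
  unfolding scheme_dim_def by (rule SUP_upper) (use assms in blast)

lemma artinian_reduction_exists:
  fixes I :: "('k::field_char_0, 'n::finite) mpol set"
  assumes "homogeneous_ideal I" "scheme_dim I \<le> 1"
  obtains a t where "forms t \<subseteq> ideal_gen (I \<union> linear_forms 2 a)"
proof -
  have "\<not> never_artinian 2 I"
  proof
    assume "never_artinian 2 I"
    from never_artinian_chain[OF assms(1) this]
    obtain P where "\<forall>i\<le>2. P i \<in> proj_points I" "\<forall>i<2. P i \<subset> P (Suc i)"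
      by (elim exE conjE)
    then have "ereal (real 2) \<le> scheme_dim I" by (rule scheme_dim_geI)
    also have "\<dots> \<le> ereal 1" using assms(2) by (simp add: one_ereal_def)
    finally show False by simp
  qed
  with that show ?thesis unfolding never_artinian_def by blast
qed

section \<open>The reduction number\<close>

text \<open>Let \<open>t\<close> be least such that R_t lies in (I, L) for some pair L. Openness
  extends this to general L, and minimality makes degree t - 1 nonzero for every L. So the reduction
  number is t - 1, and the hypothesis on \<open>d\<close> says t <= d.\<close>

lemma reduction_number_open:
  fixes I :: "('k::field_char_0, 'n::finite) mpol set"
  assumes I: "homogeneous_ideal I" and dim: "scheme_dim I \<le> 1" and one: "1 \<notin> I"
    and d: "reduction_number 2 I < d"
  obtains g a0 where "eval_mpol a0 g \<noteq> 0"
    "\<And>a. eval_mpol a g \<noteq> 0 \<Longrightarrow> forms d \<subseteq> ideal_gen (I \<union> linear_forms 2 a)"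
proof -
  note iI = homogeneous_idealD(1)[OF I]
  define Q where "Q t \<longleftrightarrow> (\<exists>a. forms t \<subseteq> ideal_gen (I \<union> linear_forms 2 a))" for t
  obtain a1 t1 where "forms t1 \<subseteq> ideal_gen (I \<union> linear_forms 2 a1)"
    using artinian_reduction_exists[OF I dim] .
  then have "\<exists>t. Q t" unfolding Q_def by blast
  then obtain t where t: "Q t" "\<And>s. s < t \<Longrightarrow> \<not> Q s" using exists_least_iff[of Q] by blast
  then obtain a0 where a0: "forms t \<subseteq> ideal_gen (I \<union> linear_forms 2 a0)" unfolding Q_def by blast
  obtain g where g: "vars_in ({..<2} \<times> UNIV) g" "eval_mpol a0 g \<noteq> 0"
    "\<And>a. eval_mpol a g \<noteq> 0 \<Longrightarrow> forms t \<subseteq> ideal_gen (I \<union> linear_forms 2 a)"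
    using forms_in_ideal_open[OF I a0] by blast
  \<comment> \<open>Needed for t - 1 to be a genuine predecessor. Linear forms contribute nothing in
    degree 0, so 1 in (I, L) would force 1 in I.\<close>
  have t0: "t \<noteq> 0"
  proof
    assume "t = 0"
    then have "1 \<in> ideal_gen (I \<union> linear_forms 2 a0)" using a0 by auto
    then obtain p u where pu: "p \<in> I" "1 = p + (\<Sum>i<2. lform a0 i * u i)"
      unfolding mem_ideal_linear_forms_iff[OF iI] by blast
    have "hc 0 1 = (1 :: ('k, 'n) mpol)" by (simp add: hc_forms[OF forms_1])
    moreover have "hc 0 (p + (\<Sum>i<2. lform a0 i * u i)) = hc 0 p"
      by (simp add: hc_add hc_sum hc_mult[OF lform_in_forms(2)])
    ultimately have "1 = hc 0 p" using pu(2) by metis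
    then show False using one homogeneous_idealD(2)[OF I pu(1), of 0] by simp
  qed
  have hf0: "hilbert_function (ideal_gen (I \<union> linear_forms 2 a)) k = 0 \<longleftrightarrow>
      forms k \<subseteq> ideal_gen (I \<union> linear_forms 2 a)" for a k
    by (rule hilbert_function_eq_0_iff) simp
  let ?Q = "\<lambda>r L. hilbert_function (ideal_gen (I \<union> L)) r \<noteq> 0 \<and>
     (\<forall>k. hilbert_function (ideal_gen (I \<union> L)) k \<noteq> 0 \<longrightarrow> k \<le> r)"
  have good: "?Q (t - 1) (linear_forms 2 a)" if "eval_mpol a g \<noteq> 0" for a
  proof (intro conjI allI impI)
    have "\<not> Q (t - 1)" using t(2) t0 by simp
    then show "hilbert_function (ideal_gen (I \<union> linear_forms 2 a)) (t - 1) \<noteq> 0"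
      unfolding hf0 Q_def by blast
    fix k assume k: "hilbert_function (ideal_gen (I \<union> linear_forms 2 a)) k \<noteq> 0"
    show "k \<le> t - 1"
    proof (rule ccontr)
      assume "\<not> k \<le> t - 1"
      then have "forms k \<subseteq> ideal_gen (I \<union> linear_forms 2 a)"
        using forms_subset_mono[OF _ g(3)[OF that], of k] by simp
      with k show False unfolding hf0 by blast
    qed
  qed
  let ?A = "{..<2::nat} \<times> (UNIV :: 'n set)"
  \<comment> \<open>Points of a Zariski open set are extensional on \<open>?A\<close>; restriction
    changes neither the linear forms nor the values of polynomials supported on
    \<open>?A\<close>.\<close>
  have restr: "linear_forms 2 (restrict a ?A) = linear_forms 2 a" for a :: "nat \<times> 'n \<Rightarrow> 'k"
    by (rule linear_forms_cong) auto
  have evr: "eval_mpol (restrict a ?A) h = eval_mpol a h" if "vars_in ?A h"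
    for h and a :: "nat \<times> 'n \<Rightarrow> 'k" by (rule eval_mpol_cong[OF that]) auto
  have "reduction_number 2 I = t - 1" unfolding reduction_number_def
  proof (rule the_equality)
    show "for_general_linear_forms 2 (?Q (t - 1))" unfolding for_general_linear_forms_def
    proof (intro exI conjI ballI)
      let ?U = "{a \<in> ?A \<rightarrow>\<^sub>E UNIV. \<not> (\<forall>g\<in>{g}. eval_mpol a g = 0)}"
      show "zariski_open ?A ?U" unfolding zariski_open_def
        by (intro exI[of _ "{g}"]) (use g(1) in \<open>auto simp: vars_in_def\<close>)
      have "restrict a0 ?A \<in> ?U" using g(2) evr[OF g(1)] by auto
      then show "?U \<noteq> {}" by blast
    qed (use good in auto)
    \<comment> \<open>Uniqueness for the definite description: the open set belonging to
      \<open>r\<close> meets the set where \<open>g\<close> does not vanish.\<close>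
    fix r assume "for_general_linear_forms 2 (?Q r)"
    then obtain U where U: "zariski_open ?A U" "U \<noteq> {}" "\<forall>a\<in>U. ?Q r (linear_forms 2 a)"
      unfolding for_general_linear_forms_def by blast
    then obtain G where G: "\<forall>g\<in>G. vars_in ?A g" "U = {a \<in> ?A \<rightarrow>\<^sub>E UNIV. \<not> (\<forall>g\<in>G. eval_mpol a g = 0)}"
      unfolding zariski_open_def vars_in_def by blast
    then obtain a2 g2 where a2: "g2 \<in> G" "eval_mpol a2 g2 \<noteq> 0" using U(2) by blast
    obtain a where a: "eval_mpol a g \<noteq> 0" "eval_mpol a g2 \<noteq> 0"
      using eval_mpol_common_nonzero[OF g(2) a2(2)] .
    have "eval_mpol (restrict a ?A) g2 \<noteq> 0" using a(2) evr G(1) a2(1) by simp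
    then have "restrict a ?A \<in> U" unfolding G(2) using a2(1) by auto
    then have "?Q r (linear_forms 2 a)" using U(3) restr[of a] by metis
    with good[OF a(1)] show "r = t - 1" by (metis order_antisym)
  qed
  then have td: "t \<le> d" using d by simp
  show ?thesis
  proof (rule that[OF g(2)])
    show "forms d \<subseteq> ideal_gen (I \<union> linear_forms 2 a)" if "eval_mpol a g \<noteq> 0" for a
      using forms_subset_mono[OF _ g(3)[OF that] td] by simp
  qed
qed

section \<open>A general linear form is not a zero divisor\<close>

text \<open>Fraction-free Gaussian elimination over K[y]: either the columns are dependent over
  K[y], or the matrix stays injective at every value that is no root of the product \<open>g\<close>
  of the pivots.\<close>

lemma poly_matrix_generically_injective:
  fixes M :: "'i \<Rightarrow> 'j \<Rightarrow> 'k::field poly"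
  assumes "finite J"
  shows "(\<exists>F. (\<exists>j\<in>J. F j \<noteq> 0) \<and> (\<forall>i\<in>I. (\<Sum>j\<in>J. M i j * F j) = 0)) \<or>
    (\<exists>g. g \<noteq> 0 \<and> (\<forall>y. poly g y \<noteq> 0 \<longrightarrow>
      (\<forall>c. (\<forall>i\<in>I. (\<Sum>j\<in>J. poly (M i j) y * c j) = 0) \<longrightarrow> (\<forall>j\<in>J. c j = 0))))"
  (is "?ker J M \<or> ?inj J M")
  using assms
proof (induction J arbitrary: M)
  case empty
  show ?case by (rule disjI2, rule exI[of _ 1]) simp
next
  case (insert j0 J)
  show ?case
  proof (cases "\<forall>i\<in>I. M i j0 = 0")
    case True
    have "(\<Sum>j\<in>insert j0 J. M i j * (if j = j0 then 1 else 0)) = 0" if "i \<in> I" for i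
      by (rule sum.neutral) (use True that in auto)
    then have "?ker (insert j0 J) M"
      by (intro exI[of _ "\<lambda>j. if j = j0 then 1 else 0"]) auto
    then show ?thesis ..
  next
    case False
    then obtain i0 where i0: "i0 \<in> I" "M i0 j0 \<noteq> 0" by auto
    define a where "a = M i0 j0"
    \<comment> \<open>Row \<open>i0\<close> with pivot \<open>a\<close> clears column
      \<open>j0\<close> by cross-multiplication. Row \<open>i0\<close> itself becomes zero, so the
      row set stays the same.\<close>
    define M' where "M' i j = a * M i j - M i j0 * M i0 j" for i j
    from insert.IH[of M'] show ?thesis
    proof
      assume "?ker J M'"
      then obtain F j1 where F: "j1 \<in> J" "F j1 \<noteq> 0" "\<forall>i\<in>I. (\<Sum>j\<in>J. M' i j * F j) = 0"
        by (elim exE conjE bexE)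
      \<comment> \<open>Back substitution: \<open>F\<close> is scaled by the pivot, and the entry at
        \<open>j0\<close> solves row \<open>i0\<close>.\<close>
      define F' where "F' j = (if j = j0 then - (\<Sum>j\<in>J. M i0 j * F j) else a * F j)" for j
      have row: "(\<Sum>j\<in>insert j0 J. M i j * F' j) = 0" if i: "i \<in> I" for i
      proof -
        have "(\<Sum>j\<in>J. M i j * F' j) = (\<Sum>j\<in>J. a * M i j * F j)"
          by (rule sum.cong) (use insert.hyps in \<open>auto simp: F'_def\<close>)
        then have "(\<Sum>j\<in>insert j0 J. M i j * F' j) =
          (\<Sum>j\<in>J. a * M i j * F j) - M i j0 * (\<Sum>j\<in>J. M i0 j * F j)"
          using insert.hyps by (simp add: F'_def)
        also have "\<dots> = (\<Sum>j\<in>J. M' i j * F j)"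
          unfolding M'_def left_diff_distrib sum_subtractf sum_distrib_left by (simp only: mult.assoc)
        finally show ?thesis using F(3) i by simp
      qed
      have "F' j1 \<noteq> 0" using F(1,2) insert.hyps i0(2) by (auto simp: F'_def a_def)
      then have "\<exists>j\<in>insert j0 J. F' j \<noteq> 0" using F(1) by (intro bexI[of _ j1]) simp_all
      with row have "?ker (insert j0 J) M" by (intro exI[of _ F'] conjI ballI)
      then show ?thesis ..
    next
      assume "?inj J M'"
      then obtain g where g: "g \<noteq> 0" "\<forall>y. poly g y \<noteq> 0 \<longrightarrow>
        (\<forall>c. (\<forall>i\<in>I. (\<Sum>j\<in>J. poly (M' i j) y * c j) = 0) \<longrightarrow> (\<forall>j\<in>J. c j = 0))"
        by (elim exE conjE)
      have "?inj (insert j0 J) M"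
      proof (intro exI[of _ "a * g"] conjI allI impI)
        show "a * g \<noteq> 0" using g(1) i0(2) by (simp add: a_def)
        fix y c assume y: "poly (a * g) y \<noteq> 0"
          and c: "\<forall>i\<in>I. (\<Sum>j\<in>insert j0 J. poly (M i j) y * c j) = 0"
        have row: "(\<Sum>j\<in>J. poly (M i j) y * c j) = - (poly (M i j0) y * c j0)" if "i \<in> I" for i
          using c that insert.hyps by (simp add: eq_neg_iff_add_eq_0 add.commute)
        have "(\<Sum>j\<in>J. poly (M' i j) y * c j) = 0" if i: "i \<in> I" for i
        proof -
          have "(\<Sum>j\<in>J. poly (M' i j) y * c j) = poly a y * (\<Sum>j\<in>J. poly (M i j) y * c j)
            - poly (M i j0) y * (\<Sum>j\<in>J. poly (M i0 j) y * c j)"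
            unfolding M'_def sum_distrib_left
            by (simp only: poly_diff poly_mult left_diff_distrib sum_subtractf mult.assoc)
          also have "\<dots> = 0" unfolding row[OF i] row[OF i0(1)] a_def by simp
          finally show ?thesis .
        qed
        then have cJ: "\<forall>j\<in>J. c j = 0" using g(2)[rule_format, of y c] y by simp
        then have "poly a y * c j0 = 0" using row[OF i0(1)] by (simp add: a_def)
        then show "\<forall>j\<in>insert j0 J. c j = 0" using cJ y by simp
      qed
      then show ?thesis ..
    qed
  qed
qed

text \<open>
  McCoy's theorem for the ring \<open>(R/I)[Y]\<close>: if the polynomial \<open>\<Sum>\<^sub>k X\<^sub>k Y\<^sup>k\<close> annihilates
  \<open>\<Sum>\<^sub>m v\<^sub>m Y\<^sup>m\<close>, the leading terms show that some product \<open>X\<^sub>k v\<close> has smaller degree.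
\<close>

lemma mccoy:
  fixes X v :: "nat \<Rightarrow> 'a::comm_ring_1"
  assumes I: "is_ideal I" and sat: "\<And>f. (\<And>k. k \<le> n \<Longrightarrow> X k * f \<in> I) \<Longrightarrow> f \<in> I"
    and fin: "\<And>e. e \<ge> E \<Longrightarrow> v e \<in> I"
    and rel: "\<And>m. (\<Sum>k\<le>n. if k \<le> m then X k * v (m - k) else 0) \<in> I"
  shows "v m \<in> I"
  using fin rel
proof (induction E arbitrary: v m)
  case 0
  then show ?case by simp
next
  case (Suc E)
  \<comment> \<open>Descending induction on \<open>k\<close>. In the coefficient of degree E + k,
    terms with j < k contain some v of index above E, and terms with j > k are covered by the
    induction, so X_k v_E lies in I. Then X_k v has its coefficients from E on in I and inherits the
    relation, so the outer induction applies to it.\<close>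
  have "X k * v m \<in> I" if "k \<le> n" for k m
    using that
  proof (induction "n - k" arbitrary: k m rule: less_induct)
    case less
    have "(\<Sum>j\<in>{..n} - {k}. if j \<le> E + k then X j * v (E + k - j) else 0) \<in> I"
    proof (rule ring_ideal.subspace_sum[OF I])
      fix j assume j: "j \<in> {..n} - {k}"
      have "X j * v (E + k - j) \<in> I"
      proof (cases "j < k")
        case True
        then show ?thesis using Suc.prems(1)[of "E + k - j"] ideal_mult_right[OF I] by simp
      next
        case False
        then show ?thesis using less.hyps[of j] j by auto
      qed
      then show "(if j \<le> E + k then X j * v (E + k - j) else 0) \<in> I"
        using ring_ideal.subspace_0[OF I] by simp
    qed
    moreover have "(\<Sum>j\<le>n. if j \<le> E + k then X j * v (E + k - j) else 0) = X k * v E +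
      (\<Sum>j\<in>{..n} - {k}. if j \<le> E + k then X j * v (E + k - j) else 0)"
      using less.prems by (subst sum.remove[of _ k]) auto
    ultimately have XvE: "X k * v E \<in> I"
      using ring_ideal.subspace_diff[OF I Suc.prems(2)[of "E + k"]] by fastforce
    show ?case
    proof (rule Suc.IH)
      fix e assume "E \<le> e"
      then show "X k * v e \<in> I"
        using XvE Suc.prems(1)[of e] ideal_mult_right[OF I] by (cases "e = E") auto
    next
      fix m
      have "X k * (\<Sum>j\<le>n. if j \<le> m then X j * v (m - j) else 0) \<in> I"
        by (rule ideal_mult_right[OF I Suc.prems(2)])
      also have "X k * (\<Sum>j\<le>n. if j \<le> m then X j * v (m - j) else 0) =
        (\<Sum>j\<le>n. if j \<le> m then X j * (X k * v (m - j)) else 0)"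
        unfolding sum_distrib_left by (rule sum.cong) (auto simp: mult.left_commute)
      finally show "(\<Sum>j\<le>n. if j \<le> m then X j * (X k * v (m - j)) else 0) \<in> I" .
    qed
  qed
  then show ?case using sat by simp
qed

lemma coeff_monom_mult_if: "coeff (Polynomial.monom a k * p) m = (if k \<le> m then a * coeff p (m - k) else 0)"
  by (auto simp: coeff_monom_mult)

lemma Const_sum: "Const (sum f S) = (\<Sum>s\<in>S. Const (f s))"
  by (induction S rule: infinite_finite_induct) (auto simp: Const_add)

lemma indep_mod_formsD:
  assumes "kvs.indep_mod (I \<inter> forms t) B" "B \<subseteq> forms t" "(\<Sum>b\<in>B. Const (c b) * b) \<in> I" "b \<in> B"
  shows "c b = 0"
proof -
  have "(\<Sum>b\<in>B. Const (c b) * b) \<in> forms t"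
    by (intro forms_sum forms_Const_mult) (use assms(2) in auto)
  then have "(\<Sum>b\<in>B. Const (c b) * b) \<in> I \<inter> forms t" using assms(3) by (rule IntI[rotated])
  then have "\<forall>b\<in>B. c b = 0" using assms(1) unfolding kvs.indep_mod_def by (elim allE[of _ c] mp)
  then show ?thesis using assms(4) by (rule bspec)
qed

text \<open>Multiplication by the family is a matrix over K[y] from (R/I)_d to (R/I)_(d+1). A kernel
  vector over K[y] would be a polynomial over R/I annihilated by the polynomial with coefficients
  X_k, which McCoy's theorem and \<open>sat\<close> exclude; hence the matrix is injective for all
  but finitely many parameters.\<close>

lemma generic_form_nonzerodivisor:
  fixes I :: "('k::field, 'n::finite) mpol set"
  assumes I: "is_ideal I" and sat: "\<And>f. (\<And>k. k \<le> n \<Longrightarrow> X k * f \<in> I) \<Longrightarrow> f \<in> I"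
    and X: "\<And>k. X k \<in> forms 1"
  shows "\<exists>g. g \<noteq> 0 \<and> (\<forall>y. poly g y \<noteq> 0 \<longrightarrow>
    (\<forall>f\<in>forms d. (\<Sum>k\<le>n. Const (y ^ k) * X k) * f \<in> I \<longrightarrow> f \<in> I))"
proof -
  obtain B where "residue_basis I d B" using residue_basis_exists[OF I] .
  then have B: "finite B" "B \<subseteq> forms d" "kvs.indep_mod (I \<inter> forms d) B"
    "kvs.span_mod (I \<inter> forms d) B (forms d)" unfolding residue_basis_iff[OF I] by auto
  obtain B' where "residue_basis I (Suc d) B'" using residue_basis_exists[OF I] .
  then have B': "finite B'" "B' \<subseteq> forms (Suc d)" "kvs.indep_mod (I \<inter> forms (Suc d)) B'"
    "kvs.span_mod (I \<inter> forms (Suc d)) B' (forms (Suc d))" unfolding residue_basis_iff[OF I] by auto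
  have "\<forall>w. \<exists>c. w \<in> forms (Suc d) \<longrightarrow> w - (\<Sum>b\<in>B'. Const (c b) * b) \<in> I"
    using B'(4) unfolding kvs.span_mod_def by blast
  then have "\<exists>co. \<forall>w. w \<in> forms (Suc d) \<longrightarrow> w - (\<Sum>b\<in>B'. Const (co w b) * b) \<in> I" by (rule choice)
  then obtain co where co': "\<forall>w. w \<in> forms (Suc d) \<longrightarrow> w - (\<Sum>b\<in>B'. Const (co w b) * b) \<in> I"
    by (rule exE)
  have co: "w - (\<Sum>b\<in>B'. Const (co w b) * b) \<in> I" if "w \<in> forms (Suc d)" for w
    by (rule mp[OF spec[OF co'] that])
  have XB: "X k * b \<in> forms (Suc d)" if "b \<in> B" for k b
    using forms_mult[OF X, of b d k] B(2) that by auto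
  \<comment> \<open>Coordinates with respect to \<open>B'\<close> turn membership in I into linear
    equations, one for each element of \<open>B'\<close>.\<close>
  have coords: "(\<Sum>b\<in>B. \<Sum>k\<le>n. Const (\<alpha> b k) * (X k * b)) \<in> I \<longleftrightarrow>
    (\<forall>b'\<in>B'. (\<Sum>b\<in>B. \<Sum>k\<le>n. \<alpha> b k * co (X k * b) b') = 0)" for \<alpha>
  proof -
    define \<beta> where "\<beta> b' = (\<Sum>b\<in>B. \<Sum>k\<le>n. \<alpha> b k * co (X k * b) b')" for b'
    have "(\<Sum>b'\<in>B'. Const (\<beta> b') * b') =
      (\<Sum>b'\<in>B'. \<Sum>b\<in>B. \<Sum>k\<le>n. Const (\<alpha> b k) * (Const (co (X k * b) b') * b'))"
      unfolding \<beta>_def Const_sum Const_mult sum_distrib_right by (simp only: mult.assoc)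
    also have "\<dots> = (\<Sum>b\<in>B. \<Sum>b'\<in>B'. \<Sum>k\<le>n. Const (\<alpha> b k) * (Const (co (X k * b) b') * b'))"
      by (rule sum.swap)
    also have "\<dots> = (\<Sum>b\<in>B. \<Sum>k\<le>n. \<Sum>b'\<in>B'. Const (\<alpha> b k) * (Const (co (X k * b) b') * b'))"
      by (rule sum.cong[OF refl]) (rule sum.swap)
    finally have eq: "(\<Sum>b\<in>B. \<Sum>k\<le>n. Const (\<alpha> b k) * (X k * b)) - (\<Sum>b'\<in>B'. Const (\<beta> b') * b') =
      (\<Sum>b\<in>B. \<Sum>k\<le>n. Const (\<alpha> b k) * (X k * b - (\<Sum>b'\<in>B'. Const (co (X k * b) b') * b')))"
      unfolding right_diff_distrib sum_subtractf sum_distrib_left by simp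
    have "\<dots> \<in> I"
      by (intro ring_ideal.subspace_sum[OF I] ideal_mult_right[OF I] co XB)
    then have diff: "(\<Sum>b\<in>B. \<Sum>k\<le>n. Const (\<alpha> b k) * (X k * b)) - (\<Sum>b'\<in>B'. Const (\<beta> b') * b') \<in> I"
      using eq by simp
    have "(\<Sum>b\<in>B. \<Sum>k\<le>n. Const (\<alpha> b k) * (X k * b)) \<in> I \<longleftrightarrow> (\<Sum>b'\<in>B'. Const (\<beta> b') * b') \<in> I"
      using ring_ideal.subspace_add[OF I diff, of "\<Sum>b'\<in>B'. Const (\<beta> b') * b'"]
        ring_ideal.subspace_diff[OF I _ diff, of "\<Sum>b\<in>B. \<Sum>k\<le>n. Const (\<alpha> b k) * (X k * b)"] by auto
    also have "\<dots> \<longleftrightarrow> (\<forall>b'\<in>B'. \<beta> b' = 0)"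
    proof
      assume "(\<Sum>b'\<in>B'. Const (\<beta> b') * b') \<in> I"
      then show "\<forall>b'\<in>B'. \<beta> b' = 0" using indep_mod_formsD[OF B'(3,2)] by (intro ballI)
    next
      assume "\<forall>b'\<in>B'. \<beta> b' = 0"
      then have "(\<Sum>b'\<in>B'. Const (\<beta> b') * b') = 0" by (intro sum.neutral) simp
      then show "(\<Sum>b'\<in>B'. Const (\<beta> b') * b') \<in> I" using ring_ideal.subspace_0[OF I] by simp
    qed
    finally show ?thesis unfolding \<beta>_def .
  qed
  note B0 = indep_mod_formsD[OF B(3,2)]
  \<comment> \<open>The entry at b' and b is the b'-coordinate of the moving linear form times b, as
    a polynomial in the parameter.\<close>
  define M where "M b' b = (\<Sum>k\<le>n. Polynomial.monom (co (X k * b) b') k)" for b' b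
  from poly_matrix_generically_injective[OF B(1), of B' M] show ?thesis
  proof
    assume "\<exists>F. (\<exists>j\<in>B. F j \<noteq> 0) \<and> (\<forall>i\<in>B'. (\<Sum>j\<in>B. M i j * F j) = 0)"
    then obtain F b0 where F: "b0 \<in> B" "F b0 \<noteq> 0" "\<forall>b'\<in>B'. (\<Sum>b\<in>B. M b' b * F b) = 0"
      by (elim exE conjE bexE)
    \<comment> \<open>The kernel vector read as a polynomial in the parameter: \<open>v m\<close> is
      the coefficient of the m-th power. Once all \<open>v m\<close> lie in I, independence of
      \<open>B\<close> modulo I contradicts \<open>F b0 \<noteq> 0\<close>.\<close>
    define v where "v m = (\<Sum>b\<in>B. Const (coeff (F b) m) * b)" for m
    have "v m \<in> I" for m
    proof (rule mccoy[OF I, where X=X and n=n])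
      show "f \<in> I" if "\<And>k. k \<le> n \<Longrightarrow> X k * f \<in> I" for f using sat that by blast
      show "v e \<in> I" if e: "Suc (\<Sum>b\<in>B. degree (F b)) \<le> e" for e
      proof -
        have "coeff (F b) e = 0" if "b \<in> B" for b
          by (rule coeff_eq_0) (use member_le_sum[OF that, of "\<lambda>b. degree (F b)"] B(1) e in simp)
        then have "v e = 0" unfolding v_def by (intro sum.neutral) simp
        then show ?thesis using ring_ideal.subspace_0[OF I] by simp
      qed
      fix m
      have "(\<Sum>b\<in>B. \<Sum>k\<le>n. (if k \<le> m then coeff (F b) (m - k) else 0) * co (X k * b) b') = 0"
        if "b' \<in> B'" for b'
      proof -
        have "(\<Sum>b\<in>B. \<Sum>k\<le>n. (if k \<le> m then coeff (F b) (m - k) else 0) * co (X k * b) b') =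
          coeff (\<Sum>b\<in>B. M b' b * F b) m"
          unfolding M_def sum_distrib_right coeff_sum coeff_monom_mult_if
          by (intro sum.cong refl) (simp add: mult.commute)
        then show ?thesis using F(3) that by simp
      qed
      then have "(\<Sum>b\<in>B. \<Sum>k\<le>n. Const (if k \<le> m then coeff (F b) (m - k) else 0) * (X k * b)) \<in> I"
        unfolding coords by blast
      also have "(\<Sum>b\<in>B. \<Sum>k\<le>n. Const (if k \<le> m then coeff (F b) (m - k) else 0) * (X k * b)) =
        (\<Sum>k\<le>n. if k \<le> m then X k * v (m - k) else 0)"
      proof -
        have "(\<Sum>b\<in>B. \<Sum>k\<le>n. Const (if k \<le> m then coeff (F b) (m - k) else 0) * (X k * b)) =
          (\<Sum>k\<le>n. \<Sum>b\<in>B. Const (if k \<le> m then coeff (F b) (m - k) else 0) * (X k * b))"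
          by (rule sum.swap)
        also have "\<dots> = (\<Sum>k\<le>n. if k \<le> m then X k * v (m - k) else 0)"
        proof (rule sum.cong[OF refl])
          fix k
          show "(\<Sum>b\<in>B. Const (if k \<le> m then coeff (F b) (m - k) else 0) * (X k * b)) =
            (if k \<le> m then X k * v (m - k) else 0)"
            unfolding v_def sum_distrib_left by (auto intro!: sum.cong simp: mult.left_commute)
        qed
        finally show ?thesis .
      qed
      finally show "(\<Sum>k\<le>n. if k \<le> m then X k * v (m - k) else 0) \<in> I" .
    qed
    then have "coeff (F b0) m = 0" for m 
      using B0[of "\<lambda>b. coeff (F b) m", OF _ F(1)] unfolding v_def by simp
    then have "F b0 = 0" by (simp add: poly_eq_iff)
    with F(2) show ?thesis by simp
  next
    assume "\<exists>g. g \<noteq> 0 \<and> (\<forall>y. poly g y \<noteq> 0 \<longrightarrow>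
      (\<forall>c. (\<forall>i\<in>B'. (\<Sum>j\<in>B. poly (M i j) y * c j) = 0) \<longrightarrow> (\<forall>j\<in>B. c j = 0)))"
    then obtain g where g: "g \<noteq> 0" "\<forall>y. poly g y \<noteq> 0 \<longrightarrow>
      (\<forall>c. (\<forall>b'\<in>B'. (\<Sum>b\<in>B. poly (M b' b) y * c b) = 0) \<longrightarrow> (\<forall>b\<in>B. c b = 0))"
      by (elim exE conjE)
    show ?thesis
    proof (intro exI conjI allI impI ballI)
      show "g \<noteq> 0" by (rule g(1))
      fix y f assume y: "poly g y \<noteq> 0" and f: "f \<in> forms d"
        and Lf: "(\<Sum>k\<le>n. Const (y ^ k) * X k) * f \<in> I"
      let ?L = "\<Sum>k\<le>n. Const (y ^ k) * X k"
      obtain c where c: "f - (\<Sum>b\<in>B. Const (c b) * b) \<in> I"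
        using B(4) f unfolding kvs.span_mod_def by blast
      have "?L * f - ?L * (f - (\<Sum>b\<in>B. Const (c b) * b)) \<in> I"
        by (rule ring_ideal.subspace_diff[OF I Lf ideal_mult_right[OF I c]])
      also have "?L * f - ?L * (f - (\<Sum>b\<in>B. Const (c b) * b)) = ?L * (\<Sum>b\<in>B. Const (c b) * b)"
        by (simp add: right_diff_distrib)
      also have "\<dots> = (\<Sum>b\<in>B. \<Sum>k\<le>n. Const (c b * y ^ k) * (X k * b))"
        unfolding sum_distrib_left sum_distrib_right Const_mult
        by (intro sum.cong refl) (simp only: mult_ac)
      finally have "\<forall>b'\<in>B'. (\<Sum>b\<in>B. \<Sum>k\<le>n. c b * y ^ k * co (X k * b) b') = 0"
        unfolding coords .
      moreover have "(\<Sum>b\<in>B. poly (M b' b) y * c b) = (\<Sum>b\<in>B. \<Sum>k\<le>n. c b * y ^ k * co (X k * b) b')" for b'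
        unfolding M_def poly_sum poly_monom sum_distrib_right
        by (intro sum.cong refl) (simp only: mult_ac)
      ultimately have "\<forall>b'\<in>B'. (\<Sum>b\<in>B. poly (M b' b) y * c b) = 0" by (simp only:)
      then have "\<forall>b\<in>B. c b = 0"
        by (rule mp[OF spec[OF mp[OF spec[where x = y, OF g(2)] y], where x = c]])
      then have "(\<Sum>b\<in>B. Const (c b) * b) = 0" by (intro sum.neutral) simp
      with c show "f \<in> I" by simp
    qed
  qed
qed

text \<open>The exponent k = 1 in the definition of \<open>saturation\<close>, since the variables
  span R_1.\<close>

lemma saturated_idealD:
  fixes I :: "('k::field, 'n::finite) mpol set"
  assumes "saturated_ideal I" "\<And>v. Var v * f \<in> I"
  shows "f \<in> I"
proof -
  have I: "is_ideal I" "saturation I = I"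
    using assms(1) homogeneous_idealD(1) unfolding saturated_ideal_def by auto
  have "g * f \<in> I" if g: "g \<in> forms 1" for g
  proof -
    have "g * f = (\<Sum>v\<in>UNIV. Const (lk g (Poly_Mapping.single v 1)) * (Var v * f))"
      by (subst linear_form_expansion[OF g]) (simp only: sum_distrib_right mult.assoc)
    also have "\<dots> \<in> I" by (intro ring_ideal.subspace_sum[OF I(1)] ideal_mult_right[OF I(1)] assms(2))
    finally show ?thesis .
  qed
  then have "f \<in> saturation I" unfolding saturation_def by blast
  then show ?thesis using I(2) by simp
qed

text \<open>Both conditions are imposed along one curve of pairs: the second form stays fixed, and
  the first is l + y x_1 + y^2 x_2 + ..., where l and the second form are a pair given by the
  reduction number. The open condition holds at y = 0, so it fails for finitely many y only.\<close>

lemma general_linear_forms_exist: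
  fixes I :: "('k::field_char_0, 'n::finite) mpol set"
  assumes I: "saturated_ideal I" and dim: "scheme_dim I \<le> 1" and one: "1 \<notin> I"
    and d: "reduction_number 2 I < d"
  obtains l1 l2 where "l1 \<in> forms 1" "l2 \<in> forms 1" "forms d \<subseteq> ideal_gen (I \<union> {l1, l2})"
    "\<And>f. f \<in> forms d \<Longrightarrow> l1 * f \<in> I \<Longrightarrow> f \<in> I"
proof -
  have hI: "homogeneous_ideal I" using I by (simp add: saturated_ideal_def)
  note iI = homogeneous_idealD(1)[OF hI]
  obtain g0 a0 where g0: "eval_mpol a0 g0 \<noteq> 0"
    "\<And>a. eval_mpol a g0 \<noteq> 0 \<Longrightarrow> forms d \<subseteq> ideal_gen (I \<union> linear_forms 2 a)"
    using reduction_number_open[OF hI dim one d] by metis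
  let ?n = "CARD('n)"
  obtain e :: "nat \<Rightarrow> 'n" where "bij_betw e {0..<card (UNIV :: 'n set)} UNIV"
    using ex_bij_betw_nat_finite[of "UNIV :: 'n set"] by auto
  then have e: "bij_betw e {..<?n} UNIV" by (simp add: atLeast0LessThan)
  define e' where "e' = inv_into {..<?n} e"
  have e': "e' (e i) = i" if "i < ?n" for i
    unfolding e'_def using e that by (simp add: bij_betw_def inv_into_f_f)
  have ee': "e (e' v) = v" "e' v < ?n" for v
    using bij_betw_inv_into_right[OF e, of v] bij_betw_apply[OF bij_betw_inv_into[OF e], of v]
    by (simp_all add: e'_def)
  \<comment> \<open>\<open>X 0\<close> makes the curve start at the good pair. The variables are
    included so that saturation applies: an f with all \<open>X k * f\<close> in I lies in
    I.\<close>
  define X where "X k = (case k of 0 \<Rightarrow> lform a0 0 | Suc k \<Rightarrow> Var (e k))" for k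
  have X: "X k \<in> forms 1" for k by (simp add: X_def split: nat.split)
  have sat: "f \<in> I" if "\<And>k. k \<le> ?n \<Longrightarrow> X k * f \<in> I" for f
  proof (rule saturated_idealD[OF I])
    fix v
    have "X (Suc (e' v)) = Var v" by (simp add: X_def ee'(1))
    then show "Var v * f \<in> I" using that[of "Suc (e' v)"] ee'(2)[of v] by simp
  qed
  have "\<exists>g. g \<noteq> 0 \<and> (\<forall>y. poly g y \<noteq> 0 \<longrightarrow>
    (\<forall>f\<in>forms d. (\<Sum>k\<le>?n. Const (y ^ k) * X k) * f \<in> I \<longrightarrow> f \<in> I))"
    by (rule generic_form_nonzerodivisor[OF iI sat X])
  then obtain g where g: "g \<noteq> 0" "\<forall>y. poly g y \<noteq> 0 \<longrightarrow>
    (\<forall>f\<in>forms d. (\<Sum>k\<le>?n. Const (y ^ k) * X k) * f \<in> I \<longrightarrow> f \<in> I)" by (elim exE conjE)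
  \<comment> \<open>Coefficients of the moving pair; only the form with index 0 depends on the
    parameter.\<close>
  define c where "c iv = [:a0 iv:] + (if fst iv = 0 then Polynomial.monom 1 (Suc (e' (snd iv))) else 0)" for iv
  obtain q where q: "\<And>y. poly q y = eval_mpol (\<lambda>v. poly (c v) y) g0"
    using eval_mpol_along_curve[of c g0] by blast
  have "poly q 0 = eval_mpol a0 g0" unfolding q
    by (rule arg_cong[of _ _ "\<lambda>a. eval_mpol a g0"]) (auto simp: c_def poly_monom)
  then have "q \<noteq> 0" using g0(1) by auto
  then have "q * g \<noteq> 0" using g(1) by simp
  then obtain y where "poly (q * g) y \<noteq> 0" by (rule nonzero_poly_nonroot)
  then have y: "poly q y \<noteq> 0" "poly g y \<noteq> 0" by auto
  define a where "a iv = poly (c iv) y" for iv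
  have "eval_mpol a g0 \<noteq> 0" using y(1) unfolding q a_def .
  then have fd: "forms d \<subseteq> ideal_gen (I \<union> linear_forms 2 a)" by (rule g0(2))
  have l0: "lform a 0 = (\<Sum>k\<le>?n. Const (y ^ k) * X k)"
  proof -
    have "lform a 0 = (\<Sum>v\<in>UNIV. Const (a0 (0, v)) * Var v + Const (y ^ Suc (e' v)) * Var v)"
      unfolding lform_def by (rule sum.cong) (simp_all add: a_def c_def poly_monom Const_add distrib_right)
    also have "\<dots> = lform a0 0 + (\<Sum>v\<in>UNIV. Const (y ^ Suc (e' v)) * Var v)"
      unfolding lform_def by (rule sum.distrib)
    also have "(\<Sum>v\<in>UNIV. Const (y ^ Suc (e' v)) * Var v) = (\<Sum>k<?n. Const (y ^ Suc k) * Var (e k))"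
      by (rule sum.reindex_bij_betw[OF e, symmetric, THEN trans]) (rule sum.cong, simp_all add: e')
    also have "lform a0 0 + \<dots> = (\<Sum>k\<le>?n. Const (y ^ k) * X k)"
      unfolding sum.atMost_shift by (simp add: X_def)
    finally show ?thesis .
  qed
  have "linear_forms 2 a = {lform a 0, lform a 1}"
    unfolding linear_forms_eq by (auto simp: numeral_2_eq_2 lessThan_Suc)
  with fd have "forms d \<subseteq> ideal_gen (I \<union> {lform a 0, lform a 1})" by simp
  moreover have "f \<in> I" if "f \<in> forms d" "lform a 0 * f \<in> I" for f
    using g(2)[rule_format, OF y(2)] that unfolding l0 by auto
  ultimately show ?thesis by (rule that[OF lform_in_forms(1) lform_in_forms(1)])
qed

section \<open>A regularity criterion\<close>

text \<open>Linear coordinates, which begin with l1, l2 in the application. They take the place of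
  the variables, so that no ideal has to be transported by a change of coordinates.\<close>

locale regular_system =
  fixes y :: "nat \<Rightarrow> ('k::field, 'n::finite) mpol" and n :: nat
  assumes y_forms: "i < n \<Longrightarrow> y i \<in> forms 1"
    and y_gen: "Var v \<in> ideal_gen (y ` {..<n})"
    and y_regular: "i < n \<Longrightarrow> y i * f \<in> ideal_gen (y ` {..<i}) \<Longrightarrow> f \<in> ideal_gen (y ` {..<i})"
begin

definition Y :: "nat \<Rightarrow> ('k, 'n) mpol set" where
  "Y i = ideal_gen (y ` {..<i})"

lemma Y_ideal [simp]: "is_ideal (Y i)"
  by (simp add: Y_def)

lemma Y_homogeneous: "i \<le> n \<Longrightarrow> homogeneous_ideal (Y i)"
  unfolding Y_def by (rule homogeneous_ideal_gen) (auto intro!: exI[of _ 1] y_forms)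

lemma Y_0: "f \<in> Y 0 \<longleftrightarrow> f = 0"
  by (simp add: Y_def ring_ideal.span_empty)

lemma Y_iff: "f \<in> Y i \<longleftrightarrow> (\<exists>u. f = (\<Sum>j<i. y j * u j))"
  unfolding Y_def by (rule ideal_gen_image_iff) simp

lemma Y_sum: "(\<Sum>j<i. y j * u j) \<in> Y i"
  unfolding Y_iff by blast

lemma Y_mono: "i \<le> j \<Longrightarrow> Y i \<subseteq> Y j"
  unfolding Y_def by (rule ring_ideal.span_mono) auto

lemma Y_regular: "i < n \<Longrightarrow> y i * f \<in> Y i \<Longrightarrow> f \<in> Y i"
  unfolding Y_def by (rule y_regular)

lemma y_forms_Suc: "i < n \<Longrightarrow> y i \<in> forms (Suc 0)"
  using y_forms by simp

lemma Y_n: "Y n = ideal_gen (range Var)"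
proof
  show "ideal_gen (range Var) \<subseteq> Y n"
    by (rule ring_ideal.span_minimal) (use y_gen in \<open>auto simp: Y_def\<close>)
  show "Y n \<subseteq> ideal_gen (range Var)" unfolding Y_def
  proof (rule ring_ideal.span_minimal)
    show "y ` {..<n} \<subseteq> ideal_gen (range Var)"
    proof
      fix f assume "f \<in> y ` {..<n}"
      then have "f \<in> forms 1" using y_forms by blast
      then have "f = (\<Sum>v\<in>UNIV. Const (lk f (Poly_Mapping.single v 1)) * Var v)"
        by (rule linear_form_expansion)
      also have "\<dots> \<in> ideal_gen (range Var)"
        by (intro ring_ideal.span_sum ring_ideal.span_scale ring_ideal.span_base rangeI)
      finally show "f \<in> ideal_gen (range Var)" .
    qed
  qed simp
qed

lemma mem_Y_n_iff: "f \<in> Y n \<longleftrightarrow> lk f 0 = 0"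
proof -
  have "f \<in> Y n \<longleftrightarrow> (\<forall>m\<in>ks f. mdeg m \<noteq> 0)"
    unfolding Y_n Var_ideal_iff mdeg_def by simp
  then show ?thesis by (auto simp: in_keys_iff)
qed

lemma Y_components:
  assumes "i \<le> n" "f \<in> Y i" "f \<in> forms (Suc t)"
  obtains u where "\<And>j. u j \<in> forms t" "f = (\<Sum>j<i. y j * u j)"
proof -
  obtain u where u: "f = (\<Sum>j<i. y j * u j)" using assms(2) unfolding Y_iff by blast
  have "f = hc (Suc t) f" using hc_forms[OF assms(3), of "Suc t"] by simp
  also have "\<dots> = (\<Sum>j<i. y j * hc t (u j))"
    unfolding u hc_sum
  proof (rule sum.cong[OF refl])
    fix j assume "j \<in> {..<i}"
    then have "y j \<in> forms (Suc 0)" using y_forms_Suc assms(1) by simp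
    then show "hc (Suc t) (y j * u j) = y j * hc t (u j)" by (simp add: hc_mult)
  qed
  finally show ?thesis using that[of "\<lambda>j. hc t (u j)"] by simp
qed

text \<open>
  \<open>colon_cond J i t\<close> says \<open>((J, y\<^sub>0, \<dots>, y\<^sub>i\<^sub>-\<^sub>1) : y\<^sub>i)\<^sub>t = (J, y\<^sub>0, \<dots>, y\<^sub>i\<^sub>-\<^sub>1)\<^sub>t\<close>, and \<open>cut_cond J i t\<close> says
  \<open>(J \<inter> (y\<^sub>0, \<dots>, y\<^sub>i\<^sub>-\<^sub>1))\<^sub>t = ((y\<^sub>0, \<dots>, y\<^sub>i\<^sub>-\<^sub>1) J)\<^sub>t\<close>. The second condition propagates to all higher degrees
  by descending induction on \<open>i\<close> and is inherited by syzygy modules.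
\<close>

definition colon_cond :: "('k, 'n) mpol set \<Rightarrow> nat \<Rightarrow> nat \<Rightarrow> bool" where
  "colon_cond J i t \<longleftrightarrow> (\<forall>f\<in>forms t. (\<exists>p\<in>J. y i * f - p \<in> Y i) \<longrightarrow> (\<exists>p\<in>J. f - p \<in> Y i))"

definition cut_cond :: "('k, 'n) mpol set \<Rightarrow> nat \<Rightarrow> nat \<Rightarrow> bool" where
  "cut_cond J i t \<longleftrightarrow> (\<forall>u\<in>J \<inter> forms t \<inter> Y i. \<exists>g. (\<forall>j<i. g j \<in> J) \<and> u = (\<Sum>j<i. y j * g j))"

lemma cut_condD:
  assumes J: "homogeneous_ideal J" and c: "cut_cond J i (Suc t)" and i: "i \<le> n"
    and u: "u \<in> J" "u \<in> forms (Suc t)" "u \<in> Y i"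
  obtains g where "\<And>j. j < i \<Longrightarrow> g j \<in> J" "\<And>j. g j \<in> forms t" "u = (\<Sum>j<i. y j * g j)"
proof -
  obtain g where g: "\<forall>j<i. g j \<in> J" "u = (\<Sum>j<i. y j * g j)"
    using bspec[OF c[unfolded cut_cond_def], of u] u by auto
  have "u = hc (Suc t) u" using hc_forms[OF u(2), of "Suc t"] by simp
  also have "\<dots> = (\<Sum>j<i. y j * hc t (g j))"
    unfolding g(2) hc_sum
  proof (rule sum.cong[OF refl])
    fix j assume "j \<in> {..<i}"
    then have "y j \<in> forms (Suc 0)" using y_forms_Suc i by simp
    then show "hc (Suc t) (y j * g j) = y j * hc t (g j)" by (simp add: hc_mult)
  qed
  finally have "u = (\<Sum>j<i. y j * hc t (g j))" .
  then show ?thesis using that[of "\<lambda>j. hc t (g j)"] g(1) homogeneous_idealD(2)[OF J] by simp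
qed

text \<open>Ascending induction on \<open>i\<close>. If u = y_0 f_0 + ... + y_i f_i lies in J, then
  y_i f_i lies in J + Y_i, the colon condition replaces f_i by some p in J modulo Y_i, and u - y_i p
  lies in both J and Y_i. The factor y_i accounts for the passage from \<open>t\<close> to
  \<open>Suc t\<close>.\<close>

lemma cut_cond_if_colon_cond:
  assumes J: "homogeneous_ideal J" and C: "\<And>i. i < n \<Longrightarrow> colon_cond J i t" and "i \<le> n"
  shows "cut_cond J i (Suc t)"
  using assms(3)
proof (induction i)
  case 0
  show ?case unfolding cut_cond_def by (auto simp: Y_0)
next
  case (Suc i)
  note iJ = homogeneous_idealD(1)[OF J]
  have i: "i < n" "i \<le> n" using Suc.prems by auto
  show ?case unfolding cut_cond_def
  proof
    fix u assume "u \<in> J \<inter> forms (Suc t) \<inter> Y (Suc i)"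
    then have u: "u \<in> J" "u \<in> forms (Suc t)" "u \<in> Y (Suc i)" by auto
    obtain f where f: "\<And>j. f j \<in> forms t" "u = (\<Sum>j<Suc i. y j * f j)"
      using Y_components[OF Suc.prems u(3,2)] by metis
    have "y i * f i - u = - (\<Sum>j<i. y j * f j)" using f(2) by simp
    also have "\<dots> \<in> Y i" by (rule ring_ideal.subspace_neg[OF Y_ideal Y_sum])
    finally have yf: "y i * f i - u \<in> Y i" .
    then obtain p0 where p0: "p0 \<in> J" "f i - p0 \<in> Y i"
      using bspec[OF C[OF i(1), unfolded colon_cond_def] f(1)[of i]] u(1) by auto
    define p where "p = hc t p0"
    have p: "p \<in> J" "p \<in> forms t" using p0(1) homogeneous_idealD(2)[OF J] by (auto simp: p_def)
    have "hc t (f i - p0) \<in> Y i" using homogeneous_idealD(2)[OF Y_homogeneous[OF i(2)] p0(2)] .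
    then have fp: "f i - p \<in> Y i" using hc_forms[OF f(1)[of i], of t] by (simp add: hc_diff p_def)
    have "u - y i * p = y i * (f i - p) - (y i * f i - u)" by (simp add: right_diff_distrib)
    also have "\<dots> \<in> Y i"
      by (intro ring_ideal.subspace_diff[OF Y_ideal] ideal_mult_right[OF Y_ideal] fp yf)
    finally have 1: "u - y i * p \<in> Y i" .
    have "y i * p \<in> forms (Suc t)" using forms_mult[OF y_forms[OF i(1)] p(2)] by simp
    then have 2: "u - y i * p \<in> J \<inter> forms (Suc t)"
      using u p(1) ring_ideal.subspace_diff[OF iJ] ideal_mult_right[OF iJ] forms_diff by blast
    obtain g where g: "\<forall>j<i. g j \<in> J" "u - y i * p = (\<Sum>j<i. y j * g j)"
      using bspec[OF Suc.IH[OF i(2), unfolded cut_cond_def], of "u - y i * p"] 1 2 by auto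
    show "\<exists>g. (\<forall>j<Suc i. g j \<in> J) \<and> u = (\<Sum>j<Suc i. y j * g j)"
    proof (intro exI[of _ "g(i := p)"] conjI allI impI)
      show "(g(i := p)) j \<in> J" if "j < Suc i" for j using that g(1) p(1) by auto
      have "(\<Sum>j<Suc i. y j * (g(i := p)) j) = (\<Sum>j<i. y j * g j) + y i * p" by simp
      then show "u = (\<Sum>j<Suc i. y j * (g(i := p)) j)" using g(2) by (simp add: diff_eq_eq)
    qed
  qed
qed

text \<open>Descending induction on \<open>i\<close>, started by \<open>top\<close>. An element of J
  and Y_i is cut with respect to Y_(i+1); regularity of y_i puts the last cofactor g_i into Y_i, the
  condition one degree lower cuts g_i in turn, and y_i g_i is absorbed by the other
  cofactors.\<close>

lemma cut_cond_Suc: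
  assumes J: "homogeneous_ideal J" and top: "cut_cond J n (Suc (Suc t))"
    and E: "\<And>i. i \<le> n \<Longrightarrow> cut_cond J i (Suc t)" and "i \<le> n"
  shows "cut_cond J i (Suc (Suc t))"
  using assms(4)
proof (induction i rule: inc_induct)
  case base
  show ?case by (rule top)
next
  case (step i)
  note iJ = homogeneous_idealD(1)[OF J]
  have i: "i < n" "i \<le> n" "Suc i \<le> n" using step.hyps by auto
  show ?case unfolding cut_cond_def
  proof
    fix u assume "u \<in> J \<inter> forms (Suc (Suc t)) \<inter> Y i"
    then have u: "u \<in> J" "u \<in> forms (Suc (Suc t))" "u \<in> Y i" by auto
    then have "u \<in> Y (Suc i)" using Y_mono[of i "Suc i"] by auto
    then obtain g where g: "\<And>j. j < Suc i \<Longrightarrow> g j \<in> J" "\<And>j. g j \<in> forms (Suc t)" "u = (\<Sum>j<Suc i. y j * g j)"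
      using cut_condD[OF J step.IH i(3) u(1,2)] by metis
    have "y i * g i = u - (\<Sum>j<i. y j * g j)" using g(3) by simp
    also have "\<dots> \<in> Y i" by (rule ring_ideal.subspace_diff[OF Y_ideal u(3) Y_sum])
    finally have gi: "g i \<in> Y i" by (rule Y_regular[OF i(1)])
    have "g i \<in> J" by (rule g(1)) simp
    then obtain h where h: "\<And>j. j < i \<Longrightarrow> h j \<in> J" "g i = (\<Sum>j<i. y j * h j)"
      using cut_condD[OF J E[OF i(2)] i(2) _ g(2) gi] by metis
    show "\<exists>g. (\<forall>j<i. g j \<in> J) \<and> u = (\<Sum>j<i. y j * g j)"
    proof (intro exI[of _ "\<lambda>j. g j + y i * h j"] conjI allI impI)
      show "g j + y i * h j \<in> J" if "j < i" for j
        using ring_ideal.subspace_add[OF iJ g(1) ideal_mult_right[OF iJ h(1)[OF that]], of j "y i"] that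
        by simp
      have "(\<Sum>j<i. y j * (g j + y i * h j)) = (\<Sum>j<i. y j * g j) + y i * g i"
        unfolding h(2) distrib_left sum.distrib sum_distrib_left by (simp only: mult.left_commute)
      then show "u = (\<Sum>j<i. y j * (g j + y i * h j))" using g(3) by simp
    qed
  qed
qed

text \<open>Modulo Y_i, y_i f is an element p of J that lies in Y_(i+1). Cutting p gives a last
  cofactor g_i in J, and cancelling the regular y_i makes f congruent to g_i.\<close>

lemma colon_cond_if_cut_cond:
  assumes J: "homogeneous_ideal J" and E: "cut_cond J (Suc i) (Suc t)" and i: "i < n"
  shows "colon_cond J i t"
  unfolding colon_cond_def
proof (intro ballI impI)
  fix f assume f: "f \<in> forms t" and "\<exists>p\<in>J. y i * f - p \<in> Y i"
  then obtain p0 where p0: "p0 \<in> J" "y i * f - p0 \<in> Y i" by auto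
  define p where "p = hc (Suc t) p0"
  have p: "p \<in> J" "p \<in> forms (Suc t)" using p0(1) homogeneous_idealD(2)[OF J] by (auto simp: p_def)
  have yf: "y i * f \<in> forms (Suc t)" using forms_mult[OF y_forms[OF i] f] by simp
  have "hc (Suc t) (y i * f - p0) \<in> Y i"
    by (rule homogeneous_idealD(2)[OF Y_homogeneous[OF less_imp_le[OF i]] p0(2)])
  then have yfp: "y i * f - p \<in> Y i" using hc_forms[OF yf, of "Suc t"] by (simp add: hc_diff p_def)
  have "y i * f \<in> Y (Suc i)" unfolding Y_def
    by (rule ideal_mult_left[OF _ ring_ideal.span_base]) auto
  moreover have "y i * f - p \<in> Y (Suc i)" using yfp Y_mono[of i "Suc i"] by auto
  ultimately have "y i * f - (y i * f - p) \<in> Y (Suc i)"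
    by (rule ring_ideal.subspace_diff[OF Y_ideal])
  then have "p \<in> Y (Suc i)" by simp
  then obtain g where g: "\<And>j. j < Suc i \<Longrightarrow> g j \<in> J" "p = (\<Sum>j<Suc i. y j * g j)"
    using cut_condD[OF J E Suc_leI[OF i] p] by metis
  have "y i * (f - g i) = (y i * f - p) + (\<Sum>j<i. y j * g j)" using g(2) by (simp add: right_diff_distrib)
  also have "\<dots> \<in> Y i" by (rule ring_ideal.subspace_add[OF Y_ideal yfp Y_sum])
  finally have "f - g i \<in> Y i" by (rule Y_regular[OF i])
  then show "\<exists>p\<in>J. f - p \<in> Y i" using g(1)[of i] by blast
qed

text \<open>For i = n the condition says that no new generators are needed in degree
  \<open>t\<close>. In a product c x with x of degree at most d < t, the constant term of c meets
  the component of x in degree \<open>t\<close>, which is 0; the other components of c lie in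
  Y_n.\<close>

lemma cut_cond_top_truncated:
  assumes I: "homogeneous_ideal I" and t: "d < t"
  shows "cut_cond (truncated_ideal d I) n t"
proof -
  let ?J = "truncated_ideal d I"
  let ?G = "I \<inter> polys_le d"
  have iJ: "is_ideal ?J" by (simp add: truncated_ideal_def)
  have key: "\<exists>g. (\<forall>j<n. g j \<in> ?J) \<and> hc t f = (\<Sum>j<n. y j * g j)" if "f \<in> ?J" for f
    using that unfolding truncated_ideal_def
  proof (induction f rule: ring_ideal.span_induct_alt)
    case base
    show ?case by (intro exI[of _ "\<lambda>_. 0"]) (simp add: ring_ideal.span_zero)
  next
    case (step c x z)
    then obtain g where g: "\<forall>j<n. g j \<in> ideal_gen ?G" "hc t z = (\<Sum>j<n. y j * g j)" by auto
    have xs: "hc s x \<in> ideal_gen ?G" for s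
    proof (rule ring_ideal.span_base)
      have "hc s x \<in> I" using step(1) homogeneous_idealD(2)[OF I] by auto
      moreover have "hc s x \<in> polys_le d"
        using step(1) by (auto simp: polys_le_def in_keys_iff split: if_splits)
      ultimately show "hc s x \<in> ?G" by simp
    qed
    have x0: "hc s x = 0" if "d < s" for s
    proof (rule poly_mapping_eqI)
      fix m
      have "lk x m \<noteq> 0 \<longrightarrow> mdeg m \<le> d" using step(1) by (simp add: polys_le_def in_keys_iff)
      then have "lk x m = 0" if "mdeg m = s" using \<open>d < s\<close> that by auto
      then show "lk (hc s x) m = lk 0 m" by simp
    qed
    have cu: "\<exists>u. hc s c = (\<Sum>j<n. y j * u j)" if "s \<noteq> 0" for s
    proof -
      have "lk (hc s c) 0 = 0" using that by simp
      then show ?thesis using mem_Y_n_iff Y_iff by blast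
    qed
    have "\<forall>s. \<exists>u. s \<noteq> 0 \<longrightarrow> hc s c = (\<Sum>j<n. y j * u j)" using cu by blast
    then have "\<exists>u. \<forall>s. s \<noteq> 0 \<longrightarrow> hc s c = (\<Sum>j<n. y j * u s j)" by (rule choice)
    then obtain u where u: "\<forall>s. s \<noteq> 0 \<longrightarrow> hc s c = (\<Sum>j<n. y j * u s j)" by (rule exE)
    have "hc t (c * x) = (\<Sum>i\<le>t. hc i c * hc (t - i) x)" by (rule hc_product)
    also have "\<dots> = (\<Sum>i\<in>{1..t}. hc i c * hc (t - i) x)"
    proof (rule sum.mono_neutral_right)
      show "\<forall>i\<in>{..t} - {1..t}. hc i c * hc (t - i) x = 0"
      proof
        fix i assume "i \<in> {..t} - {1..t}"
        then have "i = 0" by auto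
        then show "hc i c * hc (t - i) x = 0" using x0[OF t] by simp
      qed
    qed auto
    also have "\<dots> = (\<Sum>i\<in>{1..t}. \<Sum>j<n. y j * (u i j * hc (t - i) x))"
    proof (rule sum.cong[OF refl])
      fix i assume "i \<in> {1..t}"
      then have "hc i c = (\<Sum>j<n. y j * u i j)" using u by auto
      then show "hc i c * hc (t - i) x = (\<Sum>j<n. y j * (u i j * hc (t - i) x))"
        by (simp only: sum_distrib_right mult.assoc)
    qed
    also have "\<dots> = (\<Sum>j<n. y j * (\<Sum>i\<in>{1..t}. u i j * hc (t - i) x))"
      by (subst sum.swap) (simp only: sum_distrib_left)
    finally have cx: "hc t (c * x) = (\<Sum>j<n. y j * (\<Sum>i\<in>{1..t}. u i j * hc (t - i) x))" .
    show ?case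
    proof (intro exI[of _ "\<lambda>j. (\<Sum>i\<in>{1..t}. u i j * hc (t - i) x) + g j"] conjI allI impI)
      show "(\<Sum>i\<in>{1..t}. u i j * hc (t - i) x) + g j \<in> ideal_gen ?G" if "j < n" for j
        by (intro ring_ideal.span_add ring_ideal.span_sum ring_ideal.span_scale xs) (use g(1) that in auto)
      show "hc t (c * x + z) = (\<Sum>j<n. y j * ((\<Sum>i\<in>{1..t}. u i j * hc (t - i) x) + g j))"
        unfolding hc_add cx g(2) by (simp only: distrib_left sum.distrib)
    qed
  qed
  show ?thesis unfolding cut_cond_def
  proof
    fix u assume "u \<in> ?J \<inter> forms t \<inter> Y n"
    then have "u \<in> ?J" "hc t u = u" using hc_forms[of u t t] by auto
    then show "\<exists>g. (\<forall>j<n. g j \<in> ?J) \<and> u = (\<Sum>j<n. y j * g j)" using key[of u] by simp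
  qed
qed

lemma truncated_ideal_homogeneous:
  assumes I: "homogeneous_ideal I"
  shows "homogeneous_ideal (truncated_ideal d I)"
proof -
  let ?G = "I \<inter> polys_le d" and ?H = "I \<inter> polys_le d \<inter> (\<Union>t. forms t)"
  have "ideal_gen ?G = ideal_gen ?H"
  proof
    show "ideal_gen ?H \<subseteq> ideal_gen ?G" by (rule ring_ideal.span_mono) auto
    show "ideal_gen ?G \<subseteq> ideal_gen ?H"
    proof (rule ring_ideal.span_minimal)
      show "?G \<subseteq> ideal_gen ?H"
      proof
        fix f assume f: "f \<in> ?G"
        have "hc s f \<in> ?H" for s
        proof -
          have "hc s f \<in> I" using f homogeneous_idealD(2)[OF I] by auto
          moreover have "hc s f \<in> polys_le d"
            using f by (auto simp: polys_le_def in_keys_iff split: if_splits)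
          ultimately show ?thesis by (auto intro: exI[of _ s])
        qed
        then have "(\<Sum>t\<in>mdeg ` ks f. hc t f) \<in> ideal_gen ?H"
          by (intro ring_ideal.span_sum ring_ideal.span_base)
        then show "f \<in> ideal_gen ?H" using sum_hc[of f] by simp
      qed
    qed simp
  qed
  moreover have "homogeneous_ideal (ideal_gen ?H)" by (rule homogeneous_ideal_gen) auto
  ultimately show ?thesis by (simp add: truncated_ideal_def)
qed

lemma cut_cond_truncated:
  assumes I: "homogeneous_ideal I" and C: "\<And>i. i < n \<Longrightarrow> colon_cond (truncated_ideal d I) i d"
    and t: "d < t" and i: "i \<le> n"
  shows "cut_cond (truncated_ideal d I) i t"
proof -
  note J = truncated_ideal_homogeneous[OF I, of d]
  have "Suc d \<le> t" using t by simp
  then show ?thesis using i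
  proof (induction t arbitrary: i rule: dec_induct)
    case base
    then show ?case using cut_cond_if_colon_cond[OF J C] by simp
  next
    case (step t)
    then obtain s where s: "t = Suc s" by (cases t) auto
    have top: "cut_cond (truncated_ideal d I) n (Suc (Suc s))"
      using cut_cond_top_truncated[OF I, of d "Suc (Suc s)"] step.hyps(1) s by simp
    have "cut_cond (truncated_ideal d I) j (Suc s)" if "j \<le> n" for j
      using step.IH[OF that] s by simp
    from cut_cond_Suc[OF J top this step.prems] show ?case using s by simp
  qed
qed

end

section \<open>Graded submodules of free modules\<close>

text \<open>
  An element of \<open>\<Oplus>\<^sub>k R(-a\<^sub>k)\<close>, \<open>k < r\<close>, is a function on \<open>nat\<close> that vanishes from \<open>r\<close> on.
\<close>

definition hvec :: "(nat \<Rightarrow> nat) \<Rightarrow> nat \<Rightarrow> (nat \<Rightarrow> ('k::field, 'n::finite) mpol) \<Rightarrow> bool" where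
  "hvec a t v \<longleftrightarrow> (\<forall>k. \<forall>m\<in>ks (v k). mdeg m + a k = t)"

text \<open>The component of degree \<open>t\<close> in the shifted grading. The test
  \<open>a k \<le> t\<close> matters, since truncated subtraction would otherwise return the
  constant component.\<close>

definition vcomp :: "(nat \<Rightarrow> nat) \<Rightarrow> nat \<Rightarrow> (nat \<Rightarrow> ('k::field, 'n::finite) mpol) \<Rightarrow> nat \<Rightarrow> ('k, 'n) mpol" where
  "vcomp a t v k = (if a k \<le> t then hc (t - a k) (v k) else 0)"

definition graded_module :: "nat \<Rightarrow> (nat \<Rightarrow> nat) \<Rightarrow> (nat \<Rightarrow> ('k::field, 'n::finite) mpol) set \<Rightarrow> bool" where
  "graded_module r a N \<longleftrightarrow> (\<forall>v\<in>N. \<forall>k\<ge>r. v k = 0) \<and> (\<lambda>_. 0) \<in> N \<and>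
    (\<forall>u\<in>N. \<forall>v\<in>N. (\<lambda>k. u k + v k) \<in> N) \<and> (\<forall>c. \<forall>v\<in>N. (\<lambda>k. c * v k) \<in> N) \<and>
    (\<forall>t. \<forall>v\<in>N. vcomp a t v \<in> N)"

text \<open>\<open>D j\<close> is the j-th of \<open>q\<close> generators and \<open>D j k\<close>
  its k-th coordinate; the relations themselves are extended by zero beyond
  \<open>q\<close>.\<close>

definition syz :: "nat \<Rightarrow> (nat \<Rightarrow> nat \<Rightarrow> ('k::field, 'n::finite) mpol) \<Rightarrow> (nat \<Rightarrow> ('k, 'n) mpol) set" where
  "syz q D = {c. (\<forall>j\<ge>q. c j = 0) \<and> (\<forall>k. (\<Sum>j<q. c j * D j k) = 0)}"

lemma graded_moduleD:
  assumes "graded_module r a N"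
  shows "v \<in> N \<Longrightarrow> r \<le> k \<Longrightarrow> v k = 0" "(\<lambda>_. 0) \<in> N" "u \<in> N \<Longrightarrow> v \<in> N \<Longrightarrow> (\<lambda>k. u k + v k) \<in> N"
    "v \<in> N \<Longrightarrow> (\<lambda>k. c * v k) \<in> N" "v \<in> N \<Longrightarrow> vcomp a t v \<in> N"
  using assms unfolding graded_module_def by auto

lemma graded_module_sum:
  assumes "graded_module r a N" "\<And>j. j \<in> A \<Longrightarrow> g j \<in> N"
  shows "(\<lambda>k. \<Sum>j\<in>A. c j * g j k) \<in> N"
  using assms(2)
proof (induction A rule: infinite_finite_induct)
  case (insert x A)
  have "(\<lambda>k. c x * g x k + (\<Sum>j\<in>A. c j * g j k)) \<in> N"
    using insert by (intro graded_moduleD(3,4)[OF assms(1)]) auto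
  then show ?case using insert.hyps by simp
qed (simp_all add: graded_moduleD(2)[OF assms(1)])

lemma graded_module_diff:
  assumes "graded_module r a N" "u \<in> N" "v \<in> N"
  shows "(\<lambda>k. u k - c * v k) \<in> N"
  using graded_moduleD(3)[OF assms(1,2) graded_moduleD(4)[OF assms(1,3), of "- c"]] by simp

lemma hvec_iff: "hvec a t v \<longleftrightarrow> (\<forall>k m. lk (v k) m \<noteq> 0 \<longrightarrow> mdeg m + a k = t)"
  by (auto simp: hvec_def in_keys_iff)

lemma hvec_forms: "hvec a t v \<Longrightarrow> a k \<le> t \<Longrightarrow> v k \<in> forms (t - a k)"
  unfolding hvec_def forms_def by fastforce

lemma hvec_zero: "hvec a t v \<Longrightarrow> t < a k \<Longrightarrow> v k = 0"
  by (rule poly_mapping_eqI) (auto simp: hvec_iff)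

lemma hvec_vcomp: "hvec a t (vcomp a t v)"
  by (auto simp: hvec_iff vcomp_def)

lemma vcomp_hvec: "hvec a t v \<Longrightarrow> vcomp a t v = v"
  by (rule ext) (auto simp: vcomp_def hc_forms[OF hvec_forms] hvec_zero)

lemma vcomp_diff: "vcomp a t (\<lambda>k. u k - v k) = (\<lambda>k. vcomp a t u k - vcomp a t v k)"
  by (rule ext) (simp add: vcomp_def hc_diff)

lemma hvec_mult:
  assumes "hvec a t v" "f \<in> forms s"
  shows "hvec a (s + t) (\<lambda>k. f * v k)"
  unfolding hvec_def
proof (intro allI ballI)
  fix k m assume "m \<in> ks (f * v k)"
  then obtain p q where "m = p + q" "p \<in> ks f" "q \<in> ks (v k)" using keys_mult[of f "v k"] by blast
  then show "mdeg m + a k = s + t" using assms by (auto simp: hvec_def forms_def)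
qed

lemma hvec_diff: "hvec a t u \<Longrightarrow> hvec a t v \<Longrightarrow> hvec a t (\<lambda>k. u k - v k)"
  unfolding hvec_iff lookup_minus by (metis diff_0_right)

lemma vcomp_mem_ideal:
  assumes "homogeneous_ideal I" "v k \<in> I" shows "vcomp a t v k \<in> I"
  unfolding vcomp_def using homogeneous_idealD(2)[OF assms]
    ring_ideal.subspace_0[OF homogeneous_idealD(1)[OF assms(1)]] by simp

lemma vcomp_linear_comb:
  assumes "\<And>j. j < q \<Longrightarrow> hvec a (b j) (D j)"
  shows "vcomp a t (\<lambda>k. \<Sum>j<q. c j * D j k) = (\<lambda>k. \<Sum>j<q. vcomp b t c j * D j k)"
proof
  fix k
  have "(if a k \<le> t then hc (t - a k) (c j * D j k) else 0) = vcomp b t c j * D j k" if j: "j < q" for j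
  proof (cases "a k \<le> b j")
    case False
    then have "D j k = 0" using hvec_zero[OF assms[OF j]] by simp
    then show ?thesis by simp
  next
    case True
    have D: "D j k \<in> forms (b j - a k)" by (rule hvec_forms[OF assms[OF j] True])
    have "hc (t - a k) (c j * D j k) = (if b j - a k \<le> t - a k then D j k * hc (t - a k - (b j - a k)) (c j) else 0)"
      using hc_mult[OF D, of "t - a k" "c j"] by (simp add: mult.commute)
    moreover have "D j k = 0" if "a k \<le> t" "\<not> b j \<le> t" "b j - a k \<le> t - a k" using that by linarith
    ultimately show ?thesis using True by (auto simp: vcomp_def mult.commute)
  qed
  then show "vcomp a t (\<lambda>k. \<Sum>j<q. c j * D j k) k = (\<Sum>j<q. vcomp b t c j * D j k)"
    unfolding vcomp_def[of a] hc_sum by (auto intro!: sum.cong split: if_splits)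
qed

lemma sum_vcomp:
  assumes "\<And>k. r \<le> k \<Longrightarrow> v k = 0"
  shows "v k = (\<Sum>t\<in>(\<Union>k<r. (\<lambda>m. a k + mdeg m) ` ks (v k)). vcomp a t v k)"
    (is "_ = (\<Sum>t\<in>?T. _)")
proof (rule poly_mapping_eqI)
  fix m
  have fin: "finite ?T" by auto
  have "lk (\<Sum>t\<in>?T. vcomp a t v k) m = (\<Sum>t\<in>?T. if t = a k + mdeg m then lk (v k) m else 0)"
    unfolding lookup_sum by (rule sum.cong) (auto simp: vcomp_def)
  also have "\<dots> = (if a k + mdeg m \<in> ?T then lk (v k) m else 0)" using fin by simp
  also have "\<dots> = lk (v k) m"
  proof (cases "lk (v k) m = 0")
    case False
    then have "k < r" using assms[of k] by (metis leI lookup_zero)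
    moreover have "m \<in> ks (v k)" using False by (simp add: in_keys_iff)
    ultimately have "a k + mdeg m \<in> ?T" by blast
    then show ?thesis by simp
  qed simp
  finally show "lk (v k) m = lk (\<Sum>t\<in>?T. vcomp a t v k) m" by simp
qed

global_interpretation fvs: linear_space "\<lambda>c (v :: nat \<Rightarrow> ('k::field, 'n::finite) mpol). (\<lambda>k. Const c * v k)"
  by unfold_locales
    (simp_all only: plus_fun_def distrib_left distrib_right Const_add Const_mult mult.assoc Const_1 mult_1_left)

lemma sum_fun_apply: "(\<Sum>x\<in>A. F x) i = (\<Sum>x\<in>A. F x i)" for F :: "'x \<Rightarrow> 'i \<Rightarrow> 'b::comm_monoid_add"
  by (induction A rule: infinite_finite_induct) (simp_all add: zero_fun_def plus_fun_def)

lemma finite_span_hvec: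
  "fvs.finite_span {v :: nat \<Rightarrow> ('k::field, 'n::finite) mpol. hvec a t v \<and> (\<forall>k\<ge>r. v k = 0)}"
proof -
  define e :: "nat \<Rightarrow> ('n \<Rightarrow>\<^sub>0 nat) \<Rightarrow> nat \<Rightarrow> ('k, 'n) mpol" where "e k m i = (if i = k then mon m else 0)" for k m i
  let ?E = "(\<lambda>(k, m). e k m) ` ({..<r} \<times> (\<Union>s\<le>t. {m. mdeg m = s}))"
  show ?thesis unfolding fvs.finite_span_def
  proof (intro exI conjI subsetI)
    show "finite ?E" by (intro finite_imageI finite_SigmaI finite_UN_I finite_mdeg_eq) auto
    fix v :: "nat \<Rightarrow> ('k, 'n) mpol" assume "v \<in> {v. hvec a t v \<and> (\<forall>k\<ge>r. v k = 0)}"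
    then have v: "hvec a t v" "\<And>k. r \<le> k \<Longrightarrow> v k = 0" by auto
    have "v = (\<Sum>k<r. \<Sum>m\<in>ks (v k). (\<lambda>i. Const (lk (v k) m) * e k m i))"
    proof
      fix i
      have "(\<Sum>k<r. \<Sum>m\<in>ks (v k). (\<lambda>i. Const (lk (v k) m) * e k m i)) i =
        (\<Sum>k<r. \<Sum>m\<in>ks (v k). Const (lk (v k) m) * e k m i)" by (simp only: sum_fun_apply)
      also have "\<dots> = (\<Sum>k<r. if k = i then \<Sum>m\<in>ks (v i). Const (lk (v i) m) * mon m else 0)"
        by (rule sum.cong) (auto simp: e_def)
      also have "\<dots> = (\<Sum>k<r. if k = i then v i else 0)" using mon_expansion[of "v i"] by simp
      also have "\<dots> = v i" using v(2)[of i] by simp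
      finally show "v i = (\<Sum>k<r. \<Sum>m\<in>ks (v k). (\<lambda>i. Const (lk (v k) m) * e k m i)) i" by simp
    qed
    also have "\<dots> \<in> fvs.span ?E"
    proof (intro fvs.span_sum fvs.span_scale fvs.span_base)
      fix k m assume "k \<in> {..<r}" "m \<in> ks (v k)"
      moreover have "mdeg m \<le> t" using v(1) \<open>m \<in> ks (v k)\<close> unfolding hvec_def by force
      ultimately show "e k m \<in> ?E" by (intro image_eqI[of _ _ "(k, m)"]) auto
    qed
    finally show "v \<in> fvs.span ?E" .
  qed
qed

context regular_system
begin

text \<open>\<open>cut_cond\<close> for a submodule N of a free module F in all degrees above
  \<open>m\<close>: there N \<inter> Y_i F equals Y_i N. The bound on the shifts ensures that in
  vectors of degree above \<open>m\<close> no coordinate has a constant term.\<close>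

definition cut_module :: "nat \<Rightarrow> (nat \<Rightarrow> nat) \<Rightarrow> nat \<Rightarrow> (nat \<Rightarrow> ('k, 'n) mpol) set \<Rightarrow> bool" where
  "cut_module r a m N \<longleftrightarrow> (\<forall>k<r. a k \<le> m) \<and>
    (\<forall>i\<le>n. \<forall>t>m. \<forall>u\<in>N. hvec a t u \<longrightarrow> (\<forall>k. u k \<in> Y i) \<longrightarrow>
      (\<exists>g. (\<forall>j<i. g j \<in> N) \<and> (\<forall>k. u k = (\<Sum>j<i. y j * g j k))))"

lemma cut_moduleD:
  assumes "cut_module r a m N" "i \<le> n" "m < t" "u \<in> N" "hvec a t u" "\<And>k. u k \<in> Y i"
  shows "\<exists>g. (\<forall>j<i. g j \<in> N) \<and> (\<forall>k. u k = (\<Sum>j<i. y j * g j k))"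
  using assms unfolding cut_module_def by simp

lemma vcomp_y_sum:
  assumes i: "i \<le> n" and u: "hvec a (Suc t) u" "\<And>k. u k = (\<Sum>j<i. y j * g j k)"
  shows "u k = (\<Sum>j<i. y j * vcomp a t (g j) k)"
proof -
  have "u k = vcomp a (Suc t) u k" using vcomp_hvec[OF u(1)] by simp
  also have "\<dots> = (\<Sum>j<i. if a k \<le> Suc t then hc (Suc t - a k) (y j * g j k) else 0)"
    unfolding vcomp_def u(2)[of k] hc_sum by simp
  also have "\<dots> = (\<Sum>j<i. y j * vcomp a t (g j) k)"
  proof (rule sum.cong[OF refl])
    fix j assume "j \<in> {..<i}"
    then have yj: "y j \<in> forms (Suc 0)" using y_forms_Suc i by simp
    show "(if a k \<le> Suc t then hc (Suc t - a k) (y j * g j k) else 0) = y j * vcomp a t (g j) k"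
      unfolding hc_mult[OF yj] vcomp_def by (auto simp: Suc_diff_le)
  qed
  finally show ?thesis .
qed

definition generates :: "(nat \<Rightarrow> ('k, 'n) mpol) set \<Rightarrow> (nat \<Rightarrow> ('k, 'n) mpol) \<Rightarrow> bool" where
  "generates S v \<longleftrightarrow> (\<exists>c. \<forall>k. v k = (\<Sum>s\<in>S. c s * s k))"

lemma generates_add:
  assumes "generates S u" "generates S v" shows "generates S (\<lambda>k. u k + v k)"
proof -
  obtain c d where c: "\<forall>k. u k = (\<Sum>s\<in>S. c s * s k)" "\<forall>k. v k = (\<Sum>s\<in>S. d s * s k)"
    using assms unfolding generates_def by auto
  have "u k + v k = (\<Sum>s\<in>S. (c s + d s) * s k)" for k
    unfolding c(1)[rule_format, of k] c(2)[rule_format, of k] by (simp only: distrib_right sum.distrib)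
  then show ?thesis unfolding generates_def by (intro exI[of _ "\<lambda>s. c s + d s"]) simp
qed

lemma generates_mult:
  assumes "generates S u" shows "generates S (\<lambda>k. f * u k)"
proof -
  obtain c where c: "\<forall>k. u k = (\<Sum>s\<in>S. c s * s k)" using assms unfolding generates_def by auto
  have "f * u k = (\<Sum>s\<in>S. (f * c s) * s k)" for k
    unfolding c[rule_format, of k] by (simp only: sum_distrib_left mult.assoc)
  then show ?thesis unfolding generates_def by (intro exI[of _ "\<lambda>s. f * c s"]) simp
qed

lemma generates_0: "generates S (\<lambda>_. 0)"
  unfolding generates_def by (intro exI[of _ "\<lambda>_. 0"]) simp

lemma generates_sum:
  "(\<And>j. j \<in> A \<Longrightarrow> generates S (F j)) \<Longrightarrow> generates S (\<lambda>k. \<Sum>j\<in>A. F j k)"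
  by (induction A rule: infinite_finite_induct) (simp_all add: generates_0 generates_add)

lemma generates_base:
  assumes "finite S" "s \<in> S" shows "generates S s"
proof -
  have "s k = (\<Sum>x\<in>S. (if x = s then 1 else 0) * x k)" for k
  proof -
    have "(\<Sum>x\<in>S. (if x = s then 1 else 0) * x k) = (\<Sum>x\<in>S. if x = s then s k else 0)"
      by (rule sum.cong) auto
    then show ?thesis using assms by simp
  qed
  then show ?thesis unfolding generates_def by (intro exI[of _ "\<lambda>x. if x = s then 1 else 0"]) simp
qed

text \<open>Degrees up to \<open>m\<close> contribute finitely many generators, because each graded
  piece is finite-dimensional. A vector of degree above \<open>m\<close> has coordinates without
  constant term, so the cut condition with i = n writes it through elements of N of lower
  degree.\<close>

lemma finite_generators:
  assumes N: "graded_module r a N" and c: "cut_module r a m N"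
  shows "\<exists>S. finite S \<and> S \<subseteq> N \<and> (\<forall>s\<in>S. \<exists>t\<le>m. hvec a t s) \<and> (\<forall>v\<in>N. generates S v)"
proof -
  have "\<exists>B. finite B \<and> B \<subseteq> {v\<in>N. hvec a t v} \<and> {v\<in>N. hvec a t v} \<subseteq> fvs.span B" for t
  proof -
    have "fvs.finite_span {v\<in>N. hvec a t v}"
      by (rule fvs.finite_span_mono[OF finite_span_hvec[of a t r]]) (use graded_moduleD(1)[OF N] in auto)
    then obtain B where "finite B" "B \<subseteq> {v\<in>N. hvec a t v}" "{v\<in>N. hvec a t v} \<subseteq> fvs.span B"
      by (rule fvs.finite_span_basis)
    then show ?thesis by (intro exI[of _ B] conjI)
  qed
  then have "\<exists>B. \<forall>t. finite (B t) \<and> B t \<subseteq> {v\<in>N. hvec a t v} \<and> {v\<in>N. hvec a t v} \<subseteq> fvs.span (B t)"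
    by (intro choice allI)
  then obtain B where B': "\<forall>t. finite (B t) \<and> B t \<subseteq> {v\<in>N. hvec a t v} \<and> {v\<in>N. hvec a t v} \<subseteq> fvs.span (B t)"
    by (rule exE)
  have B: "finite (B t)" "B t \<subseteq> {v\<in>N. hvec a t v}" "{v\<in>N. hvec a t v} \<subseteq> fvs.span (B t)" for t
    by (rule B'[THEN spec, THEN conjunct1], rule B'[THEN spec, THEN conjunct2, THEN conjunct1],
      rule B'[THEN spec, THEN conjunct2, THEN conjunct2])
  define S where "S = (\<Union>t\<le>m. B t)"
  have finS: "finite S" unfolding S_def using B(1) by auto
  have SN: "S \<subseteq> N" "\<forall>s\<in>S. \<exists>t\<le>m. hvec a t s" unfolding S_def using B(2) by auto
  have hom: "generates S v" if "v \<in> N" "hvec a t v" for t v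
    using that
  proof (induction t arbitrary: v rule: less_induct)
    case (less t)
    show ?case
    proof (cases "t \<le> m")
      case True
      have "fvs.subspace {v. generates S v}" unfolding fvs.subspace_def
        using generates_0 generates_add generates_mult by (auto simp: zero_fun_def plus_fun_def)
      moreover have "B t \<subseteq> {v. generates S v}" using True generates_base[OF finS] by (auto simp: S_def)
      ultimately have "fvs.span (B t) \<subseteq> {v. generates S v}" by (rule fvs.span_minimal[rotated])
      then show ?thesis using B(3)[of t] less.prems by auto
    next
      case False
      then obtain t' where t': "t = Suc t'" by (cases t) auto
      have "v k \<in> Y n" for k
      proof -
        have "lk (v k) 0 = 0"
        proof (rule ccontr)
          assume nz: "lk (v k) 0 \<noteq> 0"
          then have "k < r" using graded_moduleD(1)[OF N less.prems(1), of k] by (metis leI lookup_zero)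
          then have "a k \<le> m" using c unfolding cut_module_def by simp
          moreover have "a k = t" using less.prems(2) nz unfolding hvec_iff by force
          ultimately show False using False by simp
        qed
        then show ?thesis by (simp add: mem_Y_n_iff)
      qed
      then obtain g where g: "\<forall>j<n. g j \<in> N" "\<forall>k. v k = (\<Sum>j<n. y j * g j k)"
        using cut_moduleD[OF c order_refl _ less.prems] False by auto
      have "hvec a (Suc t') v" using less.prems(2) t' by simp
      from vcomp_y_sum[OF order_refl this g(2)[rule_format]]
      have "v = (\<lambda>k. \<Sum>j<n. y j * vcomp a t' (g j) k)" by (rule ext)
      moreover have gen: "generates S (vcomp a t' (g j))" if "j < n" for j
        by (rule less.IH[OF _ graded_moduleD(5)[OF N g(1)[rule_format, OF that]] hvec_vcomp])
          (simp add: t')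
      have "generates S (\<lambda>k. \<Sum>j<n. y j * vcomp a t' (g j) k)"
        by (intro generates_sum generates_mult gen) simp
      ultimately show ?thesis by (simp only:)
    qed
  qed
  have "generates S v" if v: "v \<in> N" for v
  proof -
    have "v = (\<lambda>k. \<Sum>t\<in>(\<Union>k<r. (\<lambda>m. a k + mdeg m) ` ks (v k)). vcomp a t v k)"
      by (rule ext) (rule sum_vcomp, rule graded_moduleD(1)[OF N v])
    moreover have "generates S (\<lambda>k. \<Sum>t\<in>(\<Union>k<r. (\<lambda>m. a k + mdeg m) ` ks (v k)). vcomp a t v k)"
      by (intro generates_sum hom[OF graded_moduleD(5)[OF N v] hvec_vcomp])
    ultimately show ?thesis by simp
  qed
  with finS SN show ?thesis by auto
qed

text \<open>In a generating set of least cardinality no relation has a nonzero constant coefficient,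
  since the corresponding generator could be eliminated.\<close>

lemma minimal_generators:
  assumes N: "graded_module r a N" and c: "cut_module r a m N"
  shows "\<exists>S. finite S \<and> S \<subseteq> N \<and> (\<forall>s\<in>S. \<exists>t\<le>m. hvec a t s) \<and> (\<forall>v\<in>N. generates S v) \<and>
    (\<forall>c s \<gamma>. (\<forall>k. (\<Sum>s\<in>S. c s * s k) = 0) \<longrightarrow> s \<in> S \<longrightarrow> c s = Const \<gamma> \<longrightarrow> \<gamma> = 0)"
proof -
  define G where "G S \<longleftrightarrow> finite S \<and> S \<subseteq> N \<and> (\<forall>s\<in>S. \<exists>t\<le>m. hvec a t s) \<and> (\<forall>v\<in>N. generates S v)" for S
  have "\<exists>q S. G S \<and> card S = q" using finite_generators[OF N c] unfolding G_def by auto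
  then obtain q where q: "\<exists>S. G S \<and> card S = q" "\<And>q'. q' < q \<Longrightarrow> \<not> (\<exists>S. G S \<and> card S = q')"
    using exists_least_iff[of "\<lambda>q. \<exists>S. G S \<and> card S = q"] by auto
  then obtain S where S: "G S" "card S = q" by auto
  have fin: "finite S" using S(1) by (simp add: G_def)
  have red: "\<gamma> = 0" if k: "\<And>k. (\<Sum>s\<in>S. c s * s k) = 0" and s0: "s0 \<in> S" "c s0 = Const \<gamma>" for c s0 \<gamma>
  proof (rule ccontr)
    assume \<gamma>: "\<gamma> \<noteq> 0"
    let ?S = "S - {s0}"
    have "generates ?S v" if v: "v \<in> N" for v
    proof -
      have "generates S v" using S(1) v unfolding G_def by simp
      then obtain e where e: "\<forall>k. v k = (\<Sum>s\<in>S. e s * s k)" unfolding generates_def by (rule exE)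
      have "v k = (\<Sum>s\<in>?S. (e s - e s0 * Const (inverse \<gamma>) * c s) * s k)" for k
      proof -
        have "Const \<gamma> * s0 k + (\<Sum>s\<in>?S. c s * s k) = 0"
          using k[of k] sum.remove[OF fin s0(1), of "\<lambda>s. c s * s k"] s0(2) by simp
        then have "Const (inverse \<gamma>) * (Const \<gamma> * s0 k + (\<Sum>s\<in>?S. c s * s k)) = 0" by simp
        then have s0k: "s0 k = - (Const (inverse \<gamma>) * (\<Sum>s\<in>?S. c s * s k))"
          using \<gamma> by (simp add: distrib_left eq_neg_iff_add_eq_0 flip: mult.assoc Const_mult)
        have "v k = e s0 * s0 k + (\<Sum>s\<in>?S. e s * s k)"
          unfolding e[rule_format, of k] by (rule sum.remove[OF fin s0(1)])
        also have "e s0 * s0 k = - (e s0 * (Const (inverse \<gamma>) * (\<Sum>s\<in>?S. c s * s k)))"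
          by (subst s0k) (rule mult_minus_right)
        also have "e s0 * (Const (inverse \<gamma>) * (\<Sum>s\<in>?S. c s * s k)) =
          (\<Sum>s\<in>?S. e s0 * Const (inverse \<gamma>) * c s * s k)"
          by (simp only: sum_distrib_left mult.assoc)
        also have "- \<dots> + (\<Sum>s\<in>?S. e s * s k) =
          (\<Sum>s\<in>?S. (e s - e s0 * Const (inverse \<gamma>) * c s) * s k)"
          by (simp only: left_diff_distrib sum_subtractf) (rule uminus_add_conv_diff)
        finally show ?thesis .
      qed
      then show ?thesis unfolding generates_def
        by (intro exI[of _ "\<lambda>s. e s - e s0 * Const (inverse \<gamma>) * c s"]) simp
    qed
    then have "G ?S" using S(1) unfolding G_def by auto
    moreover have "card ?S < q" using S(2) fin s0(1) by (metis card_Diff1_less)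
    ultimately show False using q(2) by auto
  qed
  have min: "\<forall>c s \<gamma>. (\<forall>k. (\<Sum>s\<in>S. c s * s k) = 0) \<longrightarrow> s \<in> S \<longrightarrow> c s = Const \<gamma> \<longrightarrow> \<gamma> = 0"
  proof (intro allI impI)
    fix c s \<gamma> assume "\<forall>k. (\<Sum>s\<in>S. c s * s k) = 0" "s \<in> S" "c s = Const \<gamma>"
    then show "\<gamma> = 0" using red[of c s \<gamma>] by simp
  qed
  have "finite S" "S \<subseteq> N" "\<forall>s\<in>S. \<exists>t\<le>m. hvec a t s" "\<forall>v\<in>N. generates S v"
    using S(1) unfolding G_def by simp_all
  with min show ?thesis by (intro exI[of _ S] conjI)
qed

lemma syz_graded:
  assumes "\<And>j. j < q \<Longrightarrow> hvec a (b j) (D j)"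
  shows "graded_module q b (syz q D)"
  unfolding graded_module_def
proof (intro conjI ballI allI impI)
  show "(\<lambda>_. 0) \<in> syz q D" by (simp add: syz_def)
  show "(\<lambda>k. u k + v k) \<in> syz q D" if "u \<in> syz q D" "v \<in> syz q D" for u v
    using that by (simp add: syz_def distrib_right sum.distrib)
  show "(\<lambda>k. c * v k) \<in> syz q D" if "v \<in> syz q D" for c v
    using that unfolding syz_def mem_Collect_eq mult.assoc sum_distrib_left[symmetric] by simp
  show "v k = 0" if "v \<in> syz q D" "q \<le> k" for v k using that by (simp add: syz_def)
  fix t c assume c: "c \<in> syz q D"
  have "(\<lambda>k. \<Sum>j<q. c j * D j k) = (\<lambda>_. 0)" using c by (auto simp: syz_def)
  then have "(\<lambda>k. \<Sum>j<q. vcomp b t c j * D j k) = vcomp a t (\<lambda>_. 0)"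
    using vcomp_linear_comb[of q a b D t c, OF assms] by simp
  also have "\<dots> = (\<lambda>_. 0)" by (rule ext) (simp add: vcomp_def)
  finally have "(\<Sum>j<q. vcomp b t c j * D j k) = 0" for k by (rule fun_cong)
  then show "vcomp b t c \<in> syz q D" using c by (simp add: syz_def vcomp_def)
qed

text \<open>Let the syzygy u be the sum of y_j f_j for j <= i. Applying the map \<phi> and
  cancelling y_i shows that \<phi>(f_i) has its coordinates in Y_i. The condition on N, one degree
  lower, writes \<phi>(f_i) as the sum of y_j \<phi>(h_j) for j < i. Hence w = f_i - (sum of y_j
  h_j) is a syzygy, and u - y_i w has its coordinates in Y_i. The degree lost explains
  \<open>Suc m\<close>.\<close>

lemma syz_cut_module:
  assumes N: "graded_module r a N" and c: "cut_module r a m N"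
    and D: "\<And>j. j < q \<Longrightarrow> hvec a (b j) (D j)" "\<And>j. j < q \<Longrightarrow> b j \<le> m"
    and img: "N = {(\<lambda>k. \<Sum>j<q. c j * D j k) | c. True}"
  shows "cut_module q b (Suc m) (syz q D)"
  unfolding cut_module_def
proof (intro conjI allI impI ballI)
  show "b k \<le> Suc m" if "k < q" for k using D(2)[OF that] by simp
  have gm: "graded_module q b (syz q D)" by (rule syz_graded[OF D(1)])
  fix i t u assume "i \<le> n" and t: "Suc m < t" and "u \<in> syz q D" "hvec b t u" "\<forall>k. u k \<in> Y i"
  obtain t1 where t1: "t = Suc t1" "m < t1" using t by (cases t) auto
  then obtain t2 where t2: "t1 = Suc t2" by (cases t1) auto
  show "\<exists>g. (\<forall>j<i. g j \<in> syz q D) \<and> (\<forall>k. u k = (\<Sum>j<i. y j * g j k))"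
    using \<open>i \<le> n\<close> \<open>u \<in> syz q D\<close> \<open>hvec b t u\<close> \<open>\<forall>k. u k \<in> Y i\<close>
  proof (induction i arbitrary: u)
    case 0
    then show ?case by (simp add: Y_0)
  next
    case (Suc i)
    have i: "i < n" "i \<le> n" using Suc.prems(1) by auto
    have "\<forall>l. \<exists>f. u l = (\<Sum>j<Suc i. y j * f j)" using Suc.prems(4) unfolding Y_iff by simp
    then have "\<exists>f. \<forall>l. u l = (\<Sum>j<Suc i. y j * f l j)" by (rule choice)
    then obtain f0 where f0: "\<forall>l. u l = (\<Sum>j<Suc i. y j * f0 l j)" by (rule exE)
    \<comment> \<open>The arbitrary cofactors are cut off at \<open>q\<close> and made homogeneous
      of degree t1 = t - 1.\<close>
    define f where "f j = vcomp b t1 (\<lambda>l. if l < q then f0 l j else 0)" for j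
    have u0: "u l = 0" if "q \<le> l" for l using Suc.prems(2) that by (simp add: syz_def)
    have "u l = (\<Sum>j<Suc i. y j * (if l < q then f0 l j else 0))" for l
      using f0 u0[of l] by (cases "l < q") auto
    from vcomp_y_sum[OF Suc.prems(1) Suc.prems(3)[unfolded t1(1)] this]
    have uf: "u l = (\<Sum>j<Suc i. y j * f j l)" for l unfolding f_def .
    have fq: "f j l = 0" if "q \<le> l" for j l using that by (simp add: f_def vcomp_def)
    have hf: "hvec b t1 (f j)" for j unfolding f_def by (rule hvec_vcomp)
    define \<phi> where "\<phi> c k = (\<Sum>j<q. c j * D j k)" for c k
    have \<phi>N: "\<phi> c \<in> N" for c unfolding img \<phi>_def by auto
    have \<phi>sum: "\<phi> (\<lambda>l. \<Sum>j<s. y j * g j l) k = (\<Sum>j<s. y j * \<phi> (g j) k)" for s g k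
    proof -
      have "\<phi> (\<lambda>l. \<Sum>j<s. y j * g j l) k = (\<Sum>l<q. \<Sum>j<s. y j * (g j l * D l k))"
        unfolding \<phi>_def sum_distrib_right by (simp only: mult.assoc)
      also have "\<dots> = (\<Sum>j<s. \<Sum>l<q. y j * (g j l * D l k))" by (rule sum.swap)
      finally show ?thesis unfolding \<phi>_def sum_distrib_left .
    qed
    have \<phi>diff: "\<phi> (\<lambda>l. g l - h l) k = \<phi> g k - \<phi> h k" for g h k
      unfolding \<phi>_def by (simp only: left_diff_distrib sum_subtractf)
    have \<phi>h: "hvec a t1 (\<phi> (f i))"
    proof -
      have "vcomp a t1 (\<phi> (f i)) = \<phi> (f i)"
        using vcomp_linear_comb[of q a b D t1 "f i", OF D(1)] vcomp_hvec[OF hf[of i]] unfolding \<phi>_def by simp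
      then show ?thesis using hvec_vcomp by metis
    qed
    have \<phi>Y: "\<phi> (f i) k \<in> Y i" for k
    proof (rule Y_regular[OF i(1)])
      have "\<phi> u k = 0" using Suc.prems(2) by (simp add: syz_def \<phi>_def)
      moreover have "\<phi> u k = (\<Sum>j<Suc i. y j * \<phi> (f j) k)" using \<phi>sum[of f "Suc i" k] uf by presburger
      ultimately have "y i * \<phi> (f i) k = - (\<Sum>j<i. y j * \<phi> (f j) k)"
        by (simp add: eq_neg_iff_add_eq_0 add.commute)
      also have "\<dots> \<in> Y i" by (rule ring_ideal.subspace_neg[OF Y_ideal Y_sum])
      finally show "y i * \<phi> (f i) k \<in> Y i" .
    qed
    obtain g where g: "\<forall>j<i. g j \<in> N" "\<forall>k. \<phi> (f i) k = (\<Sum>j<i. y j * g j k)"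
      using cut_moduleD[OF c i(2) t1(2) \<phi>N \<phi>h \<phi>Y] by (elim exE conjE)
    have "\<forall>j. \<exists>h. j < i \<longrightarrow> g j = \<phi> h"
    proof
      fix j
      show "\<exists>h. j < i \<longrightarrow> g j = \<phi> h"
      proof (cases "j < i")
        case True
        then obtain h where "g j = (\<lambda>k. \<Sum>j<q. h j * D j k)" using g(1) unfolding img by auto
        then have "g j = \<phi> h" by (auto simp: \<phi>_def)
        then show ?thesis by auto
      qed simp
    qed
    then have "\<exists>h. \<forall>j. j < i \<longrightarrow> g j = \<phi> (h j)" by (rule choice)
    then obtain h0 where h0: "\<forall>j. j < i \<longrightarrow> g j = \<phi> (h0 j)" by (rule exE)
    define h where "h j l = (if l < q then h0 j l else 0)" for j l
    have h: "g j = \<phi> (h j)" if "j < i" for j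
      using h0 that unfolding \<phi>_def h_def by (auto intro!: sum.cong)
    \<comment> \<open>The correction of \<open>f i\<close> to a syzygy; it is congruent to
      \<open>f i\<close> modulo Y_i.\<close>
    define w where "w = (\<lambda>l. f i l - (\<Sum>j<i. y j * h j l))"
    have "w \<in> syz q D" unfolding syz_def
    proof (intro CollectI conjI allI impI)
      show "w l = 0" if "q \<le> l" for l using that fq by (simp add: w_def h_def)
      fix k
      have "\<phi> w k = \<phi> (f i) k - (\<Sum>j<i. y j * \<phi> (h j) k)" unfolding w_def \<phi>diff \<phi>sum ..
      also have "(\<Sum>j<i. y j * \<phi> (h j) k) = (\<Sum>j<i. y j * g j k)"
        by (rule sum.cong) (simp_all add: h)
      finally show "(\<Sum>j<q. w j * D j k) = 0" using g(2) unfolding \<phi>_def by simp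
    qed
    then have w': "vcomp b t1 w \<in> syz q D" by (rule graded_moduleD(5)[OF gm])
    have fw: "f i l - vcomp b t1 w l \<in> Y i" for l
    proof -
      have "f i l - vcomp b t1 w l = vcomp b t1 (\<lambda>l. f i l - w l) l"
        using vcomp_hvec[OF hf[of i]] by (simp add: vcomp_diff)
      moreover have "vcomp b t1 (\<lambda>l. f i l - w l) l \<in> Y i"
        by (rule vcomp_mem_ideal[OF Y_homogeneous[OF i(2)]]) (simp add: w_def Y_sum)
      ultimately show ?thesis by simp
    qed
    define u' where "u' = (\<lambda>l. u l - y i * vcomp b t1 w l)"
    have "u' \<in> syz q D" unfolding u'_def by (rule graded_module_diff[OF gm Suc.prems(2) w'])
    moreover have "hvec b t u'" unfolding u'_def
      using hvec_diff[OF Suc.prems(3), of "\<lambda>l. y i * vcomp b t1 w l"]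
        hvec_mult[OF hvec_vcomp[of b t1 w] y_forms[OF i(1)]] t1(1) by simp
    moreover have "u' l \<in> Y i" for l
    proof -
      have "u' l = (\<Sum>j<i. y j * f j l) + y i * (f i l - vcomp b t1 w l)"
        unfolding u'_def uf by (simp add: right_diff_distrib)
      also have "\<dots> \<in> Y i"
        by (intro ring_ideal.subspace_add[OF Y_ideal] Y_sum ideal_mult_right[OF Y_ideal] fw)
      finally show ?thesis .
    qed
    ultimately obtain g' where g': "\<forall>j<i. g' j \<in> syz q D" "\<forall>k. u' k = (\<Sum>j<i. y j * g' j k)"
      using Suc.IH[OF i(2), of u'] by auto
    show ?case
    proof (intro exI[of _ "g'(i := vcomp b t1 w)"] conjI allI impI)
      show "(g'(i := vcomp b t1 w)) j \<in> syz q D" if "j < Suc i" for j using that g'(1) w' by auto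
      fix k
      have "u k = u' k + y i * vcomp b t1 w k" by (simp add: u'_def)
      then show "u k = (\<Sum>j<Suc i. y j * (g'(i := vcomp b t1 w)) j k)" using g'(2) by simp
    qed
  qed
qed

lemma syzygy_step:
  assumes N: "graded_module r a N" and c: "cut_module r a m N"
  shows "\<exists>q b D. (\<forall>j<q. hvec a (b j) (D j) \<and> b j \<le> m) \<and> N = {(\<lambda>k. \<Sum>j<q. c j * D j k) | c. True} \<and>
    graded_module q b (syz q D) \<and> cut_module q b (Suc m) (syz q D) \<and> (\<forall>c\<in>syz q D. \<forall>j. c j \<in> Y n)"
proof -
  from minimal_generators[OF N c]
  obtain S where S: "finite S" "S \<subseteq> N" "\<forall>s\<in>S. \<exists>t\<le>m. hvec a t s" "\<forall>v\<in>N. generates S v"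
    "\<forall>c s \<gamma>. (\<forall>k. (\<Sum>s\<in>S. c s * s k) = 0) \<longrightarrow> s \<in> S \<longrightarrow> c s = Const \<gamma> \<longrightarrow> \<gamma> = 0"
    by (elim exE conjE)
  define q where "q = card S"
  obtain D where "bij_betw D {0..<q} S" using ex_bij_betw_nat_finite[OF S(1)] q_def by auto
  then have D: "bij_betw D {..<q} S" by (simp add: atLeast0LessThan)
  have DS: "D j \<in> S" if "j < q" for j using bij_betwE[OF D] that by simp
  have sumD: "(\<Sum>s\<in>S. F s) = (\<Sum>j<q. F (D j))" for F :: "_ \<Rightarrow> ('k, 'n) mpol"
    using sum.reindex_bij_betw[OF D, of F] by simp
  have "\<forall>j. \<exists>t. j < q \<longrightarrow> t \<le> m \<and> hvec a t (D j)" using bspec[OF S(3) DS] by blast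
  then have "\<exists>b. \<forall>j. j < q \<longrightarrow> b j \<le> m \<and> hvec a (b j) (D j)" by (rule choice)
  then obtain b where b: "\<forall>j. j < q \<longrightarrow> b j \<le> m \<and> hvec a (b j) (D j)" by (rule exE)
  have hb: "hvec a (b j) (D j)" "b j \<le> m" if "j < q" for j using b that by auto
  have img: "N = {(\<lambda>k. \<Sum>j<q. c j * D j k) | c. True}"
  proof
    show "{(\<lambda>k. \<Sum>j<q. c j * D j k) | c. True} \<subseteq> N"
      using graded_module_sum[OF N, of "{..<q}" D] DS S(2) by auto
    show "N \<subseteq> {(\<lambda>k. \<Sum>j<q. c j * D j k) | c. True}"
    proof
      fix v assume "v \<in> N"
      then have "generates S v" by (rule bspec[OF S(4)])
      then obtain e where "\<forall>k. v k = (\<Sum>s\<in>S. e s * s k)" unfolding generates_def by (rule exE)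
      then have "v = (\<lambda>k. \<Sum>j<q. e (D j) * D j k)" unfolding sumD by auto
      then show "v \<in> {(\<lambda>k. \<Sum>j<q. c j * D j k) | c. True}" by auto
    qed
  qed
  have gm: "graded_module q b (syz q D)" by (rule syz_graded[OF hb(1)])
  have cm: "cut_module q b (Suc m) (syz q D)" by (rule syz_cut_module[OF N c hb img])
  have "c j \<in> Y n" if c: "c \<in> syz q D" for c j
  proof (cases "j < q")
    case False
    then show ?thesis using c by (simp add: syz_def mem_Y_n_iff)
  next
    case j: True
    \<comment> \<open>In degree \<open>b j\<close> the j-th coordinate is the constant term of
      \<open>c j\<close>, and minimality of the generators makes it zero.\<close>
    define c' where "c' = vcomp b (b j) c"
    have "c' \<in> syz q D" unfolding c'_def by (rule graded_moduleD(5)[OF gm c])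
    then have z: "(\<Sum>l<q. c' l * D l k) = 0" for k by (simp add: syz_def)
    define e where "e s = c' (inv_into {..<q} D s)" for s
    have eD: "e (D l) = c' l" if "l < q" for l
      unfolding e_def using bij_betw_inv_into_left[OF D, of l] that by simp
    have "\<forall>k. (\<Sum>s\<in>S. e s * s k) = 0"
    proof
      fix k
      have "(\<Sum>s\<in>S. e s * s k) = (\<Sum>l<q. c' l * D l k)"
        unfolding sumD by (rule sum.cong) (simp_all add: eD)
      then show "(\<Sum>s\<in>S. e s * s k) = 0" using z by simp
    qed
    then have "e (D j) = Const \<gamma> \<longrightarrow> \<gamma> = 0" for \<gamma>
      using mp[OF spec[OF spec[OF spec[OF S(5)]]], of e "D j" \<gamma>] DS[OF j] by simp
    moreover have "e (D j) = Const (lk (c j) 0)"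
    proof -
      have "c' j = hc 0 (c j)" by (simp add: c'_def vcomp_def)
      then show ?thesis unfolding eD[OF j] using forms_zero_is_Const[of "hc 0 (c j)"] by simp
    qed
    ultimately have "lk (c j) 0 = 0" by simp
    then show ?thesis by (simp add: mem_Y_n_iff)
  qed
  with hb img gm cm show ?thesis by (intro exI[of _ q] exI[of _ b] exI[of _ D]) simp
qed

text \<open>On the indices: \<open>N p\<close> sits in the free module with shifts
  \<open>a p\<close>, and \<open>D p\<close> lists its \<open>r (Suc p)\<close> generators. Thus
  \<open>N 0\<close> sits in R itself, and the module F_p of the resolution has rank
  \<open>r (Suc p)\<close> and shifts \<open>a (Suc p)\<close>.\<close>

lemma syzygy_sequence:
  assumes N0: "graded_module 1 (\<lambda>_. 0) N0" "cut_module 1 (\<lambda>_. 0) d N0"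
  shows "\<exists>r a N D. r (0::nat) = (1::nat) \<and> a 0 = (\<lambda>_. 0) \<and> N 0 = N0 \<and>
    (\<forall>p. graded_module (r p) (a p) (N p)) \<and>
    (\<forall>p. \<forall>j<r (Suc p). hvec (a p) (a (Suc p) j) (D p j) \<and> a (Suc p) j \<le> d + p) \<and>
    (\<forall>p. N p = {(\<lambda>k. \<Sum>j<r (Suc p). c j * D p j k) | c. True}) \<and>
    (\<forall>p. N (Suc p) = syz (r (Suc p)) (D p)) \<and> (\<forall>p. \<forall>c\<in>N (Suc p). \<forall>j. c j \<in> Y n)"
proof -
  \<comment> \<open>Dependent choice: \<open>P\<close> is the invariant of a state and
    \<open>Q\<close> relates consecutive states. The generators stored in a state are those of the
    module in the preceding state.\<close>
  define P where "P p x \<longleftrightarrow> (case x of (r, a, N, D) \<Rightarrow> graded_module r a N \<and> cut_module r a (d + p) N \<and>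
    (p = 0 \<longrightarrow> r = 1 \<and> a = (\<lambda>_. 0) \<and> N = N0))"
    for p :: nat and x :: "nat \<times> (nat \<Rightarrow> nat) \<times> (nat \<Rightarrow> ('k, 'n) mpol) set \<times> (nat \<Rightarrow> nat \<Rightarrow> ('k, 'n) mpol)"
  define Q where "Q p x x' \<longleftrightarrow> (case x of (r, a, N, _) \<Rightarrow> case x' of (q, b, N', D) \<Rightarrow>
    (\<forall>j<q. hvec a (b j) (D j) \<and> b j \<le> d + p) \<and> N = {(\<lambda>k. \<Sum>j<q. c j * D j k) | c. True} \<and>
    N' = syz q D \<and> (\<forall>c\<in>N'. \<forall>j. c j \<in> Y n))"
    for p :: nat and x x' :: "nat \<times> (nat \<Rightarrow> nat) \<times> (nat \<Rightarrow> ('k, 'n) mpol) set \<times> (nat \<Rightarrow> nat \<Rightarrow> ('k, 'n) mpol)"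
  have "\<exists>f. \<forall>p. P p (f p) \<and> Q p (f p) (f (Suc p))"
  proof (rule dependent_nat_choice)
    show "\<exists>x. P 0 x" by (rule exI[of _ "(1, \<lambda>_. 0, N0, \<lambda>_ _. 0)"]) (use N0 in \<open>simp add: P_def\<close>)
    fix x p assume x: "P p x"
    obtain r a N D where xe: "x = (r, a, N, D)" by (cases x)
    have St: "graded_module r a N" "cut_module r a (d + p) N" using x by (simp_all add: P_def xe)
    from syzygy_step[OF St]
    obtain q b D' where st: "\<forall>j<q. hvec a (b j) (D' j) \<and> b j \<le> d + p"
      "N = {(\<lambda>k. \<Sum>j<q. c j * D' j k) | c. True}" "graded_module q b (syz q D')"
      "cut_module q b (Suc (d + p)) (syz q D')" "\<forall>c\<in>syz q D'. \<forall>j. c j \<in> Y n"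
      by (elim exE conjE)
    show "\<exists>x'. P (Suc p) x' \<and> Q p x x'"
      unfolding P_def Q_def xe prod.case
    proof (intro exI[of _ "(q, b, syz q D', D')"], unfold prod.case, intro conjI)
      show "cut_module q b (d + Suc p) (syz q D')" using st(4) by simp
    qed (use st in simp_all)
  qed
  then obtain f where f: "\<forall>p. P p (f p) \<and> Q p (f p) (f (Suc p))" by (rule exE)
  define r where "r p = fst (f p)" for p
  define a where "a p = fst (snd (f p))" for p
  define N where "N p = fst (snd (snd (f p)))" for p
  define D where "D p = snd (snd (snd (f (Suc p))))" for p
  have fe: "f p = (r p, a p, N p, snd (snd (snd (f p))))" for p by (simp add: r_def a_def N_def)
  have feS: "f (Suc p) = (r (Suc p), a (Suc p), N (Suc p), D p)" for p
    by (simp add: r_def a_def N_def D_def)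
  have Pp: "graded_module (r p) (a p) (N p)" "p = 0 \<longrightarrow> r p = 1 \<and> a p = (\<lambda>_. 0) \<and> N p = N0" for p
    using f[rule_format, of p] unfolding P_def by (subst (asm) fe, simp)+
  have Qp: "(\<forall>j<r (Suc p). hvec (a p) (a (Suc p) j) (D p j) \<and> a (Suc p) j \<le> d + p) \<and>
    N p = {(\<lambda>k. \<Sum>j<r (Suc p). c j * D p j k) | c. True} \<and>
    N (Suc p) = syz (r (Suc p)) (D p) \<and> (\<forall>c\<in>N (Suc p). \<forall>j. c j \<in> Y n)" for p
  proof -
    have "Q p (r p, a p, N p, snd (snd (snd (f p)))) (r (Suc p), a (Suc p), N (Suc p), D p)"
      using f[rule_format, of p] by (simp only: fe[symmetric] feS[symmetric])
    then show ?thesis unfolding Q_def prod.case .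
  qed
  show ?thesis
  proof (intro exI[of _ r] exI[of _ a] exI[of _ N] exI[of _ D] conjI)
    show "r 0 = 1" "a 0 = (\<lambda>_. 0)" "N 0 = N0" using Pp(2)[of 0] by simp_all
    show "\<forall>p. graded_module (r p) (a p) (N p)" using Pp(1) by (rule allI)
    show "\<forall>p. \<forall>j<r (Suc p). hvec (a p) (a (Suc p) j) (D p j) \<and> a (Suc p) j \<le> d + p"
      by (rule allI, rule Qp[THEN conjunct1])
    show "\<forall>p. N p = {(\<lambda>k. \<Sum>j<r (Suc p). c j * D p j k) | c. True}"
      by (rule allI, rule Qp[THEN conjunct2, THEN conjunct1])
    show "\<forall>p. N (Suc p) = syz (r (Suc p)) (D p)"
      by (rule allI, rule Qp[THEN conjunct2, THEN conjunct2, THEN conjunct1])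
    show "\<forall>p. \<forall>c\<in>N (Suc p). \<forall>j. c j \<in> Y n"
      by (rule allI, rule Qp[THEN conjunct2, THEN conjunct2, THEN conjunct2])
  qed
qed

text \<open>J is placed as a submodule of R with shift 0, where the hypothesis becomes
  \<open>cut_module\<close> for \<open>d\<close>. The resolution is minimal because the columns of
  the later matrices are syzygies, whose coordinates lie in the irrelevant ideal Y_n.\<close>

lemma regular_ideal_if_cut_cond:
  assumes J: "homogeneous_ideal J" and cut: "\<And>i t. i \<le> n \<Longrightarrow> d < t \<Longrightarrow> cut_cond J i t"
  shows "regular_ideal d J"
proof -
  note iJ = homogeneous_idealD(1)[OF J]
  define N0 where "N0 = {v :: nat \<Rightarrow> ('k, 'n) mpol. v 0 \<in> J \<and> (\<forall>k\<ge>1. v k = 0)}"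
  have gm0: "graded_module 1 (\<lambda>_. 0) N0" unfolding graded_module_def
  proof (intro conjI ballI allI impI)
    show "v k = 0" if "v \<in> N0" "1 \<le> k" for v k using that by (simp add: N0_def)
    show "(\<lambda>_. 0) \<in> N0" by (simp add: N0_def ring_ideal.subspace_0[OF iJ])
    show "(\<lambda>k. u k + v k) \<in> N0" if "u \<in> N0" "v \<in> N0" for u v
      using that by (simp add: N0_def ring_ideal.subspace_add[OF iJ])
    show "(\<lambda>k. c * v k) \<in> N0" if "v \<in> N0" for c v
      using that by (simp add: N0_def ideal_mult_right[OF iJ])
    show "vcomp (\<lambda>_. 0) t v \<in> N0" if "v \<in> N0" for t v
      using that by (simp add: N0_def vcomp_def homogeneous_idealD(2)[OF J])
  qed
  have cm0: "cut_module 1 (\<lambda>_. 0) d N0" unfolding cut_module_def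
  proof (intro conjI allI impI ballI)
    fix i t u assume i: "i \<le> n" "d < t" and u: "u \<in> N0" "hvec (\<lambda>_. 0) t u" "\<forall>k. u k \<in> Y i"
    have "u 0 \<in> forms t" using hvec_forms[OF u(2), of 0] by simp
    then have "u 0 \<in> J \<inter> forms t \<inter> Y i" using u by (simp add: N0_def)
    then have "\<exists>g. (\<forall>j<i. g j \<in> J) \<and> u 0 = (\<Sum>j<i. y j * g j)"
      by (rule bspec[OF cut[OF i, unfolded cut_cond_def]])
    then obtain g where g: "\<forall>j<i. g j \<in> J" "u 0 = (\<Sum>j<i. y j * g j)" by (elim exE conjE)
    show "\<exists>g. (\<forall>j<i. g j \<in> N0) \<and> (\<forall>k. u k = (\<Sum>j<i. y j * g j k))"
    proof (intro exI[of _ "\<lambda>j k. if k = 0 then g j else 0"] conjI allI impI)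
      show "(\<lambda>k. if k = 0 then g j else 0) \<in> N0" if "j < i" for j using g(1) that by (simp add: N0_def)
      show "u k = (\<Sum>j<i. y j * (if k = 0 then g j else 0))" for k
        using g(2) u(1) by (cases "k = 0") (simp_all add: N0_def)
    qed
  qed simp
  from syzygy_sequence[OF gm0 cm0]
  obtain r a N D where R0: "r (0::nat) = (1::nat)" "a 0 = (\<lambda>_. 0)" "N 0 = N0"
    "\<forall>p. graded_module (r p) (a p) (N p)"
    "\<forall>p. \<forall>j<r (Suc p). hvec (a p) (a (Suc p) j) (D p j) \<and> a (Suc p) j \<le> d + p"
    "\<forall>p. N p = {(\<lambda>k. \<Sum>j<r (Suc p). c j * D p j k) | c. True}"
    "\<forall>p. N (Suc p) = syz (r (Suc p)) (D p)"
    "\<forall>p. \<forall>c\<in>N (Suc p). \<forall>j. c j \<in> Y n"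
    by (elim exE conjE)
  have deg: "hvec (a p) (a (Suc p) j) (D p j)" "a (Suc p) j \<le> d + p" if "j < r (Suc p)" for p j
    using R0(5) that by simp_all
  have mem: "c j \<in> Y n" if "c \<in> N (Suc p)" for p c j using R0(8) that by simp
  note R = R0(1-3) R0(4)[rule_format] deg R0(6)[rule_format] R0(7)[rule_format] mem
  \<comment> \<open>Generators become columns, hence the exchanged indices.\<close>
  define M where "M p = mat (r p) (r (Suc p)) (\<lambda>(i, j). D p j i)" for p
  have Mij: "M p $$ (i, j) = D p j i" if "i < r p" "j < r (Suc p)" for p i j
    using that by (simp add: M_def)
  have Mv: "(M p *\<^sub>v w) $ i = (\<Sum>j<r (Suc p). w $ j * D p j i)"
    if "w \<in> carrier_vec (r (Suc p))" "i < r p" for p w i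
  proof -
    have "(M p *\<^sub>v w) $ i = (\<Sum>j<r (Suc p). M p $$ (i, j) * w $ j)"
      using that by (simp add: M_def scalar_prod_def atLeast0LessThan)
    also have "\<dots> = (\<Sum>j<r (Suc p). w $ j * D p j i)"
      by (rule sum.cong) (simp_all add: Mij that(2) mult.commute)
    finally show ?thesis .
  qed
  have combN: "(\<lambda>k. \<Sum>j<r (Suc p). c j * D p j k) \<in> N p" for p c unfolding R(7)[of p] by auto
  have DN: "D p j \<in> N p" if j: "j < r (Suc p)" for p j
  proof -
    have "(\<lambda>k. \<Sum>l<r (Suc p). (if l = j then 1 else 0) * D p l k) = D p j"
    proof
      fix k
      have "(\<Sum>l<r (Suc p). (if l = j then 1 else 0) * D p l k) = (\<Sum>l<r (Suc p). if l = j then D p j k else 0)"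
        by (rule sum.cong) auto
      then show "(\<Sum>l<r (Suc p). (if l = j then 1 else 0) * D p l k) = D p j k" using j by simp
    qed
    then show ?thesis using combN[where p = p and c = "\<lambda>l. if l = j then 1 else 0"] by simp
  qed
  have "minimal_free_resolution J (\<lambda>p. r (Suc p)) (\<lambda>p. a (Suc p)) M"
    unfolding minimal_free_resolution_def
  proof (intro conjI allI impI ballI)
    show "M 0 \<in> carrier_mat 1 (r (Suc 0))" by (simp add: M_def R(1))
    show "M (Suc p) \<in> carrier_mat (r (Suc p)) (r (Suc (Suc p)))" for p by (simp add: M_def)
    show "M 0 $$ (0, j) \<in> forms (a (Suc 0) j)" if "j < r (Suc 0)" for j
      using hvec_forms[OF R(5)[OF that], of 0] that by (simp add: Mij R(1,2))
    show "mdeg m + a (Suc p) i = a (Suc (Suc p)) j"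
      if "i < r (Suc p)" "j < r (Suc (Suc p))" "m \<in> ks (M (Suc p) $$ (i, j))" for p i j m
      using R(5)[OF that(2)] that(3) unfolding Mij[OF that(1,2)] hvec_def by simp
    show "{(M 0 *\<^sub>v v) $ 0 |v. v \<in> carrier_vec (r (Suc 0))} = J"
    proof
      show "{(M 0 *\<^sub>v v) $ 0 |v. v \<in> carrier_vec (r (Suc 0))} \<subseteq> J"
      proof
        fix x assume "x \<in> {(M 0 *\<^sub>v v) $ 0 |v. v \<in> carrier_vec (r (Suc 0))}"
        then obtain v where v: "v \<in> carrier_vec (r (Suc 0))" "x = (M 0 *\<^sub>v v) $ 0" by auto
        have "(\<lambda>k. \<Sum>j<r (Suc 0). v $ j * D 0 j k) \<in> N0" using combN[where p = 0 and c = "\<lambda>j. v $ j"] R(3) by simp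
        then show "x \<in> J" using Mv[OF v(1), of 0] v(2) R(1) by (simp add: N0_def)
      qed
      show "J \<subseteq> {(M 0 *\<^sub>v v) $ 0 |v. v \<in> carrier_vec (r (Suc 0))}"
      proof
        fix x assume "x \<in> J"
        then have "(\<lambda>k. if k = 0 then x else 0) \<in> N 0" by (simp add: R(3) N0_def)
        then obtain c where c: "(\<lambda>k::nat. if k = 0 then x else 0) = (\<lambda>k. \<Sum>j<r (Suc 0). c j * D 0 j k)"
          unfolding R(7)[of 0] by auto
        have w: "vec (r (Suc 0)) c \<in> carrier_vec (r (Suc 0))" by simp
        have "(M 0 *\<^sub>v vec (r (Suc 0)) c) $ 0 = (\<Sum>j<r (Suc 0). c j * D 0 j 0)"
          using Mv[OF w, of 0] R(1) by simp
        also have "\<dots> = x" using fun_cong[OF c, of 0] by simp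
        finally show "x \<in> {(M 0 *\<^sub>v v) $ 0 |v. v \<in> carrier_vec (r (Suc 0))}" using w by auto
      qed
    qed
    show "mat_kernel (M p) = {M (Suc p) *\<^sub>v v |v. v \<in> carrier_vec (r (Suc (Suc p)))}" for p
    proof
      show "mat_kernel (M p) \<subseteq> {M (Suc p) *\<^sub>v v |v. v \<in> carrier_vec (r (Suc (Suc p)))}"
      proof
        fix w assume "w \<in> mat_kernel (M p)"
        then have w: "w \<in> carrier_vec (r (Suc p))" "M p *\<^sub>v w = 0\<^sub>v (r p)"
          by (simp_all add: mat_kernel_def M_def)
        define c where "c j = (if j < r (Suc p) then w $ j else 0)" for j
        have "(\<Sum>j<r (Suc p). c j * D p j k) = 0" for k
        proof (cases "k < r p")
          case True
          have "(\<Sum>j<r (Suc p). c j * D p j k) = (M p *\<^sub>v w) $ k"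
            unfolding Mv[OF w(1) True] by (rule sum.cong) (simp_all add: c_def)
          then show ?thesis using w(2) True by simp
        next
          case False
          \<comment> \<open>The definition of \<open>syz\<close> quantifies over all
            \<open>k\<close>, while the matrix has only the rows below \<open>r p\<close>.\<close>
          then have "D p j k = 0" if "j < r (Suc p)" for j
            using graded_moduleD(1)[OF R(4) DN[OF that], of k] by simp
          then show ?thesis by (intro sum.neutral) simp
        qed
        then have "c \<in> N (Suc p)" unfolding R(8) syz_def by (simp add: c_def)
        then obtain e where e: "c = (\<lambda>k. \<Sum>j<r (Suc (Suc p)). e j * D (Suc p) j k)"
          unfolding R(7)[of "Suc p"] by auto
        have v: "vec (r (Suc (Suc p))) e \<in> carrier_vec (r (Suc (Suc p)))" by simp
        have "w = M (Suc p) *\<^sub>v vec (r (Suc (Suc p))) e"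
        proof (rule eq_vecI)
          show "dim_vec w = dim_vec (M (Suc p) *\<^sub>v vec (r (Suc (Suc p))) e)" using w(1) by (simp add: M_def)
          fix i assume "i < dim_vec (M (Suc p) *\<^sub>v vec (r (Suc (Suc p))) e)"
          then have i: "i < r (Suc p)" by (simp add: M_def)
          have "w $ i = c i" using i by (simp add: c_def)
          also have "\<dots> = (\<Sum>j<r (Suc (Suc p)). e j * D (Suc p) j i)" by (simp add: e)
          also have "\<dots> = (M (Suc p) *\<^sub>v vec (r (Suc (Suc p))) e) $ i"
            unfolding Mv[OF v i] by (rule sum.cong) simp_all
          finally show "w $ i = (M (Suc p) *\<^sub>v vec (r (Suc (Suc p))) e) $ i" .
        qed
        with v show "w \<in> {M (Suc p) *\<^sub>v v |v. v \<in> carrier_vec (r (Suc (Suc p)))}" by auto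
      qed
      show "{M (Suc p) *\<^sub>v v |v. v \<in> carrier_vec (r (Suc (Suc p)))} \<subseteq> mat_kernel (M p)"
      proof
        fix w assume "w \<in> {M (Suc p) *\<^sub>v v |v. v \<in> carrier_vec (r (Suc (Suc p)))}"
        then obtain v where v: "v \<in> carrier_vec (r (Suc (Suc p)))" "w = M (Suc p) *\<^sub>v v" by auto
        have w: "w \<in> carrier_vec (r (Suc p))" 
          unfolding v(2) by (rule carrier_vecI) (simp add: M_def)
        have "(\<lambda>k. \<Sum>j<r (Suc (Suc p)). v $ j * D (Suc p) j k) \<in> syz (r (Suc p)) (D p)"
          by (subst R(8)[symmetric]) (rule combN)
        then have z: "(\<Sum>l<r (Suc p). (\<Sum>j<r (Suc (Suc p)). v $ j * D (Suc p) j l) * D p l k) = 0" for k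
          by (simp add: syz_def)
        have "M p *\<^sub>v w = 0\<^sub>v (r p)"
        proof (rule eq_vecI)
          show "dim_vec (M p *\<^sub>v w) = dim_vec (0\<^sub>v (r p))" by (simp add: M_def)
          fix i assume "i < dim_vec (0\<^sub>v (r p) :: ('k, 'n) mpol vec)"
          then have i: "i < r p" by simp
          have "(M p *\<^sub>v w) $ i = (\<Sum>l<r (Suc p). (\<Sum>j<r (Suc (Suc p)). v $ j * D (Suc p) j l) * D p l i)"
            unfolding Mv[OF w i] by (rule sum.cong) (simp_all add: v(2) Mv[OF v(1)])
          then show "(M p *\<^sub>v w) $ i = 0\<^sub>v (r p) $ i" using z i by simp
        qed
        then show "w \<in> mat_kernel (M p)" using w by (simp add: mat_kernel_def M_def)
      qed
    qed
    show "M (Suc p) $$ (i, j) \<in> ideal_gen (range Var)"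
      if "i < r (Suc p)" "j < r (Suc (Suc p))" for p i j
      using R(9)[OF DN[OF that(2)], of i] unfolding Mij[OF that] Y_n .
  qed
  then show ?thesis unfolding regular_ideal_def
    by (intro exI[of _ "\<lambda>p. r (Suc p)"] exI[of _ "\<lambda>p. a (Suc p)"] exI[of _ M] conjI allI impI R(6))
qed

end

section \<open>Hilbert polynomial and dimension of one-dimensional schemes\<close>

text \<open>The constant term is fixed by the value at \<open>d\<close>. Polynomials that agree at
  all large naturals coincide, which settles the definite description.\<close>

lemma hilbert_polynomial_linear:
  assumes step: "\<And>t. d \<le> t \<Longrightarrow> hilbert_function J (Suc t) = hilbert_function J t + s"
  shows "hilbert_polynomial J = [:of_nat (hilbert_function J d) - of_nat s * of_nat d, of_nat s:]"
    (is "_ = ?p")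
proof -
  have val: "poly ?p (of_nat t) = of_nat (hilbert_function J t)" if "d \<le> t" for t
    using that
  proof (induction t rule: dec_induct)
    case base
    show ?case by simp
  next
    case (step t)
    then show ?case using assms[of t] by (simp add: algebra_simps)
  qed
  show ?thesis unfolding hilbert_polynomial_def
  proof (rule the_equality)
    show "\<exists>t0. \<forall>t\<ge>t0. poly ?p (of_nat t) = of_nat (hilbert_function J t)" using val by blast
    fix q :: "rat poly" assume "\<exists>t0. \<forall>t\<ge>t0. poly q (of_nat t) = of_nat (hilbert_function J t)"
    then obtain t0 where q: "\<forall>t\<ge>t0. poly q (of_nat t) = of_nat (hilbert_function J t)" by blast
    show "q = ?p"
    proof (rule ccontr)
      assume "q \<noteq> ?p"
      then have "finite {x. poly (q - ?p) x = 0}" by (intro poly_roots_finite) simp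
      moreover have "of_nat ` {max d t0..} \<subseteq> {x. poly (q - ?p) x = 0}"
      proof
        fix x :: rat assume "x \<in> of_nat ` {max d t0..}"
        then obtain t where t: "x = of_nat t" "d \<le> t" "t0 \<le> t" by auto
        have "poly q x = poly ?p x" unfolding t(1) using q t(3) val[OF t(2)] by simp
        then show "x \<in> {x. poly (q - ?p) x = 0}" by (simp only: mem_Collect_eq poly_diff diff_self)
      qed
      ultimately have "finite (of_nat ` {max d t0..} :: rat set)" by (rule finite_subset[rotated])
      then have "finite {max d t0..}" by (rule finite_imageD) (simp add: inj_on_def)
      then show False by (simp add: infinite_Ici)
    qed
  qed
qed

lemma prime_idealD:
  assumes "prime_ideal P" shows "is_ideal P" "1 \<notin> P" "f * g \<in> P \<Longrightarrow> f \<in> P \<or> g \<in> P"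
  using assms unfolding prime_ideal_def by auto

lemma prime_ideal_power: "prime_ideal P \<Longrightarrow> f \<notin> P \<Longrightarrow> f ^ k \<notin> P"
  by (induction k) (auto dest: prime_idealD)

text \<open>Some element of P' has a component outside P; this form and its powers are
  nonzerodivisors modulo P. All multiples of its degree \<open>e\<close> are recorded so that two
  inclusions can later be given a common step.\<close>

lemma hilbert_function_prime_growth:
  assumes P: "prime_ideal P" "homogeneous_ideal P" and P': "homogeneous_ideal P'" "P \<subset> P'"
  shows "\<exists>e. \<forall>j t. hilbert_function P' (t + Suc j * e) + hilbert_function P t \<le> hilbert_function P (t + Suc j * e)"
proof -
  obtain f where f: "f \<in> P'" "f \<notin> P" using P'(2) by auto
  have "\<not> (\<forall>t. hc t f \<in> P)" using f(2) homogeneous_ideal_mem_iff[OF P(2), of f] by simp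
  then obtain e where e: "hc e f \<notin> P" unfolding not_all by (rule exE)
  define g where "g = hc e f"
  have g: "g \<in> forms e" "g \<in> P'" "g \<notin> P" using e homogeneous_idealD(2)[OF P'(1) f(1)] by (auto simp: g_def)
  have "hilbert_function P' (t + Suc j * e) + hilbert_function P t \<le> hilbert_function P (t + Suc j * e)" for j t
  proof (rule hilbert_function_nonzerodivisor_le[where g = "g ^ Suc j"])
    show "is_ideal P" "is_ideal P'" using homogeneous_idealD(1) P(2) P'(1) by auto
    show "P \<subseteq> P'" using P'(2) by auto
    show "g ^ Suc j \<in> forms (Suc j * e)" by (rule forms_power[OF g(1)])
    show "g ^ Suc j \<in> P'" using ideal_mult_left[OF homogeneous_idealD(1)[OF P'(1)] g(2)] by simp
    show "h \<in> P" if "h \<in> forms t" "g ^ Suc j * h \<in> P" for h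
      using prime_idealD(3)[OF P(1) that(2)] prime_ideal_power[OF P(1) g(3), of "Suc j"] by auto
  qed
  then show ?thesis by (intro exI[of _ e] allI)
qed

text \<open>
  Three nested relevant primes would force quadratic growth of the Hilbert function.
\<close>

lemma no_three_primes_if_linear_growth:
  fixes J :: "('k::field, 'n::finite) mpol set"
  assumes J: "is_ideal J" and lin: "\<And>t. hilbert_function J t \<le> A + s * t"
    and P: "P0 \<in> proj_points J" "P1 \<in> proj_points J" "P2 \<in> proj_points J" "P0 \<subset> P1" "P1 \<subset> P2"
  shows False
proof -
  have prime: "prime_ideal P0" "prime_ideal P1" "prime_ideal P2"
    and hom: "homogeneous_ideal P0" "homogeneous_ideal P1" "homogeneous_ideal P2"
    and JP: "J \<subseteq> P0" and rel: "\<not> range Var \<subseteq> P2"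
    using P by (simp_all add: proj_points_def)
  from hilbert_function_prime_growth[OF prime(1) hom(1) hom(2) P(4)]
  obtain e0 where "\<forall>j t. hilbert_function P1 (t + Suc j * e0) + hilbert_function P0 t
    \<le> hilbert_function P0 (t + Suc j * e0)" by (rule exE)
  then have e0: "hilbert_function P1 (t + Suc j * e0) + hilbert_function P0 t
    \<le> hilbert_function P0 (t + Suc j * e0)" for j t by simp
  from hilbert_function_prime_growth[OF prime(2) hom(2) hom(3) P(5)]
  obtain e1 where "\<forall>j t. hilbert_function P2 (t + Suc j * e1) + hilbert_function P1 t
    \<le> hilbert_function P1 (t + Suc j * e1)" by (rule exE)
  then have e1: "hilbert_function P2 (t + Suc j * e1) + hilbert_function P1 t
    \<le> hilbert_function P1 (t + Suc j * e1)" for j t by simp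
  have h2: "1 \<le> hilbert_function P2 t" for t
  proof -
    obtain v where v: "Var v \<notin> P2" using rel by auto
    have "Var v ^ t \<in> forms t" using forms_power[OF forms_Var(1), of v t] by simp
    then have "\<not> forms t \<subseteq> P2" using prime_ideal_power[OF prime(3) v, of t] by auto
    then have "hilbert_function P2 t \<noteq> 0" using hilbert_function_eq_0_iff[OF prime_idealD(1)[OF prime(3)]] by simp
    then show ?thesis by simp
  qed
  show False
  proof (cases "e0 = 0 \<or> e1 = 0")
    \<comment> \<open>A step of 0 would make the Hilbert function of P1 or P2 vanish in degree 0,
      although neither prime contains R_0.\<close>
    case True
    have "hilbert_function P1 0 \<noteq> 0"
    proof -
      have "\<not> forms 0 \<subseteq> P1" using prime_idealD(2)[OF prime(2)] subsetD[OF _ forms_1, of P1] by auto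
      then show ?thesis using hilbert_function_eq_0_iff[OF prime_idealD(1)[OF prime(2)]] by simp
    qed
    then show False using True e0[where j = 0 and t = 0] e1[where j = 0 and t = 0] h2[of 0] by auto
  next
    case False
    \<comment> \<open>A common multiple of both degrees, so that the two growth inequalities advance
      in equal steps.\<close>
    define E where "E = e0 * e1"
    have Suc1: "Suc (e1 - 1) = e1" and Suc0: "Suc (e0 - 1) = e0" using False by auto
    have E0: "hilbert_function P1 (t + E) + hilbert_function P0 t \<le> hilbert_function P0 (t + E)" for t
      using e0[where j = "e1 - 1" and t = t] unfolding Suc1 E_def by (simp only: mult.commute)
    have E1: "hilbert_function P2 (t + E) + hilbert_function P1 t \<le> hilbert_function P1 (t + E)" for t
      using e1[where j = "e0 - 1" and t = t] unfolding Suc0 E_def by (simp only: mult.commute)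
    have g1: "k \<le> hilbert_function P1 (k * E)" for k
    proof (induction k)
      case (Suc k)
      then show ?case using E1[of "k * E"] h2[of "k * E + E"] by (simp add: add.commute)
    qed simp
    \<comment> \<open>Summation of \<open>g1\<close> gives 1 + 2 + ... + k; the factor 2 avoids a
      division.\<close>
    have g0: "k * k + k \<le> 2 * hilbert_function P0 (k * E)" for k
    proof (induction k)
      case (Suc k)
      have "Suc k \<le> hilbert_function P1 (k * E + E)" using g1[of "Suc k"] by (simp add: add.commute)
      with E0[of "k * E"] Suc show ?case by (simp add: add.commute)
    qed simp
    \<comment> \<open>Large enough for k^2 + k to exceed twice the linear bound A + s k E.\<close>
    define k where "k = 2 * A + 2 * s * E + 1"
    have "k * k + k \<le> 2 * hilbert_function P0 (k * E)" by (rule g0)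
    also have "hilbert_function P0 (k * E) \<le> hilbert_function J (k * E)"
      by (rule hilbert_function_antimono[OF J prime_idealD(1)[OF prime(1)]]) (use JP in auto)
    also have "\<dots> \<le> A + s * (k * E)" by (rule lin)
    finally have "k * k + k \<le> 2 * A + 2 * s * E * k" by (simp add: algebra_simps)
    moreover have "k * k = 2 * A * k + 2 * s * E * k + k" by (simp add: k_def algebra_simps)
    moreover have "2 * A \<le> 2 * A * k" by (simp add: k_def)
    moreover have "0 < k" by (simp add: k_def)
    ultimately show False by linarith
  qed
qed

text \<open>P1 is a relevant prime above (J, l). P0 takes the role of a minimal prime of J below P1:
  it avoids all products of a form outside P1 with a power of l, hence lies in P1 and does not
  contain l.\<close>

lemma two_primes_through_nonzerodivisor:
  fixes J :: "('k::field_char_0, 'n::finite) mpol set"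
  assumes J: "homogeneous_ideal J" and l: "l \<in> forms 1" and nzd: "\<And>f. l * f \<in> J \<Longrightarrow> f \<in> J"
    and inf: "\<And>t. \<not> forms t \<subseteq> ideal_gen (insert l J)"
  obtains P0 P1 where "P0 \<in> proj_points J" "P1 \<in> proj_points J" "P0 \<subset> P1"
proof -
  let ?K = "ideal_gen (insert l J)"
  have "never_artinian 0 ?K" unfolding never_artinian_def using inf by (simp add: linear_forms_eq ring_ideal.span_span)
  then obtain P1 where P1: "P1 \<in> proj_points ?K"
    using never_artinian_prime[OF homogeneous_ideal_gen_insert[OF J l]] by metis
  have JK: "J \<subseteq> ?K" "l \<in> ?K" using ring_ideal.span_superset[of "insert l J"] by auto
  have P1J: "P1 \<in> proj_points J" using subsetD[OF proj_points_antimono[OF JK(1)] P1] .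
  have p1: "prime_ideal P1" "homogeneous_ideal P1" "l \<in> P1" "J \<subseteq> P1" "\<not> range Var \<subseteq> P1"
    using P1 P1J JK(2) by (auto simp: proj_points_def)
  \<comment> \<open>Multiplicatively closed, and disjoint from J because l is a nonzerodivisor
    modulo J and J lies in P1.\<close>
  define W where "W = {w * l ^ k | w k. w \<notin> P1 \<and> (\<exists>t. w \<in> forms t)}"
  have nzdk: "f \<in> J" if "f * l ^ k \<in> J" for f k
    using that
  proof (induction k)
    case (Suc k)
    have "l * (f * l ^ k) \<in> J" using Suc.prems by (simp only: power_Suc mult.left_commute)
    then show ?case by (rule Suc.IH[OF nzd])
  qed simp
  have 1: "W \<inter> J = {}"
  proof (rule ccontr)
    assume "W \<inter> J \<noteq> {}"
    then obtain w k where "w \<notin> P1" "w * l ^ k \<in> J" unfolding W_def by auto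
    then show False using nzdk p1(4) by auto
  qed
  have WI: "w * l ^ k \<in> W" if "w \<notin> P1" "w \<in> forms t" for w k t using that unfolding W_def by auto
  have one: "1 \<notin> P1" using prime_idealD(2)[OF p1(1)] .
  have 2: "1 \<in> W" using WI[OF one forms_1, of 0] by simp
  have 3: "x * z \<in> W" if xz: "x \<in> W" "z \<in> W" for x z
  proof -
    obtain w k s where x: "x = w * l ^ k" "w \<notin> P1" "w \<in> forms s" using xz(1) unfolding W_def by auto
    obtain w' k' t where z: "z = w' * l ^ k'" "w' \<notin> P1" "w' \<in> forms t" using xz(2) unfolding W_def by auto
    have "w * w' \<notin> P1" using prime_idealD(3)[OF p1(1)] x(2) z(2) by auto
    from WI[OF this forms_mult[OF x(3) z(3)], of "k + k'"]
    have "w * w' * (l ^ k * l ^ k') \<in> W" unfolding power_add .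
    moreover have "x * z = w * w' * (l ^ k * l ^ k')" unfolding x(1) z(1) by (simp only: mult_ac)
    ultimately show ?thesis by (simp only:)
  qed
  obtain P0 where P0: "homogeneous_ideal P0" "prime_ideal P0" "J \<subseteq> P0" "W \<inter> P0 = {}"
    by (rule homogeneous_prime_avoiding[OF J 1 2 3])
  have "P0 \<subseteq> P1"
  proof
    fix f assume f: "f \<in> P0"
    have "hc t f \<in> P1" for t
    proof (rule ccontr)
      assume "hc t f \<notin> P1"
      then have "hc t f \<in> W" using WI[OF _ hc_in_forms, of t f 0] by simp
      then show False using P0(4) homogeneous_idealD(2)[OF P0(1) f] by auto
    qed
    then show "f \<in> P1" by (rule iffD2[OF homogeneous_ideal_mem_iff[OF p1(2)], OF allI])
  qed
  moreover have "l \<in> W" using WI[OF one forms_1, of 1] by simp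
  then have "l \<notin> P0" using P0(4) by (metis disjoint_iff)
  then have "P0 \<noteq> P1" using p1(3) by metis
  ultimately have "P0 \<subset> P1" by (rule psubsetI)
  moreover have "\<not> range Var \<subseteq> P0"
  proof
    assume "range Var \<subseteq> P0"
    also note \<open>P0 \<subseteq> P1\<close>
    finally show False using p1(5) by simp
  qed
  then have "P0 \<in> proj_points J" unfolding proj_points_def mem_Collect_eq by (intro conjI P0)
  ultimately show ?thesis using P1J by (intro that)
qed

section \<open>Truncations of a saturated ideal\<close>

lemma truncated_ideal_subset: "is_ideal I \<Longrightarrow> truncated_ideal d I \<subseteq> I"
  unfolding truncated_ideal_def by (rule ring_ideal.span_minimal) auto

lemma truncated_ideal_memI: "f \<in> I \<Longrightarrow> f \<in> forms t \<Longrightarrow> t \<le> d \<Longrightarrow> f \<in> truncated_ideal d I"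
  unfolding truncated_ideal_def by (rule ring_ideal.span_base) (auto simp: polys_le_def forms_def)

lemma mem_ideal_if_power_mult:
  assumes nzd: "\<And>t f. d \<le> t \<Longrightarrow> f \<in> forms t \<Longrightarrow> l * f \<in> J \<Longrightarrow> f \<in> J"
    and l: "l \<in> forms 1" and f: "f \<in> forms t" "d \<le> t" "l ^ k * f \<in> J"
  shows "f \<in> J"
  using f(3)
proof (induction k)
  case (Suc k)
  have "l * (l ^ k * f) \<in> J" using Suc.prems by (simp only: power_Suc mult.assoc)
  moreover have "l ^ k * f \<in> forms (k + t)" using forms_mult[OF forms_power[OF l, of k] f(1)] by simp
  moreover have "d \<le> k + t" using f(2) by simp
  ultimately show ?case using nzd[of "k + t" "l ^ k * f"] Suc.IH by simp
qed simp

text \<open>Up to degree \<open>d\<close> the truncation agrees with the saturated ideal I; above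
  \<open>d\<close>, a power of l that carries a form into the truncation can be cancelled.\<close>

lemma saturated_truncated_ideal:
  fixes I :: "('k::field, 'n::finite) mpol set"
  assumes I: "saturated_ideal I" and J: "homogeneous_ideal (truncated_ideal d I)" and l: "l \<in> forms 1"
    and nzd: "\<And>t f. d \<le> t \<Longrightarrow> f \<in> forms t \<Longrightarrow> l * f \<in> truncated_ideal d I \<Longrightarrow> f \<in> truncated_ideal d I"
  shows "saturated_ideal (truncated_ideal d I)"
proof -
  let ?J = "truncated_ideal d I"
  have iI: "is_ideal I" and satI: "saturation I = I"
    using I homogeneous_idealD(1) by (auto simp: saturated_ideal_def)
  note iJ = homogeneous_idealD(1)[OF J]
  have "saturation ?J \<subseteq> ?J"
  proof
    fix f assume "f \<in> saturation ?J"
    then obtain k where k: "\<forall>g\<in>forms k. g * f \<in> ?J" unfolding saturation_def by auto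
    have gh: "g * hc t f \<in> ?J" if g: "g \<in> forms k" for g t
      using homogeneous_idealD(2)[OF J bspec[OF k g], of "k + t"] unfolding hc_mult_add[OF g] .
    have "hc t f \<in> ?J" for t
    proof (cases "t \<le> d")
      case True
      have "\<forall>g\<in>forms k. g * hc t f \<in> I" using gh truncated_ideal_subset[OF iI, of d] by auto
      then have "hc t f \<in> saturation I" unfolding saturation_def by auto
      then have "hc t f \<in> I" unfolding satI .
      then show ?thesis using hc_in_forms True by (rule truncated_ideal_memI)
    next
      case False
      have "l ^ k * hc t f \<in> ?J" by (rule gh) (use forms_power[OF l, of k] in simp)
      then show ?thesis by (intro mem_ideal_if_power_mult[OF nzd l hc_in_forms]) (use False in auto)
    qed
    then show "f \<in> ?J" by (rule iffD2[OF homogeneous_ideal_mem_iff[OF J], OF allI])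
  qed
  moreover have "?J \<subseteq> saturation ?J" unfolding saturation_def using ideal_mult_right[OF iJ] by auto
  ultimately show ?thesis using J by (simp add: saturated_ideal_def)
qed

text \<open>Multiplying f by all forms of degree d - t moves the question to degree
  \<open>d\<close>; saturation brings the answer back.\<close>

lemma nonzerodivisor_if_high_degree:
  fixes J :: "('k::field, 'n::finite) mpol set"
  assumes J: "saturated_ideal J" and l: "l \<in> forms 1"
    and nzd: "\<And>f. f \<in> forms d \<Longrightarrow> l * f \<in> J \<Longrightarrow> f \<in> J"
    and f: "f \<in> forms t" "t \<le> d" "l * f \<in> J"
  shows "f \<in> J"
proof -
  have iJ: "is_ideal J" and sat: "saturation J = J"
    using J homogeneous_idealD(1) by (auto simp: saturated_ideal_def)
  have "g * f \<in> J" if g: "g \<in> forms (d - t)" for g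
  proof (rule nzd)
    show "g * f \<in> forms d" using forms_mult[OF g f(1)] f(2) by simp
    show "l * (g * f) \<in> J" using ideal_mult_right[OF iJ f(3), of g] by (simp only: mult.left_commute)
  qed
  then have "f \<in> saturation J" unfolding saturation_def by auto
  then show ?thesis unfolding sat .
qed

lemma regular_system_exists:
  fixes l1 l2 :: "('k::field, 'n::finite) mpol"
  assumes l: "l1 \<in> forms 1" "l2 \<in> forms 1"
    and ind: "\<And>a b. Const a * l1 + Const b * l2 = 0 \<Longrightarrow> a = 0 \<and> b = 0"
  shows "\<exists>y. y 0 = l1 \<and> y (1::nat) = l2 \<and> CARD('n) \<ge> 2 \<and> regular_system y CARD('n)"
proof (rule two_forms_extend_regular[OF l])
  show "a = 0 \<and> b = 0" if "Const a * l1 + Const b * l2 = 0" for a b by (rule ind[OF that])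
  fix y assume y: "y 0 = l1" "y (1::nat) = l2" "CARD('n) \<ge> 2"
    and y': "\<And>i. i < CARD('n) \<Longrightarrow> y i \<in> forms 1"
    "\<And>v. Var v \<in> ideal_gen (y ` {..<CARD('n)})"
    "\<And>i f. i < CARD('n) \<Longrightarrow> y i * f \<in> ideal_gen (y ` {..<i}) \<Longrightarrow> f \<in> ideal_gen (y ` {..<i})"
  have "regular_system y CARD('n)" by (rule regular_system.intro) (fact y')+
  with y show "\<exists>y. y 0 = l1 \<and> y (1::nat) = l2 \<and> CARD('n) \<ge> 2 \<and> regular_system y CARD('n)"
    by (intro exI[of _ y] conjI)
qed

theorem theorem4p2:
  fixes I :: "('k::field_char_0, 'n::finite) mpol set"
    and d :: nat and s :: int
  assumes "CARD('n) \<ge> 3"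
    and "saturated_ideal I"
    and "scheme_dim I \<le> 1"
    and "d > reduction_number 2 I"
    and "delta_hilbert I d = s"
    and "delta_hilbert I (d + 1) = s"
    and "s \<noteq> 0"
  shows "regular_ideal d (truncated_ideal d I) \<and>
         saturated_ideal (truncated_ideal d I) \<and>
         scheme_dim (truncated_ideal d I) = 1 \<and>
         scheme_degree (truncated_ideal d I) = of_int s"
proof -

  \<comment> \<open>The two linear forms, and s as a value of Hilbert functions\<close>
  have hI: "homogeneous_ideal I" using assms(2) by (simp add: saturated_ideal_def)
  note iI = homogeneous_idealD(1)[OF hI]
  \<comment> \<open>For I = R no number satisfies the description of
    \<open>reduction_number\<close>; s being nonzero excludes this case.\<close>
  have one: "1 \<notin> I"
  proof
    assume "1 \<in> I"
    then have "forms t \<subseteq> I" for t using ideal_mult_right[OF iI, of 1] by auto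
    then have h0: "hilbert_function I t = 0" for t using hilbert_function_eq_0_iff[OF iI] by simp
    show False using assms(5,7) by (simp add: delta_hilbert_def h0 split: if_splits)
  qed
  obtain l1 l2 where l: "l1 \<in> forms 1" "l2 \<in> forms 1" and fdI: "forms d \<subseteq> ideal_gen (I \<union> {l1, l2})"
    and injd: "\<And>f. f \<in> forms d \<Longrightarrow> l1 * f \<in> I \<Longrightarrow> f \<in> I"
    by (rule general_linear_forms_exist[OF assms(2,3) one assms(4)]) (rule that)
  \<comment> \<open>Since d > 0, the difference at \<open>d\<close> involves degree d - 1, where
    injectivity of l1 follows from degree \<open>d\<close> by saturation.\<close>
  obtain d' where d': "d = Suc d'" using assms(4) by (cases d) auto
  let ?J = "truncated_ideal d I"
  let ?KI = "ideal_gen (insert l1 I)" and ?K = "ideal_gen (insert l1 ?J)"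
  let ?h = hilbert_function
  have sKI: "int (?h ?KI d) = s" "int (?h ?KI (Suc d)) = s"
  proof -
    have "f \<in> I" if "f \<in> forms d'" "l1 * f \<in> I" for f
      using nonzerodivisor_if_high_degree[OF assms(2) l(1) injd that(1) _ that(2)] d' by simp
    from hilbert_function_hyperplane_section[OF hI l(1) this]
    have "?h ?KI d + ?h I d' = ?h I d" using d' by simp
    then show "int (?h ?KI d) = s" using assms(5) d' by (simp add: delta_hilbert_def)
    from hilbert_function_hyperplane_section[OF hI l(1) injd]
    have "?h ?KI (Suc d) + ?h I d = ?h I (Suc d)" by simp
    then show "int (?h ?KI (Suc d)) = s" using assms(6) by (simp add: delta_hilbert_def)
  qed
  have JI: "?J \<subseteq> I" by (rule truncated_ideal_subset[OF iI])
  have KKI: "?K \<subseteq> ?KI" by (rule ring_ideal.span_mono) (use JI in auto)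
  \<comment> \<open>J and I agree in degree \<open>d\<close>, hence so do (J, l1) and (I, l1); in
    degree d + 1 only an inclusion is available.\<close>
  have hd: "?h ?K d = ?h ?KI d"
  proof (rule hilbert_function_cong)
    show "?K \<inter> forms d = ?KI \<inter> forms d"
    proof
      show "?K \<inter> forms d \<subseteq> ?KI \<inter> forms d" using KKI by auto
      show "?KI \<inter> forms d \<subseteq> ?K \<inter> forms d"
      proof
        fix w assume "w \<in> ?KI \<inter> forms d"
        then have w: "w \<in> ?KI" "w \<in> forms d" by auto
        have "w \<in> forms (d' + 1)" using w(2) d' by simp
        then obtain v where v: "v \<in> forms d'" "w - l1 * v \<in> I"
          using ideal_gen_insert_forms[OF hI l(1) w(1)] by auto
        have "l1 * v \<in> forms d" using forms_mult[OF l(1) v(1)] d' by simp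
        then have "w - l1 * v \<in> ?J" using truncated_ideal_memI[OF v(2) forms_diff[OF w(2)]] by simp
        then have "\<exists>v. w - l1 * v \<in> ?J" by (rule exI)
        then have "w \<in> ?K" using ideal_gen_insert_iff[of ?J w l1] by (simp add: truncated_ideal_def)
        with w(2) show "w \<in> ?K \<inter> forms d" by (rule IntI[rotated])
      qed
    qed
  qed simp_all
  have sK: "int (?h ?K d) = s" using hd sKI(1) by simp
  have fdJ: "forms d \<subseteq> ideal_gen (?J \<union> {l1, l2})"
  proof
    fix f :: "('k, 'n) mpol" assume f: "f \<in> forms d"
    then obtain p z where pz: "f = p + z" "p \<in> I" "z \<in> ideal_gen {l1, l2}"
      using fdI unfolding ideal_gen_Un[OF iI] by auto
    have "homogeneous_ideal (ideal_gen {l1, l2})" by (rule homogeneous_ideal_gen) (use l in auto)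
    then have "hc d z \<in> ideal_gen {l1, l2}" using pz(3) by (rule homogeneous_idealD(2))
    then have 1: "hc d z \<in> ideal_gen (?J \<union> {l1, l2})"
      using ring_ideal.span_mono[of "{l1, l2}" "?J \<union> {l1, l2}"] by auto
    have "hc d p \<in> ?J"
      by (rule truncated_ideal_memI[OF homogeneous_idealD(2)[OF hI pz(2)] hc_in_forms order_refl])
    then have 2: "hc d p \<in> ideal_gen (?J \<union> {l1, l2})" by (intro ring_ideal.span_base) simp
    have "f = hc d p + hc d z" using hc_forms[OF f, of d] pz(1) by (simp add: hc_add)
    then show "f \<in> ideal_gen (?J \<union> {l1, l2})" using ring_ideal.span_add[OF 2 1] by simp
  qed
  \<comment> \<open>If l2 were a multiple of l1, then R/(J, l1) would vanish in degree
    \<open>d\<close>; if l1 were 0, then R/I would. Either way s would be 0.\<close>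
  have ind: "a = 0 \<and> b = 0" if ab: "Const a * l1 + Const b * l2 = 0" for a b
  proof -
    have b: "b = 0"
    proof (rule ccontr)
      assume b: "b \<noteq> 0"
      have "Const (inverse b) * (Const a * l1 + Const b * l2) = 0" using ab by simp
      then have "Const (inverse b * a) * l1 + l2 = 0"
        using b by (simp add: distrib_left flip: mult.assoc Const_mult)
      then have "l2 = - (Const (inverse b * a) * l1)" by (simp add: eq_neg_iff_add_eq_0 add.commute)
      moreover have "- (Const (inverse b * a) * l1) \<in> ?K"
        by (intro ring_ideal.span_neg ring_ideal.span_scale ring_ideal.span_base) simp
      ultimately have "l2 \<in> ?K" by simp
      have "ideal_gen (?J \<union> {l1, l2}) \<subseteq> ?K"
      proof (rule ring_ideal.span_minimal)
        show "?J \<union> {l1, l2} \<subseteq> ?K"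
          using ring_ideal.span_superset[of "insert l1 ?J"] \<open>l2 \<in> ?K\<close> by auto
      qed simp
      then have "forms d \<subseteq> ?K" using fdJ by simp
      then have "?h ?K d = 0" using hilbert_function_eq_0_iff[of ?K d] by simp
      then show False using sK assms(7) by simp
    qed
    have "a = 0"
    proof (rule ccontr)
      assume "a \<noteq> 0"
      then have "l1 = 0" using ab b by simp
      then have "forms d \<subseteq> I" using injd ring_ideal.subspace_0[OF iI] by auto
      also have "I \<subseteq> ?KI" using ring_ideal.span_superset[of "insert l1 I"] by auto
      finally have "?h ?KI d = 0" using hilbert_function_eq_0_iff[of ?KI d] by simp
      then show False using sKI(1) assms(7) by simp
    qed
    with b show ?thesis by simp
  qed
  have "\<exists>y. y 0 = l1 \<and> y (1::nat) = l2 \<and> CARD('n) \<ge> 2 \<and> regular_system y CARD('n)"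
    by (rule regular_system_exists[OF l]) (rule ind)
  then obtain y where y: "y 0 = l1" "y (1::nat) = l2" "CARD('n) \<ge> 2" "regular_system y CARD('n)"
    by (elim exE conjE)
  interpret regular_system y "CARD('n)" by (rule y(4))

  \<comment> \<open>Colon conditions in degree d, regularity and saturation\<close>
  have hJ: "homogeneous_ideal ?J" by (rule truncated_ideal_homogeneous[OF hI])
  note iJ = homogeneous_idealD(1)[OF hJ]
  \<comment> \<open>The congruences in \<open>colon_cond\<close> are memberships in (J, y_0, ...,
    y_(i-1)).\<close>
  have JY: "(\<exists>p\<in>?J. f - p \<in> Y i) \<longleftrightarrow> f \<in> ideal_gen (?J \<union> y ` {..<i})" for f i
  proof -
    have "f \<in> ideal_gen (?J \<union> y ` {..<i}) \<longleftrightarrow> (\<exists>p z. f = p + z \<and> p \<in> ?J \<and> z \<in> Y i)"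
      unfolding ideal_gen_Un[OF iJ] Y_def by simp
    also have "\<dots> \<longleftrightarrow> (\<exists>p\<in>?J. f - p \<in> Y i)"
      by (metis add_diff_cancel_left' add.commute diff_add_cancel)
    finally show ?thesis by simp
  qed
  have JY0: "(\<exists>p\<in>?J. f - p \<in> Y 0) \<longleftrightarrow> f \<in> ?J" for f
    unfolding JY by (simp add: truncated_ideal_def ring_ideal.span_span)
  have JY1: "(\<exists>p\<in>?J. f - p \<in> Y 1) \<longleftrightarrow> f \<in> ?K" for f
    unfolding JY by (simp add: y(1) lessThan_Suc)
  have surj: "\<exists>v\<in>forms t. w - l2 * v \<in> ?K" if t: "d \<le> t" and w: "w \<in> forms (t + 1)" for t w
  proof -
    have "forms (t + 1) \<subseteq> ideal_gen (?J \<union> {l1, l2})"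
      by (rule forms_subset_mono[OF _ fdJ]) (use t in simp_all)
    also have "\<dots> \<subseteq> ideal_gen (insert l2 ?K)"
      by (rule ring_ideal.span_mono) (use ring_ideal.span_superset[of "insert l1 ?J"] in auto)
    finally have "w \<in> ideal_gen (insert l2 ?K)" using w by auto
    from ideal_gen_insert_forms[OF homogeneous_ideal_gen_insert[OF hJ l(1)] l(2) this w]
    show ?thesis by metis
  qed
  have l2K: "l2 * f \<in> ?K" if "f \<in> ?K" for f by (rule ideal_mult_right[OF _ that]) simp
  have iK: "is_ideal ?K" by simp
  have colon: "colon_cond ?J i d" if i: "i < CARD('n)" for i
  proof -
    consider "i = 0" | "i = 1" | "i \<ge> 2" by linarith
    then show ?thesis
    proof cases
      case 1
      show ?thesis unfolding 1 colon_cond_def JY0 y(1)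
      proof (intro ballI impI)
        fix f assume "f \<in> forms d" "l1 * f \<in> ?J"
        then show "f \<in> ?J" using truncated_ideal_memI[OF injd] JI by auto
      qed
    next
      case 2
      have le: "?h ?K d \<le> ?h ?K (d + 1)"
      proof -
        have "?h ?KI (Suc d) \<le> ?h ?K (Suc d)"
          by (rule hilbert_function_antimono[OF iK]) (use KKI in auto)
        then show ?thesis using sK sKI(2) by simp
      qed
      show ?thesis unfolding 2 colon_cond_def JY1 y(2)
      proof (intro ballI impI)
        fix f assume f: "f \<in> forms d" "l2 * f \<in> ?K"
        show "f \<in> ?K" by (rule mult_inj_if_surj[OF iK iK l(2) l2K surj[OF order_refl] le f])
      qed
    next
      case 3
      \<comment> \<open>From i = 2 on, the ideal contains all of R_d, so the colon condition in
        degree \<open>d\<close> is trivial.\<close>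
      have "?J \<union> {l1, l2} \<subseteq> ?J \<union> y ` {..<i}"
        using 3 y(1,2) by (auto intro: image_eqI[of _ y 0] image_eqI[of _ y 1])
      then have fd: "forms d \<subseteq> ideal_gen (?J \<union> y ` {..<i})"
        by (intro order_trans[OF fdJ] ring_ideal.span_mono)
      show ?thesis unfolding colon_cond_def JY by (intro ballI impI subsetD[OF fd])
    qed
  qed
  have cut: "cut_cond ?J i t" if "i \<le> CARD('n)" "d < t" for i t
    by (rule cut_cond_truncated[OF hI colon that(2,1)])
  have reg: "regular_ideal d ?J" by (rule regular_ideal_if_cut_cond[OF hJ cut])
  have colon_t: "colon_cond ?J i t" if "i < CARD('n)" "d \<le> t" for i t
    by (rule colon_cond_if_cut_cond[OF hJ cut that(1)]) (use that in simp_all)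
  have nzd_t: "f \<in> ?J" if "d \<le> t" "f \<in> forms t" "l1 * f \<in> ?J" for t f
  proof -
    have "0 < CARD('n)" using y(3) by linarith
    from colon_t[OF this that(1)] that(2,3) show ?thesis unfolding colon_cond_def JY0 y(1) by auto
  qed
  have sat: "saturated_ideal ?J" by (rule saturated_truncated_ideal[OF assms(2) hJ l(1) nzd_t])
  have nzd_forms: "f \<in> ?J" if "f \<in> forms t" "l1 * f \<in> ?J" for t f
  proof (cases "d \<le> t")
    case True
    then show ?thesis using that by (rule nzd_t)
  next
    case False
    then show ?thesis
      using nonzerodivisor_if_high_degree[OF sat l(1) nzd_t[OF order_refl] that(1) _ that(2)] by simp
  qed
  have nzd: "f \<in> ?J" if "l1 * f \<in> ?J" for f
  proof (rule iffD2[OF homogeneous_ideal_mem_iff[OF hJ], OF allI])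
    fix t
    have "l1 * hc t f \<in> ?J"
      using homogeneous_idealD(2)[OF hJ that, of "1 + t"] unfolding hc_mult_add[OF l(1)] .
    with hc_in_forms show "hc t f \<in> ?J" by (rule nzd_forms)
  qed

  \<comment> \<open>Hilbert polynomial, degree and dimension of the truncation\<close>
  have hK: "?h ?K t = ?h ?K d" if "d \<le> t" for t
    using that
  proof (induction t rule: dec_induct)
    case (step t)
    have "1 < CARD('n)" using y(3) by linarith
    from colon_t[OF this step.hyps(1)]
    have inj: "f \<in> ?K" if "f \<in> forms t" "l2 * f \<in> ?K" for f
      using that unfolding colon_cond_def JY1 y(2) by auto
    \<comment> \<open>Multiplication by l2 is bijective from degree \<open>t\<close> to t + 1:
      injective by the colon condition for i = 1, surjective because R_(t+1) lies in (J, l1,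
      l2).\<close>
    have "?h ?K t \<le> ?h ?K (t + 1)" by (rule hilbert_function_le_if_mult_inj[OF iK iK l(2) inj])
    moreover have "?h ?K (t + 1) \<le> ?h ?K t"
      by (rule hilbert_function_le_if_mult_surj[OF iK iK l(2) l2K surj[OF step.hyps(1)]])
    ultimately show ?case using step.IH by simp
  qed simp
  have hstep: "?h ?J (Suc t) = ?h ?J t + nat s" if "d \<le> t" for t
  proof -
    have "?h ?K (t + 1) + ?h ?J t = ?h ?J (t + 1)"
      by (rule hilbert_function_hyperplane_section[OF hJ l(1) nzd_forms])
    moreover have "?h ?K (t + 1) = nat s" using hK[of "t + 1"] that sK by simp
    ultimately show ?thesis by simp
  qed
  have s0: "s > 0" using sK assms(7) by linarith
  have "hilbert_polynomial ?J = [:of_nat (?h ?J d) - of_nat (nat s) * of_nat d, of_nat (nat s):]"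
    by (rule hilbert_polynomial_linear[OF hstep])
  moreover have "(of_nat (nat s) :: rat) = of_int s" using s0 by simp
  ultimately have deg: "scheme_degree ?J = of_int s" using s0 unfolding scheme_degree_def by simp
  have inf: "\<not> forms t \<subseteq> ?K" for t
  proof
    assume "forms t \<subseteq> ?K"
    then have "forms (max t d) \<subseteq> ?K" by (rule forms_subset_mono[OF iK]) simp
    then have "?h ?K (max t d) = 0" using hilbert_function_eq_0_iff[OF iK] by simp
    then show False using hK[of "max t d"] sK assms(7) by simp
  qed
  obtain P0 P1 where P: "P0 \<in> proj_points ?J" "P1 \<in> proj_points ?J" "P0 \<subset> P1"
    by (rule two_primes_through_nonzerodivisor[OF hJ l(1) nzd inf])
  have "ereal (real 1) \<le> scheme_dim ?J"
    by (rule scheme_dim_geI[where P = "\<lambda>i. if i = 0 then P0 else P1"]) (use P in auto)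
  moreover have "scheme_dim ?J \<le> 1" unfolding scheme_dim_def
  proof (rule SUP_least)
    fix k :: nat
    assume "k \<in> {k. \<exists>P. (\<forall>i\<le>k. P i \<in> proj_points ?J) \<and> (\<forall>i<k. P i \<subset> P (Suc i))}"
    then obtain Q where Q: "\<forall>i\<le>k. Q i \<in> proj_points ?J" "\<forall>i<k. Q i \<subset> Q (Suc i)"
      unfolding mem_Collect_eq by (elim exE conjE)
    have "k \<le> 1"
    proof (rule ccontr)
      assume k: "\<not> k \<le> 1"
      \<comment> \<open>Growth by s is known from degree \<open>d\<close> on; the sum of the values
        up to \<open>d\<close> bounds the initial segment, so that the estimate holds for all
        t.\<close>
      have lin: "?h ?J t \<le> (\<Sum>i\<le>d. ?h ?J i) + nat s * t" for t
      proof (cases "t \<le> d")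
        case True
        then have "?h ?J t \<le> (\<Sum>i\<le>d. ?h ?J i)" by (intro member_le_sum) auto
        then show ?thesis by simp
      next
        case False
        then have "d \<le> t" by simp
        then show ?thesis
        proof (induction t rule: dec_induct)
          case base
          have "?h ?J d \<le> (\<Sum>i\<le>d. ?h ?J i)" by (intro member_le_sum) auto
          then show ?case by simp
        next
          case (step t)
          then show ?case using hstep[of t] by simp
        qed
      qed
      show False
        by (rule no_three_primes_if_linear_growth[OF iJ lin, of "Q 0" "Q (Suc 0)" "Q (Suc (Suc 0))"])
          (use Q k in simp_all)
    qed
    then show "ereal (real k) \<le> 1" by (simp add: one_ereal_def)
  qed
  ultimately have "scheme_dim ?J = 1" by (simp add: one_ereal_def)
  with reg sat deg show ?thesis by simp
qed

end
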